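(* Let $\alpha\in(0,1)$ and let $\lambda>0$ satisfy the non-resonance condition: $\lambda\neq\lambda_n$ and $\lambda_n-\lambda\neq\lambda_k$ for all $k,n\in\mathbb N^*$. Let $k\in L^2((0,1)^2)$ be the kernel $k(x,y)=\sum_{n\in\mathbb N^*}\psi_n(x)\phi_n(y)$ defined in the context. Then the operator $T$ given by $$Tf(x)=f(x)-\int_0^1k(x,y)f(y)\,dy,\qquad f\in L^2(0,1),$$ is continuous from $L^2(0,1)$ to $L^2(0,1)$ and invertible.
   Context: $\mathbb N^*=\{1,2,\dots\}$; scalars are complex and function spaces consist of complex-valued functions. Let $\alpha\in(0,1)$, $\nu=\frac{1-\alpha}{2-\alpha}$, $\kappa=\frac{2-\alpha}{2}$. $J_\nu$ is the Bessel function of the first kind of order $\nu$, and $0<j_{\nu,1}<j_{\nu,2}<\cdots$ are its positive zeros. $H^1_{\alpha,0}(0,1)=\{f\in L^2(0,1): x^{\alpha/2}f'\in L^2(0,1),\ f(0)=f(1)=0\}$. The operator $A$ on $L^2(0,1)$ is $Au=(x^\alpha u')'$ with $D(A)=\{u\in H^1_{\alpha,0}(0,1): x^\alpha u'\in H^1(0,1)\}$. $-A$ is self-adjoint, positive definite with compact resolvent; its eigenvalues are $\lambda_n=(\kappa j_{\nu,n})^2$ and the functions $\phi_n(x)=\frac{(2\kappa)^{1/2}}{J_\nu'(j_{\nu,n})}x^{(1-\alpha)/2}J_\nu(j_{\nu,n}x^\kappa)$ ($n\in\mathbb N^*$) are corresponding eigenfunctions ($-A\phi_n=\lambda_n\phi_n$)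 forming a Hilbert basis of $L^2(0,1)$. One has $\phi_n'(1)=(2\kappa)^{1/2}\kappa j_{\nu,n}$. $D(A^{1/2})'$ is the Hilbert space of formal series $f=\sum_n a_n\phi_n$ with $\|f\|^2=\sum_n |a_n|^2/\lambda_n<\infty$; it contains $L^2(0,1)$. For $\lambda$ as in the claim, $\widetilde\xi_n(x)=\frac{(2\kappa)^{1/2}}{J_\nu'(j_{\nu,n})}x^{(1-\alpha)/2}J_\nu\!\left(\frac{\sqrt{\lambda_n-\lambda}}{\kappa}x^\kappa\right)$, where $\sqrt{\lambda_n-\lambda}$ means $i\sqrt{\lambda-\lambda_n}$ if $\lambda>\lambda_n$ (principal branch for $z\mapsto z^\nu$). There is a unique scalar sequence $(c_n)_{n\in\mathbb N^*}$ with $(c_n-1)_n\in\ell^2(\mathbb N^* )$ such that, with $\psi_n:=\phi_n-c_n\widetilde\xi_n$, one has $\sum_{n}\phi_n'(1)\psi_n=0$ with convergence in $D(A^{1/2})'$. This fixes $c_n$ and $\psi_n$, and the series $k(x,y)=\sum_n\psi_n(x)\phi_n(y)$ then converges in $L^2((0,1)^2)$. *)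

theory Defs
  imports "HOL-Analysis.Analysis"
begin

section \<open>Square-integrable functions\<close>

text \<open>
  Elements of \<open>L\<^sup>2\<close> are represented by functions, and equality in \<open>L\<^sup>2\<close> is equality almost everywhere.
  Measurability is with respect to Borel sets; since every Lebesgue measurable function has a Borel
  measurable representative, this gives the usual space of equivalence classes.
\<close>

definition L2 :: "'a measure \<Rightarrow> ('a \<Rightarrow> complex) set" where
  "L2 M = {f. f \<in> borel_measurable M \<and> integrable M (\<lambda>x. (norm (f x))\<^sup>2)}"

definition L2_norm :: "'a measure \<Rightarrow> ('a \<Rightarrow> complex) \<Rightarrow> real" where
  "L2_norm M f = sqrt (LINT x|M. (norm (f x))\<^sup>2)"

definition L2_inner :: "'a measure \<Rightarrow> ('a \<Rightarrow> complex) \<Rightarrow> ('a \<Rightarrow> complex) \<Rightarrow> complex" where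
  "L2_inner M f g = (LINT x|M. f x * cnj (g x))"

text \<open>Series are indexed by the positive integers.\<close>

definition L2_sums :: "'a measure \<Rightarrow> (nat \<Rightarrow> 'a \<Rightarrow> complex) \<Rightarrow> ('a \<Rightarrow> complex) \<Rightarrow> bool" where
  "L2_sums M f s \<longleftrightarrow> (\<forall>n\<ge>1. f n \<in> L2 M) \<and> s \<in> L2 M \<and>
     (\<lambda>N. L2_norm M (\<lambda>x. (\<Sum>n=1..N. f n x) - s x)) \<longlonglongrightarrow> 0"

definition L2_linear_operator ::
    "'a measure \<Rightarrow> (('a \<Rightarrow> complex) \<Rightarrow> ('a \<Rightarrow> complex)) \<Rightarrow> bool" where
  "L2_linear_operator M T \<longleftrightarrow>
     (\<forall>f\<in>L2 M. T f \<in> L2 M) \<and>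
     (\<forall>f\<in>L2 M. \<forall>g\<in>L2 M. (AE x in M. f x = g x) \<longrightarrow> (AE x in M. T f x = T g x)) \<and>
     (\<forall>f\<in>L2 M. \<forall>g\<in>L2 M. AE x in M. T (\<lambda>t. f t + g t) x = T f x + T g x) \<and>
     (\<forall>f\<in>L2 M. \<forall>a. AE x in M. T (\<lambda>t. a * f t) x = a * T f x)"

definition L2_continuous ::
    "'a measure \<Rightarrow> (('a \<Rightarrow> complex) \<Rightarrow> ('a \<Rightarrow> complex)) \<Rightarrow> bool" where
  "L2_continuous M T \<longleftrightarrow>
     (\<forall>f\<in>L2 M. \<forall>\<epsilon>>0. \<exists>\<delta>>0. \<forall>g\<in>L2 M.
        L2_norm M (\<lambda>x. g x - f x) < \<delta> \<longrightarrow> L2_norm M (\<lambda>x. T g x - T f x) < \<epsilon>)"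

definition L2_invertible ::
    "'a measure \<Rightarrow> (('a \<Rightarrow> complex) \<Rightarrow> ('a \<Rightarrow> complex)) \<Rightarrow> bool" where
  "L2_invertible M T \<longleftrightarrow>
     (\<exists>S. L2_linear_operator M S \<and> L2_continuous M S \<and>
        (\<forall>f\<in>L2 M. (AE x in M. S (T f) x = f x) \<and> (AE x in M. T (S f) x = f x)))"

abbreviation unit_interval :: "real measure" where
  "unit_interval \<equiv> restrict_space lborel {0<..<1}"


section \<open>Bessel functions of the first kind\<close>

text \<open>
  The complex power is the principal one.
\<close>

definition bessel_J :: "real \<Rightarrow> complex \<Rightarrow> complex" where
  "bessel_J \<nu> z = (z / 2) powr (of_real \<nu>) *
     (\<Sum>m. (-1) ^ m / (fact m * of_real (Gamma (\<nu> + real m + 1))) * (z / 2) ^ (2 * m))"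

text \<open>
  For \<open>n \<ge> 1\<close>, the \<open>n\<close>-th positive zero is the one for which exactly \<open>n\<close> zeros lie in \<open>(0, x]\<close>.
\<close>

definition bessel_zero :: "real \<Rightarrow> nat \<Rightarrow> real" where
  "bessel_zero \<nu> n = (THE x. 0 < x \<and> bessel_J \<nu> (of_real x) = 0 \<and>
     card {t. 0 < t \<and> t \<le> x \<and> bessel_J \<nu> (of_real t) = 0} = n)"


section \<open>Spectral data of the degenerate operator \<open>u \<mapsto> (x\<^sup>\<alpha> u')'\<close>\<close>

definition nu :: "real \<Rightarrow> real" where
  "nu \<alpha> = (1 - \<alpha>) / (2 - \<alpha>)"

definition kappa :: "real \<Rightarrow> real" where
  "kappa \<alpha> = (2 - \<alpha>) / 2"

definition eigval :: "real \<Rightarrow> nat \<Rightarrow> real" where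
  "eigval \<alpha> n = (kappa \<alpha> * bessel_zero (nu \<alpha>) n)\<^sup>2"

definition phi :: "real \<Rightarrow> nat \<Rightarrow> real \<Rightarrow> complex" where
  "phi \<alpha> n x =
     of_real (sqrt (2 * kappa \<alpha>)) / deriv (bessel_J (nu \<alpha>)) (of_real (bessel_zero (nu \<alpha>) n))
     * of_real (x powr ((1 - \<alpha>) / 2))
     * bessel_J (nu \<alpha>) (of_real (bessel_zero (nu \<alpha>) n * x powr kappa \<alpha>))"

text \<open>
  For \<open>r < 0\<close> one has \<open>csqrt (of_real r) = \<i> * of_real (sqrt (- r))\<close>, which is the intended
  reading of the square root when \<open>\<lambda> > \<lambda>\<^sub>n\<close>.
\<close>

definition xi :: "real \<Rightarrow> real \<Rightarrow> nat \<Rightarrow> real \<Rightarrow> complex" where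
  "xi \<alpha> lam n x =
     of_real (sqrt (2 * kappa \<alpha>)) / deriv (bessel_J (nu \<alpha>)) (of_real (bessel_zero (nu \<alpha>) n))
     * of_real (x powr ((1 - \<alpha>) / 2))
     * bessel_J (nu \<alpha>)
         (csqrt (of_real (eigval \<alpha> n - lam)) / of_real (kappa \<alpha>) * of_real (x powr kappa \<alpha>))"

definition psi :: "real \<Rightarrow> real \<Rightarrow> (nat \<Rightarrow> complex) \<Rightarrow> nat \<Rightarrow> real \<Rightarrow> complex" where
  "psi \<alpha> lam c n x = phi \<alpha> n x - c n * xi \<alpha> lam n x"


section \<open>The space \<open>D(A\<^sup>1\<^sup>/\<^sup>2)'\<close>\<close>

text \<open>
  A formal series \<open>\<Sum>n\<ge>1. a n \<cdot> phi \<alpha> n\<close> is represented by its coefficient sequence \<open>a\<close>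
  (the value \<open>a 0\<close> is irrelevant), and \<open>f \<in> L\<^sup>2(0,1)\<close> is identified with its Fourier series.
\<close>

definition dual_space :: "real \<Rightarrow> (nat \<Rightarrow> complex) set" where
  "dual_space \<alpha> = {a. (\<lambda>m. (norm (a m))\<^sup>2 / eigval \<alpha> m) summable_on {1..}}"

definition dual_norm :: "real \<Rightarrow> (nat \<Rightarrow> complex) \<Rightarrow> real" where
  "dual_norm \<alpha> a = sqrt (\<Sum>\<^sub>\<infinity>m\<in>{1..}. (norm (a m))\<^sup>2 / eigval \<alpha> m)"

definition dual_embed :: "real \<Rightarrow> (real \<Rightarrow> complex) \<Rightarrow> nat \<Rightarrow> complex" where
  "dual_embed \<alpha> f m = L2_inner unit_interval f (phi \<alpha> m)"

definition dual_sums :: "real \<Rightarrow> (nat \<Rightarrow> nat \<Rightarrow> complex) \<Rightarrow> (nat \<Rightarrow> complex) \<Rightarrow> bool" where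
  "dual_sums \<alpha> a s \<longleftrightarrow> (\<forall>n\<ge>1. a n \<in> dual_space \<alpha>) \<and> s \<in> dual_space \<alpha> \<and>
     (\<lambda>N. dual_norm \<alpha> (\<lambda>m. (\<Sum>n=1..N. a n m) - s m)) \<longlonglongrightarrow> 0"


section \<open>The transformation\<close>

definition admissible_coeffs :: "real \<Rightarrow> real \<Rightarrow> (nat \<Rightarrow> complex) \<Rightarrow> bool" where
  "admissible_coeffs \<alpha> lam c \<longleftrightarrow>
     (\<lambda>n. (norm (c n - 1))\<^sup>2) summable_on {1..} \<and>
     dual_sums \<alpha>
       (\<lambda>n. dual_embed \<alpha> (\<lambda>x. vector_derivative (phi \<alpha> n) (at 1) * psi \<alpha> lam c n x))
       (\<lambda>m. 0)"

definition is_kernel ::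
    "real \<Rightarrow> real \<Rightarrow> (nat \<Rightarrow> complex) \<Rightarrow> (real \<Rightarrow> real \<Rightarrow> complex) \<Rightarrow> bool" where
  "is_kernel \<alpha> lam c k \<longleftrightarrow>
     L2_sums (unit_interval \<Otimes>\<^sub>M unit_interval)
       (\<lambda>n (x, y). psi \<alpha> lam c n x * phi \<alpha> n y) (\<lambda>(x, y). k x y)"

definition kernel_transform ::
    "(real \<Rightarrow> real \<Rightarrow> complex) \<Rightarrow> (real \<Rightarrow> complex) \<Rightarrow> real \<Rightarrow> complex" where
  "kernel_transform k f x = f x - (LINT y|unit_interval. k x y * f y)"

end

theory Submission
  imports Defs
begin

text \<open>
  Write \<open>\<lambda>\<^sub>n\<close> for the eigenvalues and \<open>b\<^sub>n = \<phi>\<^sub>n'(1)\<close>. The operator \<open>T\<close> is the identity minus a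
  Hilbert--Schmidt operator \<open>K\<close>, so it is invertible as soon as nothing but zero annihilates its
  range. Since \<open>K f\<close> depends only on the coefficients \<open>\<langle>f, \<phi>\<^sub>n\<rangle>\<close>, all of this can be read off the matrix of
  \<open>T\<close> in the orthonormal system \<open>\<phi>\<^sub>n\<close>. By construction \<open>T \<phi>\<^sub>n = c\<^sub>n \<xi>\<^sub>n\<close>, and because \<open>\<xi>\<^sub>n\<close> solves the
  same differential equation with \<open>\<lambda>\<^sub>n - \<lambda>\<close> in place of \<open>\<lambda>\<^sub>m\<close>, Green's formula turns the entries into
  \<open>\<langle>c\<^sub>n \<xi>\<^sub>n, \<phi>\<^sub>m\<rangle> = d\<^sub>n b\<^sub>m / (\<lambda>\<^sub>n - \<lambda> - \<lambda>\<^sub>m)\<close> with \<open>d\<^sub>n = c\<^sub>n \<xi>\<^sub>n(1)\<close>: only the boundary point 1 contributes.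

  Let \<open>h\<close> annihilate the range, that is \<open>d\<^sub>n \<Sum>\<^sub>m h\<^sub>m b\<^sub>m / (\<lambda>\<^sub>n - \<lambda> - \<lambda>\<^sub>m) = 0\<close> for all \<open>n\<close>. Apply the resolvent
  \<open>(\<lambda>\<^sub>m - r)\<^sup>-\<^sup>1\<close> to \<open>h\<close>. A partial fraction shows that the resulting sequence also annihilates the range,
  except for the error \<open>d\<^sub>n F / (\<lambda>\<^sub>n - \<lambda> - r)\<close>, where \<open>F = \<Sum>\<^sub>m h\<^sub>m b\<^sub>m / (\<lambda>\<^sub>m - r)\<close>. The relation
  \<open>\<Sum>\<^sub>n b\<^sub>n \<psi>\<^sub>n = 0\<close>, paired with this more regular sequence, gives \<open>F (1 - \<Phi>(r)) = 0\<close> with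
  \<open>\<Phi>(r) = \<Sum>\<^sub>n b\<^sub>n d\<^sub>n / (\<lambda>\<^sub>n - \<lambda> - r)\<close>. The products \<open>b\<^sub>n d\<^sub>n\<close> are bounded (they occur in the diagonal of a
  Hilbert--Schmidt matrix) and \<open>\<Sum> 1 / \<lambda>\<^sub>n\<close> converges, so \<open>\<Phi>(r)\<close> is small for very negative \<open>r\<close>. Hence
  \<open>F = 0\<close>, the space of annihilators is invariant under the resolvent, and by iteration
  \<open>\<Sum>\<^sub>m h\<^sub>m b\<^sub>m / (\<lambda>\<^sub>m - r)\<^sup>k = 0\<close> for all \<open>k \<ge> 1\<close>. For large \<open>k\<close> the smallest eigenvalue with \<open>h\<^sub>m \<noteq> 0\<close> would
  dominate this sum, so \<open>h = 0\<close> (\<open>orthogonal_to_range_imp_zero\<close>).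

  The passage from this uniqueness to a bounded inverse is \<open>fredholm_hilbert_schmidt\<close> together with
  \<open>kernel_expansion.T_invertible\<close>. The facts on \<open>\<phi>\<^sub>n\<close> and \<open>\<xi>\<^sub>n\<close> come from writing
  \<open>J\<^sub>\<mu>(z) = (z/2)\<^sup>\<mu> E\<^sub>\<mu>(z\<^sup>2)\<close> with an entire function \<open>E\<^sub>\<mu>\<close>: all of them are multiples of one family of
  solutions \<open>sol q\<close> of the degenerate equation.
\<close>

section \<open>Square-summable sequences\<close>

lemma norm_add_sq_le: "(norm (a + b :: complex))\<^sup>2 \<le> 2 * (norm a)\<^sup>2 + 2 * (norm b)\<^sup>2"
proof -
  have "(norm (a + b))\<^sup>2 \<le> (norm a + norm b)\<^sup>2"
    by (intro power_mono norm_triangle_ineq) auto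
  also have "\<dots> \<le> 2 * (norm a)\<^sup>2 + 2 * (norm b)\<^sup>2"
    using sum_squares_bound[of "norm a" "norm b"] by (simp add: power2_sum)
  finally show ?thesis .
qed

lemma sq_summable_mult:
  fixes x y :: "nat \<Rightarrow> complex"
  assumes x: "summable (\<lambda>n. (norm (x n))\<^sup>2)" and y: "summable (\<lambda>n. (norm (y n))\<^sup>2)"
  shows "summable (\<lambda>n. norm (x n * y n))"
    and "(\<Sum>n. norm (x n * y n)) \<le> sqrt (\<Sum>n. (norm (x n))\<^sup>2) * sqrt (\<Sum>n. (norm (y n))\<^sup>2)"
    and "norm (\<Sum>n. x n * y n) \<le> sqrt (\<Sum>n. (norm (x n))\<^sup>2) * sqrt (\<Sum>n. (norm (y n))\<^sup>2)"
proof -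
  have bound: "(\<Sum>n<N. norm (x n * y n))
      \<le> sqrt (\<Sum>n. (norm (x n))\<^sup>2) * sqrt (\<Sum>n. (norm (y n))\<^sup>2)" for N
  proof -
    have "(\<Sum>n<N. norm (x n * y n)) = (\<Sum>n<N. \<bar>norm (x n)\<bar> * \<bar>norm (y n)\<bar>)"
      by (simp add: norm_mult)
    also have "\<dots> \<le> L2_set (\<lambda>n. norm (x n)) {..<N} * L2_set (\<lambda>n. norm (y n)) {..<N}"
      by (rule L2_set_mult_ineq)
    also have "\<dots> \<le> sqrt (\<Sum>n. (norm (x n))\<^sup>2) * sqrt (\<Sum>n. (norm (y n))\<^sup>2)"
      unfolding L2_set_def
      by (intro mult_mono real_sqrt_le_mono sum_le_suminf x y) (auto intro!: sum_nonneg suminf_nonneg x)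
    finally show ?thesis .
  qed
  show S: "summable (\<lambda>n. norm (x n * y n))"
    by (rule summableI_nonneg_bounded[OF _ bound]) auto
  show B: "(\<Sum>n. norm (x n * y n)) \<le> sqrt (\<Sum>n. (norm (x n))\<^sup>2) * sqrt (\<Sum>n. (norm (y n))\<^sup>2)"
    by (rule suminf_le_const[OF S bound])
  show "norm (\<Sum>n. x n * y n) \<le> sqrt (\<Sum>n. (norm (x n))\<^sup>2) * sqrt (\<Sum>n. (norm (y n))\<^sup>2)"
    using summable_norm[OF S] B by linarith
qed

lemma sq_summable_add:
  fixes x y :: "nat \<Rightarrow> complex"
  assumes "summable (\<lambda>n. (norm (x n))\<^sup>2)" and "summable (\<lambda>n. (norm (y n))\<^sup>2)"
  shows "summable (\<lambda>n. (norm (x n + y n))\<^sup>2)"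
proof (rule summable_comparison_test')
  show "summable (\<lambda>n. 2 * (norm (x n))\<^sup>2 + 2 * (norm (y n))\<^sup>2)"
    by (intro summable_add summable_mult assms)
  show "norm ((norm (x n + y n))\<^sup>2) \<le> 2 * (norm (x n))\<^sup>2 + 2 * (norm (y n))\<^sup>2" for n
    using norm_add_sq_le by simp
qed

lemma sq_summable_cmult:
  fixes x :: "nat \<Rightarrow> complex"
  assumes "summable (\<lambda>n. (norm (x n))\<^sup>2)"
  shows "summable (\<lambda>n. (norm (a * x n))\<^sup>2)"
  using assms by (simp add: norm_mult power_mult_distrib summable_mult)

text \<open>
  The sequences form a type of their own so that the fixed point theorem for complete metric spaces
  and the theory of linear maps apply. Only the real inner product is recorded; complex scalars
  enter where they are needed through coordinates.
\<close>

typedef ell2 = "{x :: nat \<Rightarrow> complex. summable (\<lambda>n. (norm (x n))\<^sup>2)}"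
  morphisms coord Abs_ell2
  by (rule exI[of _ "\<lambda>_. 0"]) simp

setup_lifting type_definition_ell2

lemma coord_summable: "summable (\<lambda>n. (norm (coord x n))\<^sup>2)"
  using coord[of x] by simp

lemma ell2_eqI: "(\<And>n. coord x n = coord y n) \<Longrightarrow> x = y"
  by (auto intro: iffD1[OF coord_inject])

lemma summable_Re_mult_cnj:
  assumes "summable (\<lambda>n. (norm (x n))\<^sup>2)" and "summable (\<lambda>n. (norm (y n :: complex))\<^sup>2)"
  shows "summable (\<lambda>n. Re (x n * cnj (y n)))"
proof -
  have "summable (\<lambda>n. x n * cnj (y n))"
    by (rule summable_norm_cancel, rule sq_summable_mult(1)) (use assms in auto)
  then show ?thesis by (rule summable_Re)
qed

instantiation ell2 :: real_vector
begin

lift_definition zero_ell2 :: ell2 is "\<lambda>_. 0" by simp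
lift_definition plus_ell2 :: "ell2 \<Rightarrow> ell2 \<Rightarrow> ell2" is "\<lambda>x y n. x n + y n"
  by (rule sq_summable_add)
lift_definition uminus_ell2 :: "ell2 \<Rightarrow> ell2" is "\<lambda>x n. - x n" by simp
lift_definition minus_ell2 :: "ell2 \<Rightarrow> ell2 \<Rightarrow> ell2" is "\<lambda>x y n. x n - y n"
  using sq_summable_add[of _ "\<lambda>n. - y n" for y] by simp
lift_definition scaleR_ell2 :: "real \<Rightarrow> ell2 \<Rightarrow> ell2" is "\<lambda>r x n. of_real r * x n"
  by (rule sq_summable_cmult)

instance
  by standard (transfer, simp add: algebra_simps)+

end

instantiation ell2 :: real_inner
begin

lift_definition inner_ell2 :: "ell2 \<Rightarrow> ell2 \<Rightarrow> real" is "\<lambda>x y. \<Sum>n. Re (x n * cnj (y n))" .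
definition norm_ell2 :: "ell2 \<Rightarrow> real" where "norm_ell2 x = sqrt (inner x x)"
definition sgn_ell2 :: "ell2 \<Rightarrow> ell2" where "sgn_ell2 x = x /\<^sub>R norm x"
definition dist_ell2 :: "ell2 \<Rightarrow> ell2 \<Rightarrow> real" where "dist_ell2 x y = norm (x - y)"
definition uniformity_ell2 :: "(ell2 \<times> ell2) filter"
  where "uniformity_ell2 = (INF e\<in>{0 <..}. principal {(x, y). dist x y < e})"
definition open_ell2 :: "ell2 set \<Rightarrow> bool"
  where "open_ell2 S = (\<forall>x\<in>S. \<forall>\<^sub>F (x', y) in uniformity. x' = x \<longrightarrow> y \<in> S)"

instance
proof
  fix x y z :: ell2 and a b :: real and S :: "ell2 set"
  show "sgn x = x /\<^sub>R norm x" by (fact sgn_ell2_def)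
  show "dist x y = norm (x - y)" by (fact dist_ell2_def)
  show "uniformity = (INF e\<in>{0 <..}. principal {(x::ell2, y). dist x y < e})"
    by (fact uniformity_ell2_def)
  show "open S = (\<forall>x\<in>S. \<forall>\<^sub>F (x', y) in uniformity. x' = x \<longrightarrow> y \<in> S)" by (fact open_ell2_def)
  have Re_sym: "Re (u * cnj v) = Re (v * cnj u)" for u v by simp
  show "inner x y = inner y x" 
    unfolding inner_ell2.rep_eq by (simp only: Re_sym[of "coord x _"])
  show "inner (x + y) z = inner x z + inner y z"
    unfolding inner_ell2.rep_eq plus_ell2.rep_eq distrib_right plus_complex.sel(1)
    by (rule suminf_add[symmetric]; intro summable_Re_mult_cnj coord_summable)
  have Re_scale: "Re (of_real r * w) = r * Re w" for r w by simp
  show "inner (a *\<^sub>R x) y = a * inner x y"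
    unfolding inner_ell2.rep_eq scaleR_ell2.rep_eq mult.assoc Re_scale
    by (rule suminf_mult; intro summable_Re_mult_cnj coord_summable)
  have sq: "Re (z * cnj z) = (norm z)\<^sup>2" for z
    by (simp only: complex_mult_cnj cmod_power2 Re_complex_of_real)
  show "0 \<le> inner x x"
    unfolding inner_ell2.rep_eq sq by (simp add: suminf_nonneg coord_summable)
  have "inner x x = 0 \<longleftrightarrow> (\<forall>n. coord x n = 0)"
    unfolding inner_ell2.rep_eq sq by (simp add: suminf_eq_zero_iff coord_summable)
  then show "inner x x = 0 \<longleftrightarrow> x = 0"
    by (auto intro!: ell2_eqI simp: zero_ell2.rep_eq)
  show "norm x = sqrt (inner x x)" by (fact norm_ell2_def)
qed

end

lemma norm_ell2_eq: "norm x = sqrt (\<Sum>n. (norm (coord x n))\<^sup>2)"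
proof -
  have "Re (z * cnj z) = (norm z)\<^sup>2" for z
    by (simp only: complex_mult_cnj cmod_power2 Re_complex_of_real)
  then have "inner x x = (\<Sum>n. (norm (coord x n))\<^sup>2)"
    by (simp only: inner_ell2.rep_eq)
  then show ?thesis by (simp only: norm_ell2_def)
qed

lemma norm_ell2_sq: "(norm x)\<^sup>2 = (\<Sum>n. (norm (coord x n))\<^sup>2)"
  unfolding norm_ell2_eq
  by (rule real_sqrt_pow2, rule suminf_nonneg[OF coord_summable]) simp

lemma sum_coord_le_norm: "finite I \<Longrightarrow> (\<Sum>n\<in>I. (norm (coord x n))\<^sup>2) \<le> (norm x)\<^sup>2"
  unfolding norm_ell2_sq by (rule sum_le_suminf[OF coord_summable]) auto

lemma coord_le_norm: "norm (coord x n) \<le> norm x"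
  by (rule power2_le_imp_le) (use sum_coord_le_norm[of "{n}" x] in auto)

lemma Abs_ell2_coord: "summable (\<lambda>n. (norm (x n))\<^sup>2) \<Longrightarrow> coord (Abs_ell2 x) = x"
  by (simp add: Abs_ell2_inverse)

text \<open>
  Operators and coefficient maps with values in \<^typ>\<open>ell2\<close> are bounded by this criterion: a uniform bound
  on finite sums controls membership and the norm at the same time.
\<close>

lemma ell2_of_bounded_sums:
  fixes x :: "nat \<Rightarrow> complex"
  assumes "\<And>N. (\<Sum>n<N. (norm (x n))\<^sup>2) \<le> B\<^sup>2" and "B \<ge> 0"
  shows "summable (\<lambda>n. (norm (x n))\<^sup>2)" and "norm (Abs_ell2 x) \<le> B"
proof -
  show S: "summable (\<lambda>n. (norm (x n))\<^sup>2)"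
    by (rule summableI_nonneg_bounded[OF _ assms(1)]) auto
  have "(norm (Abs_ell2 x))\<^sup>2 \<le> B\<^sup>2"
    unfolding norm_ell2_sq Abs_ell2_coord[OF S] by (rule suminf_le_const[OF S assms(1)])
  then show "norm (Abs_ell2 x) \<le> B" using assms(2) by (rule power2_le_imp_le)
qed

instance ell2 :: banach
proof
  fix X :: "nat \<Rightarrow> ell2"
  assume C: "Cauchy X"
  have "Cauchy (\<lambda>k. coord (X k) n)" for n
  proof (rule metric_CauchyI)
    fix e :: real assume "e > 0"
    from metric_CauchyD[OF C this] obtain M where M: "\<And>k l. k \<ge> M \<Longrightarrow> l \<ge> M \<Longrightarrow> dist (X k) (X l) < e"
      by blast
    have "dist (coord (X k) n) (coord (X l) n) \<le> dist (X k) (X l)" for k l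
      using coord_le_norm[of "X k - X l" n] by (simp add: dist_norm minus_ell2.rep_eq)
    then show "\<exists>M. \<forall>m\<ge>M. \<forall>k\<ge>M. dist (coord (X m) n) (coord (X k) n) < e"
      using M by (meson le_less_trans)
  qed
  then have "\<forall>n. \<exists>l. (\<lambda>k. coord (X k) n) \<longlonglongrightarrow> l"
    by (simp add: Cauchy_convergent_iff convergent_def)
  then obtain L where L: "\<And>n. (\<lambda>k. coord (X k) n) \<longlonglongrightarrow> L n" by metis
  have tail: "(\<Sum>n<N. (norm (coord (X k) n - L n))\<^sup>2) \<le> e\<^sup>2"
    if M: "\<And>k l. k \<ge> M \<Longrightarrow> l \<ge> M \<Longrightarrow> dist (X k) (X l) < e" and "k \<ge> M" for M e k N
  proof (rule LIMSEQ_le_const2)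
    show "(\<lambda>l. \<Sum>n<N. (norm (coord (X k) n - coord (X l) n))\<^sup>2) \<longlonglongrightarrow> (\<Sum>n<N. (norm (coord (X k) n - L n))\<^sup>2)"
      by (intro tendsto_intros L)
    have "(\<Sum>n<N. (norm (coord (X k) n - coord (X l) n))\<^sup>2) \<le> e\<^sup>2" if "l \<ge> M" for l
    proof -
      have "(\<Sum>n<N. (norm (coord (X k) n - coord (X l) n))\<^sup>2) \<le> (norm (X k - X l))\<^sup>2"
        using sum_coord_le_norm[of "{..<N}" "X k - X l"] by (simp add: minus_ell2.rep_eq)
      also have "\<dots> \<le> e\<^sup>2"
        using M[OF \<open>k \<ge> M\<close> that] by (intro power_mono) (auto simp: dist_norm)
      finally show ?thesis .
    qed
    then show "\<exists>N'. \<forall>n\<ge>N'. (\<Sum>na<N. (norm (coord (X k) na - coord (X n) na))\<^sup>2) \<le> e\<^sup>2" by blast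
  qed
  have sumL: "summable (\<lambda>n. (norm (L n))\<^sup>2)"
  proof -
    from metric_CauchyD[OF C zero_less_one] obtain M
      where M: "\<And>k l. k \<ge> M \<Longrightarrow> l \<ge> M \<Longrightarrow> dist (X k) (X l) < 1" by blast
    have "summable (\<lambda>n. (norm (coord (X M) n - L n))\<^sup>2)"
      by (rule ell2_of_bounded_sums(1)[OF tail[OF M]]) auto
    then have "summable (\<lambda>n. (norm (L n - coord (X M) n))\<^sup>2)" by (simp add: norm_minus_commute)
    from sq_summable_add[OF this coord_summable[of "X M"]] show ?thesis by simp
  qed
  have "X \<longlonglongrightarrow> Abs_ell2 L"
  proof (rule metric_LIMSEQ_I)
    fix e :: real assume "e > 0"
    then have "e / 2 > 0" by simp
    from metric_CauchyD[OF C this] obtain M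
      where M: "\<And>k l. k \<ge> M \<Longrightarrow> l \<ge> M \<Longrightarrow> dist (X k) (X l) < e / 2" by blast
    have "dist (X k) (Abs_ell2 L) < e" if "k \<ge> M" for k
    proof -
      have "X k - Abs_ell2 L = Abs_ell2 (\<lambda>n. coord (X k) n - L n)"
        by (rule ell2_eqI, subst Abs_ell2_coord, rule ell2_of_bounded_sums(1)[OF tail[OF M that]])
           (use \<open>e > 0\<close> in \<open>auto simp: minus_ell2.rep_eq Abs_ell2_coord[OF sumL]\<close>)
      moreover have "norm (Abs_ell2 (\<lambda>n. coord (X k) n - L n)) \<le> e / 2"
        by (rule ell2_of_bounded_sums(2)[OF tail[OF M that]]) (use \<open>e > 0\<close> in auto)
      ultimately show ?thesis using \<open>e > 0\<close> by (simp add: dist_norm)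
    qed
    then show "\<exists>no. \<forall>n\<ge>no. dist (X n) (Abs_ell2 L) < e" by blast
  qed
  then show "convergent X" by (auto simp: convergent_def)
qed

section \<open>The Fredholm alternative for Hilbert--Schmidt matrices\<close>

lemma linear_functional_combination:
  assumes "\<And>i. i \<in> I \<Longrightarrow> linear (l i)"
  shows "linear (\<lambda>x. \<Sum>i\<in>I. l i x *\<^sub>R u i)"
  by (rule linearI)
     (simp_all add: linear_add[OF assms] linear_cmul[OF assms] scaleR_add_left sum.distrib scaleR_sum_right)

text \<open>
  The map \<open>x \<mapsto> x - G x\<close> sends the span of the \<open>u i\<close> into itself, and an injective linear map of a
  finite-dimensional space into itself is onto.
\<close>

lemma solvable_minus_finite_rank:
  fixes G :: "'a::real_vector \<Rightarrow> 'a"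
  assumes fin: "finite I" and lin: "\<And>i. i \<in> I \<Longrightarrow> linear (l i)"
    and G: "\<And>x. G x = (\<Sum>i\<in>I. l i x *\<^sub>R u i)"
    and inj: "\<And>x. G x = x \<Longrightarrow> x = 0"
    and i: "i \<in> I"
  shows "\<exists>w. w - G w = u i"
proof (rule ccontr)
  assume no: "\<nexists>w. w - G w = u i"
  define W where "W = span (u ` I)"
  define L where "L = (\<lambda>x. x - G x)"
  have linG: "linear G"
    unfolding G[abs_def] by (rule linear_functional_combination[OF lin])
  then have linL: "linear L"
    unfolding L_def by (intro linear_compose_sub linear_ident)
  have injL: "inj L"
    unfolding linear_injective_0[OF linL] using inj by (auto simp: L_def)
  have GW: "G x \<in> W" for x
    unfolding G W_def by (intro span_sum span_scale span_base) auto
  have LW: "L x \<in> W" if "x \<in> W" for x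
    unfolding L_def using span_diff[of x "u ` I" "G x"] that GW[of x] by (simp add: W_def)
  obtain B where B: "B \<subseteq> W" "independent B" "span B = W"
  proof -
    obtain B where "B \<subseteq> W" "independent B" "W \<subseteq> span B"
      by (rule basis_exists[of W])
    moreover from this have "span B = W"
      by (intro span_subspace) (simp_all add: W_def)
    ultimately show thesis by (intro that)
  qed
  have finB: "finite B"
    by (rule conjunct1[OF independent_span_bound[OF finite_imageI[OF fin] B(2)]])
       (use B(1) in \<open>simp add: W_def\<close>)
  have indL: "independent (L ` B)"
    using linear_independent_injective_image[OF linL B(2)] injL by (simp add: inj_on_subset)
  have "u i \<notin> span (L ` B)"
  proof
    assume "u i \<in> span (L ` B)"
    then obtain w where "u i = L w" by (auto simp: linear_span_image[OF linL])
    then show False using no by (auto simp: L_def)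
  qed
  then have ind: "independent (insert (u i) (L ` B))"
    using indL by (simp add: independent_insertI)
  have "insert (u i) (L ` B) \<subseteq> span B"
    unfolding B(3) using B(1) LW i span_base[of "u i" "u ` I"] by (auto simp: W_def)
  from independent_span_bound[OF finB ind this]
  have "card (insert (u i) (L ` B)) \<le> card B" by simp
  moreover have "card (L ` B) = card B"
    using injL by (simp add: card_image inj_on_subset)
  moreover have "u i \<notin> L ` B"
    using \<open>u i \<notin> span (L ` B)\<close> span_base[of "u i" "L ` B"] by metis
  ultimately show False using finB by simp
qed

text \<open>
  The solution of \<open>x - R x = y\<close> is the fixed point of the contraction \<open>x \<mapsto> y + R x\<close>.
\<close>

lemma contraction_perturbation:
  fixes R :: "'a::banach \<Rightarrow> 'a"
  assumes lin: "linear R" and R: "\<And>x. norm (R x) \<le> r * norm x" and r: "0 \<le> r" "r < 1"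
  obtains S where "linear S" and "\<And>y. S y - R (S y) = y" and "\<And>x. S (x - R x) = x"
    and "\<And>y. norm (S y) \<le> norm y / (1 - r)"
proof -
  have ex1: "\<exists>!x. y + R x = x" for y
  proof (rule banach_fix_type[OF r], intro allI)
    fix x x'
    show "dist (y + R x) (y + R x') \<le> r * dist x x'"
      using R[of "x - x'"] by (simp add: dist_norm linear_diff[OF lin])
  qed
  define S where "S y = (THE x. y + R x = x)" for y
  have S: "y + R (S y) = S y" for y
    unfolding S_def by (rule theI'[OF ex1])
  have S_unique: "S y = x" if "y + R x = x" for x y
    using ex1[of y] S[of y] that by blast
  show thesis
  proof
    show "linear S"
    proof (rule linearI)
      show "S (x + y) = S x + S y" for x y
      proof (rule S_unique)
        have "x + y + R (S x + S y) = (x + R (S x)) + (y + R (S y))"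
          by (simp add: linear_add[OF lin])
        then show "x + y + R (S x + S y) = S x + S y" by (simp only: S)
      qed
      show "S (c *\<^sub>R x) = c *\<^sub>R S x" for c x
      proof (rule S_unique)
        have "c *\<^sub>R x + R (c *\<^sub>R S x) = c *\<^sub>R (x + R (S x))"
          by (simp add: linear_cmul[OF lin] scaleR_add_right)
        then show "c *\<^sub>R x + R (c *\<^sub>R S x) = c *\<^sub>R S x" by (simp only: S)
      qed
    qed
    show *: "S y - R (S y) = y" for y using S[of y] by (simp add: algebra_simps)
    show "S (x - R x) = x" for x by (rule S_unique) simp
    show "norm (S y) \<le> norm y / (1 - r)" for y
    proof -
      have "norm (S y) \<le> norm y + norm (R (S y))"
        using norm_triangle_ineq[of y "R (S y)"] by (simp add: S)
      then show ?thesis using R[of "S y"] r by (simp add: field_simps)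
    qed
  qed
qed

text \<open>
  With \<open>S\<close> the inverse of \<open>1 - R\<close>, the equation \<open>x - R x - F x = y\<close> becomes \<open>x - S F x = S y\<close>, where \<open>S F\<close> has
  finite rank. Once \<open>w i - S F (w i) = S (v i)\<close> is solved, the solution is the explicit finite sum
  \<open>S y + \<Sum> l i (S y) w i\<close>, which also displays its norm bound.
\<close>

lemma fredholm_contraction_plus_finite_rank:
  fixes R F :: "'a::banach \<Rightarrow> 'a"
  assumes linR: "linear R" and R: "\<And>x. norm (R x) \<le> r * norm x" and r: "0 \<le> r" "r < 1"
    and fin: "finite I" and linl: "\<And>i. i \<in> I \<Longrightarrow> linear (l i)"
    and l: "\<And>i x. i \<in> I \<Longrightarrow> \<bar>l i x\<bar> \<le> B * norm x" and B: "0 \<le> B"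
    and F: "\<And>x. F x = (\<Sum>i\<in>I. l i x *\<^sub>R v i)"
    and inj: "\<And>x. R x + F x = x \<Longrightarrow> x = 0"
  shows "\<exists>C\<ge>0. \<forall>y. \<exists>x. x - (R x + F x) = y \<and> norm x \<le> C * norm y"
proof -
  obtain S where S: "linear S" "\<And>y. S y - R (S y) = y" "\<And>x. S (x - R x) = x"
    "\<And>y. norm (S y) \<le> norm y / (1 - r)"
    using contraction_perturbation[OF linR R r] by blast
  define G where "G x = (\<Sum>i\<in>I. l i x *\<^sub>R S (v i))" for x
  have G: "G x = S (F x)" for x
    unfolding G_def F by (simp add: linear_sum[OF S(1)] linear_cmul[OF S(1)])
  have "\<exists>w. w - G w = S (v i)" if "i \<in> I" for i
  proof (rule solvable_minus_finite_rank[OF fin linl G_def _ that])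
    fix x assume "G x = x"
    then have "F x = x - R x" using S(2)[of "F x"] by (simp add: G)
    then show "x = 0" by (intro inj) (simp add: algebra_simps)
  qed auto
  then obtain w where w: "\<And>i. i \<in> I \<Longrightarrow> w i - G (w i) = S (v i)" by metis
  have linG: "linear G"
    unfolding G_def[abs_def] by (rule linear_functional_combination[OF linl])
  define C where "C = (1 + B * (\<Sum>i\<in>I. norm (w i))) / (1 - r)"
  have "x - (R x + F x) = y \<and> norm x \<le> C * norm y"
    if x: "x = S y + (\<Sum>i\<in>I. l i (S y) *\<^sub>R w i)" for x y
  proof
    have "x - G x = (S y - G (S y)) + (\<Sum>i\<in>I. l i (S y) *\<^sub>R (w i - G (w i)))"
      unfolding x by (simp add: linear_add[OF linG] linear_sum[OF linG] linear_cmul[OF linG]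
          sum_subtractf scaleR_diff_right)
    also have "(\<Sum>i\<in>I. l i (S y) *\<^sub>R (w i - G (w i))) = G (S y)"
      unfolding G_def[of "S y"] by (intro sum.cong) (auto simp: w)
    finally have "x = S (y + F x)" by (simp add: G linear_add[OF S(1)] algebra_simps)
    then show "x - (R x + F x) = y" using S(2)[of "y + F x"] by (simp add: algebra_simps)
    have "norm (\<Sum>i\<in>I. l i (S y) *\<^sub>R w i) \<le> (\<Sum>i\<in>I. (B * norm (S y)) * norm (w i))"
      by (intro sum_norm_le) (auto intro!: mult_right_mono l)
    also have "\<dots> = B * (\<Sum>i\<in>I. norm (w i)) * norm (S y)"
      by (simp add: sum_distrib_left mult_ac)
    finally have "norm x \<le> (1 + B * (\<Sum>i\<in>I. norm (w i))) * norm (S y)"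
      unfolding x using norm_triangle_ineq[of "S y" "\<Sum>i\<in>I. l i (S y) *\<^sub>R w i"]
      by (simp add: algebra_simps)
    also have "\<dots> \<le> (1 + B * (\<Sum>i\<in>I. norm (w i))) * (norm y / (1 - r))"
      by (intro mult_left_mono S) (simp add: B sum_nonneg)
    finally show "norm x \<le> C * norm y" by (simp add: C_def)
  qed
  moreover have "C \<ge> 0" using r B by (simp add: C_def sum_nonneg)
  ultimately show ?thesis by blast
qed

text \<open>
  Square-summability over all pairs of indices, stated row by row.
\<close>

definition hilbert_schmidt :: "(nat \<Rightarrow> nat \<Rightarrow> complex) \<Rightarrow> bool" where
  "hilbert_schmidt M \<longleftrightarrow> (\<forall>m. summable (\<lambda>n. (norm (M m n))\<^sup>2))
     \<and> summable (\<lambda>m. \<Sum>n. (norm (M m n))\<^sup>2)"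

definition matrix_op :: "(nat \<Rightarrow> nat \<Rightarrow> complex) \<Rightarrow> ell2 \<Rightarrow> ell2" where
  "matrix_op M x = Abs_ell2 (\<lambda>m. \<Sum>n. M m n * coord x n)"

lemma hilbert_schmidt_transpose:
  assumes M: "hilbert_schmidt M"
  shows "hilbert_schmidt (\<lambda>m n. M n m)"
proof -
  define s where "s m = (\<Sum>n. (norm (M m n))\<^sup>2)" for m
  have row: "summable (\<lambda>n. (norm (M m n))\<^sup>2)" and s: "summable s" for m
    using M by (auto simp: hilbert_schmidt_def s_def[abs_def])
  have col: "summable (\<lambda>m. (norm (M m n))\<^sup>2)" for n
  proof (rule summable_comparison_test'[OF s])
    show "norm ((norm (M m n))\<^sup>2) \<le> s m" for m
      using sum_le_suminf[OF row[of m], of "{n}"] by (simp add: s_def)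
  qed
  have "summable (\<lambda>n. \<Sum>m. (norm (M m n))\<^sup>2)"
  proof (rule summableI_nonneg_bounded)
    show "0 \<le> (\<Sum>m. (norm (M m n))\<^sup>2)" for n by (rule suminf_nonneg[OF col]) simp
    fix N
    have "(\<Sum>n<N. \<Sum>m. (norm (M m n))\<^sup>2) = (\<Sum>m. \<Sum>n<N. (norm (M m n))\<^sup>2)"
      by (rule suminf_sum[symmetric]) (rule col)
    also have "\<dots> \<le> suminf s"
      by (rule suminf_le[OF _ summable_sum[OF col] s])
         (auto simp: s_def intro!: sum_le_suminf row)
    finally show "(\<Sum>n<N. \<Sum>m. (norm (M m n))\<^sup>2) \<le> suminf s" .
  qed
  with col show ?thesis by (simp add: hilbert_schmidt_def)
qed

lemma matrix_op:
  assumes M: "hilbert_schmidt M"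
  shows coord_matrix_op: "coord (matrix_op M x) m = (\<Sum>n. M m n * coord x n)"
    and matrix_op_bound: "norm (matrix_op M x) \<le> sqrt (\<Sum>m. \<Sum>n. (norm (M m n))\<^sup>2) * norm x"
    and matrix_op_summable: "summable (\<lambda>n. M m n * coord x n)"
proof -
  define s where "s m = (\<Sum>n. (norm (M m n))\<^sup>2)" for m
  have row: "summable (\<lambda>n. (norm (M m n))\<^sup>2)" and s: "summable s" for m
    using M by (auto simp: hilbert_schmidt_def s_def[abs_def])
  have s0: "s m \<ge> 0" for m unfolding s_def by (rule suminf_nonneg[OF row]) simp
  show "summable (\<lambda>n. M m n * coord x n)"
    by (rule summable_norm_cancel, rule sq_summable_mult(1)[OF row coord_summable])
  have entry: "(norm (\<Sum>n. M m n * coord x n))\<^sup>2 \<le> s m * (norm x)\<^sup>2" for m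
  proof -
    have "norm (\<Sum>n. M m n * coord x n) \<le> sqrt (s m) * norm x"
      using sq_summable_mult(3)[OF row coord_summable] by (simp add: s_def norm_ell2_eq)
    then have "(norm (\<Sum>n. M m n * coord x n))\<^sup>2 \<le> (sqrt (s m) * norm x)\<^sup>2"
      by (rule power_mono) simp
    then show ?thesis using s0[of m] by (simp add: power_mult_distrib)
  qed
  have bound: "(\<Sum>m<N. (norm (\<Sum>n. M m n * coord x n))\<^sup>2) \<le> (sqrt (suminf s) * norm x)\<^sup>2" for N
  proof -
    have "(\<Sum>m<N. (norm (\<Sum>n. M m n * coord x n))\<^sup>2) \<le> (\<Sum>m<N. s m) * (norm x)\<^sup>2"
      unfolding sum_distrib_right by (intro sum_mono entry)
    also have "\<dots> \<le> suminf s * (norm x)\<^sup>2"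
      by (intro mult_right_mono sum_le_suminf s) (auto simp: s0)
    finally show ?thesis by (simp add: power_mult_distrib suminf_nonneg s s0)
  qed
  have nn: "0 \<le> sqrt (suminf s) * norm x" by (simp add: suminf_nonneg s s0)
  show "coord (matrix_op M x) m = (\<Sum>n. M m n * coord x n)"
    unfolding matrix_op_def Abs_ell2_coord[OF ell2_of_bounded_sums(1)[OF bound nn]] ..
  show "norm (matrix_op M x) \<le> sqrt (\<Sum>m. \<Sum>n. (norm (M m n))\<^sup>2) * norm x"
    using ell2_of_bounded_sums(2)[OF bound nn] by (simp add: matrix_op_def s_def[abs_def])
qed

lemma linear_matrix_op: "hilbert_schmidt M \<Longrightarrow> linear (matrix_op M)"
  by (rule linearI; rule ell2_eqI)
     (simp_all add: coord_matrix_op plus_ell2.rep_eq scaleR_ell2.rep_eq distrib_left mult.left_commute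
        suminf_add[symmetric] suminf_mult[symmetric] matrix_op_summable)

definition single :: "nat \<Rightarrow> complex \<Rightarrow> ell2" where
  "single m a = Abs_ell2 (\<lambda>n. if n = m then a else 0)"

lemma coord_single: "coord (single m a) n = (if n = m then a else 0)"
proof -
  have "summable (\<lambda>n. (norm (if n = m then a else 0))\<^sup>2)"
    by (rule summable_finite[of "{m}"]) auto
  then show ?thesis by (simp add: single_def Abs_ell2_coord)
qed

lemma coord_sum: "coord (\<Sum>i\<in>I. f i) n = (\<Sum>i\<in>I. coord (f i) n)"
  by (induction I rule: infinite_finite_induct) (auto simp: zero_ell2.rep_eq plus_ell2.rep_eq)

text \<open>
  Deleting finitely many rows makes a Hilbert--Schmidt matrix a contraction; the deleted rows form
  an operator of finite rank. Real and imaginary parts of each deleted row are treated as separate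
  functionals, because linearity here is over the reals.
\<close>

theorem fredholm_hilbert_schmidt:
  assumes M: "hilbert_schmidt M" and inj: "\<And>x. matrix_op M x = x \<Longrightarrow> x = 0"
  shows "\<exists>C\<ge>0. \<forall>y. \<exists>x. x - matrix_op M x = y \<and> norm x \<le> C * norm y"
proof -
  define s where "s m = (\<Sum>n. (norm (M m n))\<^sup>2)" for m
  have row: "summable (\<lambda>n. (norm (M m n))\<^sup>2)" and s: "summable s" for m
    using M by (auto simp: hilbert_schmidt_def s_def[abs_def])
  have s0: "s m \<ge> 0" for m unfolding s_def by (rule suminf_nonneg[OF row]) simp
  have "eventually (\<lambda>N. norm (\<Sum>m. s (m + N)) < 1 / 4) sequentially"
    using order_tendstoD(2)[OF tendsto_norm[OF suminf_exist_split2[OF s]], of "1/4"] by simp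
  then obtain N where N: "norm (\<Sum>m. s (m + N)) < 1 / 4" by (auto simp: eventually_sequentially)
  \<comment> \<open>the tail of the row sums below 1/4 makes the remaining operator a contraction with factor 1/2\<close>
  define M' where "M' m n = (if m < N then 0 else M m n)" for m n
  have s': "(\<Sum>n. (norm (M' m n))\<^sup>2) = (if m < N then 0 else s m)" for m
    by (simp add: M'_def s_def)
  have sum': "summable (\<lambda>m. if m < N then 0 else s m)"
    by (rule summable_comparison_test'[OF s]) (auto simp: s0)
  have M': "hilbert_schmidt M'"
    unfolding hilbert_schmidt_def s' using sum'
  proof (intro conjI allI)
    show "summable (\<lambda>n. (norm (M' m n))\<^sup>2)" for m
      by (cases "m < N") (simp_all add: M'_def row)
  qed
  have small: "sqrt (\<Sum>m. \<Sum>n. (norm (M' m n))\<^sup>2) \<le> 1 / 2"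
  proof -
    have "(\<Sum>m. \<Sum>n. (norm (M' m n))\<^sup>2) = (\<Sum>m. s (m + N))"
      unfolding s' by (subst suminf_split_initial_segment[OF sum', of N]) simp
    also have "\<dots> \<le> (1 / 2)\<^sup>2" using N by (simp add: power2_eq_square)
    finally show ?thesis by (intro real_le_lsqrt) auto
  qed
  define F where "F x = (\<Sum>i\<in>{..<N} \<times> UNIV. (if snd i then Re (coord (matrix_op M x) (fst i))
      else Im (coord (matrix_op M x) (fst i))) *\<^sub>R single (fst i) (if snd i then 1 else \<i>))" for x
  have split: "matrix_op M x = matrix_op M' x + F x" for x
  proof (rule ell2_eqI)
    fix m
    have "coord (F x) m = (\<Sum>i<N. if m = i then coord (matrix_op M x) i else 0)"
      unfolding F_def coord_sum sum.cartesian_product' UNIV_bool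
      by (intro sum.cong refl) (auto simp: scaleR_ell2.rep_eq coord_single complex_eq_iff)
    then show "coord (matrix_op M x) m = coord (matrix_op M' x + F x) m"
      by (simp add: plus_ell2.rep_eq coord_matrix_op[OF M'] coord_matrix_op[OF M] M'_def)
  qed
  define B where "B = sqrt (\<Sum>m. \<Sum>n. (norm (M m n))\<^sup>2)"
  have "\<exists>C\<ge>0. \<forall>y. \<exists>x. x - (matrix_op M' x + F x) = y \<and> norm x \<le> C * norm y"
  proof (rule fredholm_contraction_plus_finite_rank[OF linear_matrix_op[OF M'] _ _ _ _ _ _ _ F_def])
    show "norm (matrix_op M' x) \<le> 1 / 2 * norm x" for x
      using matrix_op_bound[OF M', of x] small mult_right_mono[OF small, of "norm x"] by simp
    show "0 \<le> B" by (simp add: B_def s_def[symmetric, abs_def] suminf_nonneg s s0)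
    have lin: "linear (matrix_op M)" by (rule linear_matrix_op[OF M])
    show "linear (\<lambda>x. if snd i then Re (coord (matrix_op M x) (fst i)) else Im (coord (matrix_op M x) (fst i)))"
      for i :: "nat \<times> bool"
      by (rule linearI) (auto simp: linear_add[OF lin] linear_cmul[OF lin] plus_ell2.rep_eq scaleR_ell2.rep_eq)
    show "\<bar>if snd i then Re (coord (matrix_op M x) (fst i)) else Im (coord (matrix_op M x) (fst i))\<bar> \<le> B * norm x"
      for i :: "nat \<times> bool" and x
      using abs_Re_le_cmod[of "coord (matrix_op M x) (fst i)"] abs_Im_le_cmod[of "coord (matrix_op M x) (fst i)"]
        coord_le_norm[of "matrix_op M x" "fst i"] matrix_op_bound[OF M, of x] by (auto simp: B_def)
    show "x = 0" if "matrix_op M' x + F x = x" for x using inj that by (simp add: split)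
  qed auto
  then show ?thesis by (simp add: split)
qed

text \<open>
  Fubini's theorem for double series.
\<close>

lemma suminf_swap:
  fixes f :: "nat \<Rightarrow> nat \<Rightarrow> complex"
  assumes inner: "\<And>m. summable (\<lambda>n. norm (f m n))"
    and outer: "summable (\<lambda>m. \<Sum>n. norm (f m n))"
  shows "(\<Sum>m. \<Sum>n. f m n) = (\<Sum>n. \<Sum>m. f m n)"
proof -
  have suminf_eq: "suminf g = infsum g UNIV" if "g summable_on UNIV" for g :: "nat \<Rightarrow> complex"
    using has_sum_imp_sums[OF has_sum_infsum[OF that]] by (simp add: sums_iff)
  have inf_norm: "infsum (\<lambda>n. norm (f m n)) UNIV = (\<Sum>n. norm (f m n))" for m
    using norm_summable_imp_has_sum[of "\<lambda>n. norm (f m n)"] inner[of m]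
    by (intro infsumI) (auto simp: summable_sums)
  have "(\<lambda>m. norm (\<Sum>n. norm (f m n))) summable_on UNIV"
    using outer by (intro norm_summable_imp_summable_on) (auto simp: suminf_nonneg inner)
  then have "(\<lambda>x. norm (case x of (m, n) \<Rightarrow> f m n)) summable_on UNIV \<times> UNIV"
    unfolding Infinite_Sum.abs_summable_on_Sigma_iff using inner
    by (auto simp: inf_norm intro!: norm_summable_imp_summable_on)
  then have f: "(\<lambda>(m, n). f m n) summable_on UNIV \<times> UNIV" by (rule Infinite_Sum.abs_summable_summable)
  then have f': "(\<lambda>(n, m). f m n) summable_on UNIV \<times> UNIV"
    by (subst (asm) summable_on_swap) (simp add: case_prod_unfold)
  note rows = summable_on_SigmaD1[OF f, simplified] and cols = summable_on_SigmaD1[OF f', simplified]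
  have "(\<Sum>m. \<Sum>n. f m n) = infsum (\<lambda>m. infsum (\<lambda>n. f m n) UNIV) UNIV"
    using summable_on_SigmaD[OF f] rows by (simp add: suminf_eq)
  also have "\<dots> = infsum (\<lambda>n. infsum (\<lambda>m. f m n) UNIV) UNIV"
    by (rule infsum_swap_banach[OF f])
  also have "\<dots> = (\<Sum>n. \<Sum>m. f m n)"
    using summable_on_SigmaD[OF f'] cols by (simp add: suminf_eq)
  finally show ?thesis .
qed

lemma pairing_matrix_op:
  assumes M: "hilbert_schmidt M"
  shows "(\<Sum>m. coord h m * (\<Sum>n. M m n * coord x n)) = (\<Sum>n. coord x n * (\<Sum>m. M m n * coord h m))"
proof -
  define s where "s m = (\<Sum>n. (norm (M m n))\<^sup>2)" for m
  have row: "summable (\<lambda>n. (norm (M m n))\<^sup>2)" and s: "summable s" for m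
    using M by (auto simp: hilbert_schmidt_def s_def[abs_def])
  have s0: "s m \<ge> 0" for m unfolding s_def by (rule suminf_nonneg[OF row]) simp
  note prod = sq_summable_mult[OF row coord_summable, of _ x]
  have inner: "summable (\<lambda>n. norm (coord h m * (M m n * coord x n)))" for m
    unfolding norm_mult[of "coord h m"] by (rule summable_mult[OF prod(1)])
  have "summable (\<lambda>m. \<Sum>n. norm (coord h m * (M m n * coord x n)))"
  proof (rule summable_comparison_test')
    show "summable (\<lambda>m. norm (coord h m * of_real (sqrt (s m))) * norm x)"
      by (intro summable_mult2 sq_summable_mult(1) coord_summable) (simp add: s s0)
    fix m
    have "(\<Sum>n. norm (coord h m * (M m n * coord x n))) = norm (coord h m) * (\<Sum>n. norm (M m n * coord x n))"
      unfolding norm_mult[of "coord h m"] by (rule suminf_mult[OF prod(1)])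
    also have "\<dots> \<le> norm (coord h m) * (sqrt (s m) * norm x)"
      using prod(2)[of m] by (intro mult_left_mono) (auto simp: s_def norm_ell2_eq)
    finally show "norm (\<Sum>n. norm (coord h m * (M m n * coord x n))) \<le> norm (coord h m * of_real (sqrt (s m))) * norm x"
      using s0[of m] suminf_nonneg[OF inner[of m]] by (simp add: norm_mult mult.assoc)
  qed
  from suminf_swap[OF inner this]
  have "(\<Sum>m. \<Sum>n. coord h m * (M m n * coord x n)) = (\<Sum>n. \<Sum>m. coord x n * (M m n * coord h m))"
    by (simp add: mult_ac)
  then show ?thesis
    by (simp add: suminf_mult matrix_op_summable[OF M] matrix_op_summable[OF hilbert_schmidt_transpose[OF M]])
qed

text \<open>
  The Fredholm alternative for the transposed matrix makes \<open>1 - M\<^sup>T\<close> onto, and a vector killed by \<open>1 - M\<close>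
  pairs to zero with its range.
\<close>

lemma injective_of_transpose:
  assumes M: "hilbert_schmidt M"
    and inj: "\<And>x. matrix_op (\<lambda>m n. M n m) x = x \<Longrightarrow> x = 0"
    and x: "matrix_op M x = x"
  shows "x = 0"
proof (rule ell2_eqI)
  fix k
  note Mt = hilbert_schmidt_transpose[OF M]
  \<comment> \<open>pairing with this preimage reads off the coordinate k\<close>
  obtain h where h: "h - matrix_op (\<lambda>m n. M n m) h = single k 1"
    using fredholm_hilbert_schmidt[OF Mt inj] by blast
  have hk: "coord h n - (\<Sum>m. M m n * coord h m) = (if n = k then 1 else 0)" for n
    using arg_cong[OF h, of "\<lambda>z. coord z n"]
    by (simp add: minus_ell2.rep_eq coord_matrix_op[OF Mt] coord_single)
  have xm: "(\<Sum>n. M m n * coord x n) = coord x m" for m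
    using arg_cong[OF x, of "\<lambda>z. coord z m"] by (simp add: coord_matrix_op[OF M])
  have xh: "summable (\<lambda>n. coord x n * coord h n)"
    by (rule summable_norm_cancel, rule sq_summable_mult(1)[OF coord_summable coord_summable])
  have xM: "summable (\<lambda>n. coord x n * (\<Sum>m. M m n * coord h m))"
    by (rule summable_norm_cancel,
        rule sq_summable_mult(1)[OF coord_summable[of x] coord_summable[of "matrix_op (\<lambda>m n. M n m) h"],
          unfolded coord_matrix_op[OF Mt]])
  have "coord x k = (\<Sum>n. coord x n * (if n = k then 1 else 0))"
    by (subst suminf_finite[of "{k}"]) auto
  also have "\<dots> = (\<Sum>n. coord x n * coord h n - coord x n * (\<Sum>m. M m n * coord h m))"
    by (simp add: hk[symmetric] right_diff_distrib)
  also have "\<dots> = (\<Sum>n. coord x n * coord h n) - (\<Sum>n. coord x n * (\<Sum>m. M m n * coord h m))"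
    by (rule suminf_diff[OF xh xM, symmetric])
  also have "(\<Sum>n. coord x n * (\<Sum>m. M m n * coord h m)) = (\<Sum>m. coord h m * (\<Sum>n. M m n * coord x n))"
    by (rule pairing_matrix_op[OF M, symmetric])
  also have "\<dots> = (\<Sum>n. coord x n * coord h n)" unfolding xm by (simp only: mult.commute)
  finally show "coord x k = coord 0 k" by (simp add: zero_ell2.rep_eq)
qed

section \<open>Uniqueness for the boundary system\<close>

text \<open>
  The spectral data in abstract form: \<open>L\<close> are the eigenvalues, \<open>b\<close> the normal derivatives of the
  eigenfunctions at the boundary point, \<open>d\<close> the boundary values of the transformed eigenfunctions.
\<close>

locale boundary_system =
  fixes L b :: "nat \<Rightarrow> real" and d :: "nat \<Rightarrow> complex" and lam gam :: real
  assumes L_pos: "\<And>n. 0 < L n" and L_mono: "strict_mono L"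
    and L_sum: "summable (\<lambda>n. 1 / L n)"
    and lam_pos: "0 < lam" and nonres: "\<And>n m. L n - lam \<noteq> L m"
    and gam: "0 < gam" and b_sq: "\<And>n. (b n)\<^sup>2 = gam * L n"
begin

definition entry :: "nat \<Rightarrow> nat \<Rightarrow> complex" where
  "entry m n = d n * (of_real (b m) / of_real (L n - lam - L m))"

text \<open>
  The normal derivative at the boundary point of the resolvent at \<open>r\<close> applied to the function with
  coefficients \<open>h\<close>.
\<close>

definition resolvent_trace :: "real \<Rightarrow> (nat \<Rightarrow> complex) \<Rightarrow> complex" where
  "resolvent_trace r h = (\<Sum>m. h m * (of_real (b m) / of_real (L m - r)))"

lemma b_nz: "b n \<noteq> 0"
  using b_sq[of n] gam L_pos[of n] by auto

lemma L_at_top: "filterlim L at_top sequentially"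
proof -
  have "filterlim (\<lambda>n. inverse (1 / L n)) at_top sequentially"
    by (rule filterlim_inverse_at_top[OF summable_LIMSEQ_zero[OF L_sum]]) (simp add: L_pos)
  then show ?thesis by simp
qed

lemma sq_summable_resolvent:
  assumes "r \<le> 0"
  shows "summable (\<lambda>m. (norm (of_real (b m) / of_real (L m - r) :: complex))\<^sup>2)"
proof (rule summable_comparison_test')
  show "summable (\<lambda>m. gam * (1 / L m))" by (intro summable_mult L_sum)
  fix m
  have "(norm (of_real (b m) / of_real (L m - r) :: complex))\<^sup>2 = gam * L m / (L m - r)\<^sup>2"
    unfolding norm_divide norm_of_real power_divide power2_abs b_sq ..
  also have "\<dots> \<le> gam * L m / (L m)\<^sup>2"
    using L_pos[of m] gam assms by (intro divide_left_mono power_mono) auto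
  finally show "norm ((norm (of_real (b m) / of_real (L m - r) :: complex))\<^sup>2) \<le> gam * (1 / L m)"
    using L_pos[of m] by (simp add: power2_eq_square)
qed

lemma sq_summable_shifted:
  "summable (\<lambda>m. (norm (of_real (b m) / of_real (L n - lam - L m) :: complex))\<^sup>2)"
proof (rule summable_comparison_test_ev)
  show "summable (\<lambda>m. 4 * gam * (1 / L m))" by (intro summable_mult L_sum)
  have "eventually (\<lambda>m. L m \<ge> 2 * \<bar>L n - lam\<bar>) sequentially"
    using L_at_top by (simp add: filterlim_at_top)
  then show "eventually (\<lambda>m. norm ((norm (of_real (b m) / of_real (L n - lam - L m) :: complex))\<^sup>2)
      \<le> 4 * gam * (1 / L m)) sequentially"
  proof eventually_elim
    case (elim m)
    have "L m / 2 \<le> \<bar>L n - lam - L m\<bar>"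

    proof -
      have "l / 2 \<le> \<bar>x - l\<bar>" if "2 * \<bar>x\<bar> \<le> l" for x l :: real
        using that by (simp add: abs_if split: if_splits)
      then show ?thesis using elim by blast
    qed
    then have "(L m / 2)\<^sup>2 \<le> (L n - lam - L m)\<^sup>2"
      using L_pos[of m] by (subst (2) power2_abs[symmetric]) (intro power_mono, auto)
    then have "gam * L m / (L n - lam - L m)\<^sup>2 \<le> gam * L m / (L m / 2)\<^sup>2"
      using L_pos[of m] gam by (intro divide_left_mono) (auto intro!: mult_pos_pos simp: nonres)
    also have "\<dots> = 4 * gam * (1 / L m)"
      using L_pos[of m] by (simp add: power2_eq_square)
    finally show ?case
      unfolding norm_divide norm_of_real power_divide power2_abs b_sq
      using gam L_pos[of m] by (simp add: abs_mult)
  qed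
qed

lemma summable_resolvent_trace:
  fixes h :: "nat \<Rightarrow> complex"
  assumes "r \<le> 0" and "summable (\<lambda>m. (norm (h m))\<^sup>2)"
  shows "summable (\<lambda>m. norm (h m * (of_real (b m) / of_real (L m - r))))"
  by (rule sq_summable_mult(1)[OF assms(2) sq_summable_resolvent[OF assms(1)]])

lemma summable_shifted:
  fixes h :: "nat \<Rightarrow> complex"
  assumes "summable (\<lambda>m. (norm (h m))\<^sup>2)"
  shows "summable (\<lambda>m. h m * (of_real (b m) / of_real (L n - lam - L m)))"
  by (rule summable_norm_cancel, rule sq_summable_mult(1)[OF assms sq_summable_shifted])

lemma summable_entry:
  fixes h :: "nat \<Rightarrow> complex"
  assumes "summable (\<lambda>m. (norm (h m))\<^sup>2)"
  shows "summable (\<lambda>m. h m * entry m n)"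
  using summable_mult[OF summable_shifted[OF assms], of "d n"] by (simp add: entry_def mult_ac)

lemma entry_sum:
  fixes h :: "nat \<Rightarrow> complex"
  assumes "summable (\<lambda>m. (norm (h m))\<^sup>2)"
  shows "(\<Sum>m. h m * entry m n) = d n * (\<Sum>m. h m * (of_real (b m) / of_real (L n - lam - L m)))"
  by (subst suminf_mult[OF summable_shifted[OF assms], symmetric]) (simp add: entry_def mult_ac)

text \<open>
  The resolvent gains two powers of the square root of \<open>L\<close>. The second claim says that its range lies
  in the form domain, whose dual is the space in which the boundary relation is assumed to converge.
\<close>

lemma sq_summable_resolved:
  fixes h :: "nat \<Rightarrow> complex"
  assumes "r \<le> - 1" and h: "summable (\<lambda>m. (norm (h m))\<^sup>2)"
  shows "summable (\<lambda>m. (norm (h m / of_real (L m - r)))\<^sup>2)"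
    and "summable (\<lambda>m. (norm (h m / of_real (L m - r) * of_real (sqrt (L m))))\<^sup>2)"
proof -
  have ge: "1 \<le> L m - r" for m using L_pos[of m] assms(1) by linarith
  show "summable (\<lambda>m. (norm (h m / of_real (L m - r)))\<^sup>2)"
  proof (rule summable_comparison_test'[OF h])
    fix m
    have "norm (h m / of_real (L m - r)) \<le> norm (h m)"
      unfolding norm_divide norm_of_real using ge[of m] divide_left_mono[of 1 "\<bar>L m - r\<bar>" "norm (h m)"] by simp
    then show "norm ((norm (h m / of_real (L m - r)))\<^sup>2) \<le> (norm (h m))\<^sup>2"
      by (simp add: power_mono)
  qed
  show "summable (\<lambda>m. (norm (h m / of_real (L m - r) * of_real (sqrt (L m))))\<^sup>2)"
  proof (rule summable_comparison_test'[OF h])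
    fix m
    have "sqrt (L m) \<le> L m - r"
    proof (rule real_le_lsqrt)
      have "L m * 1 \<le> (L m - r) * (L m - r)"
        using ge[of m] L_pos[of m] assms(1) by (intro mult_mono) auto
      then show "L m \<le> (L m - r)\<^sup>2" by (simp add: power2_eq_square)
    qed (use ge[of m] in auto)
    then have "norm (h m) * sqrt (L m) \<le> norm (h m) * (L m - r)" by (rule mult_left_mono) simp
    then have "norm (h m / of_real (L m - r) * of_real (sqrt (L m))) \<le> norm (h m)"
      unfolding norm_divide norm_mult norm_of_real using ge[of m] L_pos[of m] by (simp add: field_simps)
    then show "norm ((norm (h m / of_real (L m - r) * of_real (sqrt (L m))))\<^sup>2) \<le> (norm (h m))\<^sup>2"
      by (simp add: power_mono)
  qed
qed

text \<open>
  Partial fractions: with \<open>A = L m - r\<close> and \<open>B = L n - lam - L m\<close> the sum \<open>A + B\<close> does not depend on \<open>m\<close>, so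
  \<open>1 / (A B) = (1 / A + 1 / B) / (A + B)\<close> splits the series into the trace and a multiple of the sum that
  vanishes by assumption.
\<close>

lemma entry_sum_resolved:
  fixes h :: "nat \<Rightarrow> complex"
  assumes r: "r \<le> - 1" "r \<le> - lam"
    and h: "summable (\<lambda>m. (norm (h m))\<^sup>2)" and 0: "(\<Sum>m. h m * entry m n) = 0"
  shows "(\<Sum>m. h m / of_real (L m - r) * entry m n) = d n * resolvent_trace r h / of_real (L n - lam - r)"
proof -
  define a where "a m = (of_real (b m) / of_real (L m - r) :: complex)" for m
  define c where "c m = (of_real (b m) / of_real (L n - lam - L m) :: complex)" for m
  have pf: "h m / of_real (L m - r) * c m = (h m * a m + h m * c m) / of_real (L n - lam - r)" for m
  proof -
    have "L m - r \<noteq> 0" "L n - lam - L m \<noteq> 0" "L n - lam - r \<noteq> 0"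
      using L_pos[of m] L_pos[of n] nonres[of n m] r lam_pos by auto
    then have ne: "(of_real (L m - r) :: complex) \<noteq> 0" "(of_real (L n - lam - L m) :: complex) \<noteq> 0"
        "(of_real (L n - lam - r) :: complex) \<noteq> 0"
      by (simp_all only: of_real_eq_0_iff not_False_eq_True)
    have "(of_real (L n - lam - r) :: complex) = of_real (L m - r) + of_real (L n - lam - L m)"
      by (simp flip: of_real_add)
    moreover have "x / u * (y / v) = (x * (y / u) + x * (y / v)) / (u + v)"
      if "u \<noteq> 0" "v \<noteq> 0" "u + v \<noteq> 0" for x y u v :: complex
    proof -
      have "x * (y / u) + x * (y / v) = x * y * (u + v) / (u * v)"
        using that(1,2) by (simp add: field_simps)
      then show ?thesis using that by simp
    qed
    ultimately show ?thesis using ne unfolding a_def c_def by metis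
  qed
  have sa: "summable (\<lambda>m. h m * a m)"
    unfolding a_def by (rule summable_norm_cancel, rule summable_resolvent_trace) (use r h in auto)
  have sc: "summable (\<lambda>m. h m * c m)"
    unfolding c_def by (rule summable_shifted[OF h])
  have "(\<Sum>m. h m / of_real (L m - r) * entry m n) = d n * (\<Sum>m. h m / of_real (L m - r) * c m)"
    unfolding c_def by (rule entry_sum[OF sq_summable_resolved(1)[OF r(1) h]])
  also have "(\<Sum>m. h m / of_real (L m - r) * c m)
      = ((\<Sum>m. h m * a m) + (\<Sum>m. h m * c m)) / of_real (L n - lam - r)"
    unfolding pf suminf_add[OF sa sc] by (rule suminf_divide[OF summable_add[OF sa sc]])
  also have "d n * \<dots> = (d n * resolvent_trace r h + d n * (\<Sum>m. h m * c m)) / of_real (L n - lam - r)"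
    by (simp add: resolvent_trace_def a_def algebra_simps add_divide_distrib)
  also have "d n * (\<Sum>m. h m * c m) = 0"
    using 0 entry_sum[OF h, of n] by (simp add: c_def)
  finally show ?thesis by simp
qed

text \<open>
  The series is dominated by \<open>D \<Sum> 1 / (L n + s)\<close> with \<open>s = - lam - r\<close>, which tends to zero as \<open>s\<close> grows.
\<close>

lemma small_response_exists:
  assumes D: "\<And>n. norm (of_real (b n) * d n) \<le> D"
  obtains r where "r \<le> - 1" "r \<le> - lam"
    "summable (\<lambda>n. of_real (b n) * d n / of_real (L n - lam - r))"
    "norm (\<Sum>n. of_real (b n) * d n / of_real (L n - lam - r)) < 1"
proof -
  have D0: "D \<ge> 0" using D[of 0] norm_ge_zero order_trans by blast
  have sm: "summable (\<lambda>n. 1 / (L n + real s))" for s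
    by (rule summable_comparison_test'[OF L_sum])
       (use L_pos in \<open>auto simp: less_imp_le intro!: divide_left_mono mult_pos_pos add_pos_nonneg\<close>)
  have "(\<lambda>s. \<Sum>n. 1 / (L n + real s)) \<longlonglongrightarrow> (\<Sum>n. 0)"
  proof (rule conjunct2[OF conjunct2[OF tannerys_theorem[where M = "\<lambda>n. 1 / L n"]]])
    show "(\<lambda>s. 1 / (L k + real s)) \<longlonglongrightarrow> 0" for k
      by (intro tendsto_divide_0[OF tendsto_const] filterlim_at_top_imp_at_infinity
          filterlim_tendsto_add_at_top[OF tendsto_const] filterlim_real_sequentially)
    show "\<forall>\<^sub>F (k, s) in sequentially \<times>\<^sub>F sequentially. norm (1 / (L k + real s)) \<le> 1 / L k"
      by (rule always_eventually)
         (use L_pos in \<open>auto simp: less_imp_le abs_of_pos add_pos_nonneg intro!: divide_left_mono mult_pos_pos add_pos_nonneg\<close>)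
  qed (use L_sum in auto)
  then have "(\<lambda>s. D * (\<Sum>n. 1 / (L n + real s))) \<longlonglongrightarrow> D * 0"
    by (intro tendsto_mult tendsto_const) simp
  then have "eventually (\<lambda>s. D * (\<Sum>n. 1 / (L n + real s)) < 1) sequentially"
    by (rule order_tendstoD) simp
  then obtain s where s: "D * (\<Sum>n. 1 / (L n + real s)) < 1" "s \<ge> 1"
    using eventually_conj[OF _ eventually_ge_at_top[of 1]] by (metis (no_types, lifting) eventually_sequentially le_refl)
  \<comment> \<open>this turns L n - lam - r into L n + s\<close>
  define r where "r = - lam - real s"
  have bound: "norm (of_real (b n) * d n / of_real (L n - lam - r)) \<le> D * (1 / (L n + real s))" for n
  proof -
    have "norm (of_real (b n) * d n / of_real (L n - lam - r)) = norm (of_real (b n) * d n) / (L n + real s)"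
      unfolding norm_divide norm_of_real r_def using L_pos[of n] by simp
    also have "\<dots> \<le> D / (L n + real s)"
      using L_pos[of n] by (intro divide_right_mono D) auto
    finally show ?thesis by simp
  qed
  have sn: "summable (\<lambda>n. norm (of_real (b n) * d n / of_real (L n - lam - r)))"
    by (rule summable_comparison_test'[OF summable_mult[OF sm, of D]]) (use bound in auto)
  have "norm (\<Sum>n. of_real (b n) * d n / of_real (L n - lam - r)) \<le> (\<Sum>n. D * (1 / (L n + real s)))"
    by (rule order_trans[OF summable_norm[OF sn] suminf_le[OF bound sn summable_mult[OF sm]]])
  also have "\<dots> < 1" using s(1) suminf_mult[OF sm, of D] by simp
  finally show thesis
    using that[of r] summable_norm_cancel[OF sn] s(2) lam_pos by (simp add: r_def)
qed

text \<open>
  The boundary relation is tested against the resolved sequence \<open>g\<close>. By \<open>entry_sum_resolved\<close> the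
  partial sums of the pairing tend to \<open>F - F \<Phi>\<close> with \<open>F\<close> the trace, whereas the relation forces them
  to tend to zero. As \<open>\<Phi> \<noteq> 1\<close>, the trace vanishes, and with it the error in the partial fraction
  formula, so that \<open>g\<close> again annihilates the range.
\<close>

lemma resolvent_step:
  fixes h :: "nat \<Rightarrow> complex"
  assumes r: "r \<le> - 1" "r \<le> - lam"
    and resp: "(\<lambda>n. of_real (b n) * d n / of_real (L n - lam - r)) sums \<Phi>" "\<Phi> \<noteq> 1"
    and res_sum: "\<And>N. summable (\<lambda>m. (norm (\<Sum>n<N. of_real (b n) * ((if n = m then 1 else 0) - entry m n)))\<^sup>2 / L m)"
    and res_lim: "(\<lambda>N. \<Sum>m. (norm (\<Sum>n<N. of_real (b n) * ((if n = m then 1 else 0) - entry m n)))\<^sup>2 / L m) \<longlonglongrightarrow> 0"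
    and h: "summable (\<lambda>m. (norm (h m))\<^sup>2)" and h0: "\<And>n. (\<Sum>m. h m * entry m n) = 0"
  shows "resolvent_trace r h = 0" and "(\<Sum>m. h m / of_real (L m - r) * entry m n) = 0"
proof -
  define v where "v N m = (\<Sum>n<N. of_real (b n) * ((if n = m then 1 else 0) - entry m n))" for N m
  define g where "g m = h m / of_real (L m - r)" for m
  have g: "summable (\<lambda>m. (norm (g m))\<^sup>2)" "summable (\<lambda>m. (norm (g m * of_real (sqrt (L m))))\<^sup>2)"
    unfolding g_def by (rule sq_summable_resolved[OF r(1) h])+
  have vN: "(norm (v N m / of_real (sqrt (L m))))\<^sup>2 = (norm (v N m))\<^sup>2 / L m" for N m
    using L_pos[of m] by (simp add: norm_divide power_divide)
  have sv: "summable (\<lambda>m. (norm (v N m / of_real (sqrt (L m))))\<^sup>2)" for N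
    unfolding vN using res_sum[of N] by (simp add: v_def)
  have gv: "g m * of_real (sqrt (L m)) * (v N m / of_real (sqrt (L m))) = g m * v N m" for N m
    using L_pos[of m] by simp
  have pair_lim: "(\<lambda>N. \<Sum>m. g m * v N m) \<longlonglongrightarrow> 0"
  proof (rule Lim_null_comparison)
    show "eventually (\<lambda>N. norm (\<Sum>m. g m * v N m)
        \<le> sqrt (\<Sum>m. (norm (g m * of_real (sqrt (L m))))\<^sup>2) * sqrt (\<Sum>m. (norm (v N m))\<^sup>2 / L m)) sequentially"
      using sq_summable_mult(3)[OF g(2) sv] by (intro always_eventually allI) (simp only: gv vN)
    have "(\<lambda>N. sqrt (\<Sum>m. (norm (g m * of_real (sqrt (L m))))\<^sup>2) * sqrt (\<Sum>m. (norm (v N m))\<^sup>2 / L m))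
        \<longlonglongrightarrow> sqrt (\<Sum>m. (norm (g m * of_real (sqrt (L m))))\<^sup>2) * sqrt 0"
      by (intro tendsto_mult tendsto_const tendsto_real_sqrt) (use res_lim in \<open>simp add: v_def\<close>)
    then show "(\<lambda>N. sqrt (\<Sum>m. (norm (g m * of_real (sqrt (L m))))\<^sup>2) * sqrt (\<Sum>m. (norm (v N m))\<^sup>2 / L m)) \<longlonglongrightarrow> 0"
      by simp
  qed
  have col: "(\<Sum>m. g m * entry m n) = d n * resolvent_trace r h / of_real (L n - lam - r)" for n
    unfolding g_def by (rule entry_sum_resolved[OF r h h0])
  have pair_eq: "(\<Sum>m. g m * v N m)
      = (\<Sum>n<N. g n * of_real (b n)) - resolvent_trace r h * (\<Sum>n<N. of_real (b n) * d n / of_real (L n - lam - r))" for N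
  proof -
    have t: "(\<lambda>m. g m * (of_real (b n) * ((if n = m then 1 else 0) - entry m n)))
        sums (g n * of_real (b n) - of_real (b n) * (d n * resolvent_trace r h / of_real (L n - lam - r)))" for n
    proof -
      have "(\<lambda>m. if m = n then g m * of_real (b n) else 0) sums (g n * of_real (b n))"
        by (rule sums_single)
      moreover have "(\<lambda>m. of_real (b n) * (g m * entry m n))
          sums (of_real (b n) * (d n * resolvent_trace r h / of_real (L n - lam - r)))"
        using summable_sums[OF summable_entry[OF g(1)], of n] unfolding col by (rule sums_mult)
      ultimately have "(\<lambda>m. (if m = n then g m * of_real (b n) else 0) - of_real (b n) * (g m * entry m n))
          sums (g n * of_real (b n) - of_real (b n) * (d n * resolvent_trace r h / of_real (L n - lam - r)))"
        by (rule sums_diff)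
      then show ?thesis
        by (rule back_subst[where P = "\<lambda>f. f sums _"]) (auto simp: algebra_simps)
    qed
    have "(\<lambda>m. \<Sum>n<N. g m * (of_real (b n) * ((if n = m then 1 else 0) - entry m n)))
        sums (\<Sum>n<N. g n * of_real (b n) - of_real (b n) * (d n * resolvent_trace r h / of_real (L n - lam - r)))"
      by (rule sums_sum) (rule t)
    then have "(\<lambda>m. g m * v N m)
        sums (\<Sum>n<N. g n * of_real (b n) - of_real (b n) * (d n * resolvent_trace r h / of_real (L n - lam - r)))"
      by (simp add: v_def sum_distrib_left)
    then show ?thesis
      by (simp add: sums_iff sum_subtractf sum_distrib_left mult_ac)
  qed
  have "(\<lambda>n. g n * of_real (b n)) sums resolvent_trace r h"
    using summable_sums[OF summable_norm_cancel[OF summable_resolvent_trace[OF _ h, of r]]] r(1)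
    by (simp add: resolvent_trace_def g_def)
  then have "(\<lambda>N. \<Sum>m. g m * v N m) \<longlonglongrightarrow> resolvent_trace r h - resolvent_trace r h * \<Phi>"
    unfolding pair_eq using resp(1) unfolding sums_def by (intro tendsto_intros)
  from LIMSEQ_unique[OF this pair_lim] have "resolvent_trace r h * (1 - \<Phi>) = 0" by (simp add: algebra_simps)
  then show T0: "resolvent_trace r h = 0" using resp(2) by simp
  show "(\<Sum>m. h m / of_real (L m - r) * entry m n) = 0" using col[of n] by (simp add: g_def T0)
qed

text \<open>
  After multiplication by \<open>(L m - r)\<^sup>k\<close> all terms beyond the \<open>m\<close>-th decay geometrically in \<open>k\<close>, and the earlier
  ones vanish by induction; dominated convergence isolates the \<open>m\<close>-th term.
\<close>

lemma vanishing_of_moments: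
  fixes h :: "nat \<Rightarrow> complex"
  assumes r: "r \<le> 0" and h: "summable (\<lambda>m. (norm (h m))\<^sup>2)"
    and mom: "\<And>k. resolvent_trace r (\<lambda>m. h m / of_real (L m - r) ^ k) = 0"
  shows "h m = 0"
proof (induction m rule: less_induct)
  case (less m)
  define p where "p j = L j - r" for j
  have p: "p j > 0" for j using L_pos[of j] r by (simp add: p_def)
  define q where "q j = p m / p j" for j
  define a where "a j k = (if j < m then 0 else h j * of_real (b j) / of_real (p j) * of_real (q j ^ k))" for j k
  have q1: "q j \<le> 1" "0 < q j" if "j \<ge> m" for j
    using p strict_mono_less_eq[OF L_mono, of m j] that by (auto simp: q_def p_def)
  have sum0: "(\<Sum>j. a j k) = 0" for k
  proof -
    have "a j k = of_real (p m ^ k) * (h j / of_real (L j - r) ^ k * (of_real (b j) / of_real (L j - r)))" for j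
    proof (cases "j < m")
      case False
      then show ?thesis
        by (simp add: a_def q_def p_def power_divide mult_ac)
    qed (use less[of j] in \<open>simp add: a_def\<close>)
    moreover have "summable (\<lambda>j. h j / of_real (L j - r) ^ k * (of_real (b j) / of_real (L j - r)))"
    proof (rule summable_norm_cancel, rule summable_comparison_test_ev)
      show "summable (\<lambda>m. norm (h m * (of_real (b m) / of_real (L m - r))))"
        by (rule summable_resolvent_trace[OF r h])
      have "eventually (\<lambda>j. L j \<ge> 1) sequentially" using L_at_top by (simp add: filterlim_at_top)
      then show "eventually (\<lambda>j. norm (norm (h j / of_real (L j - r) ^ k * (of_real (b j) / of_real (L j - r))))
          \<le> norm (h j * (of_real (b j) / of_real (L j - r)))) sequentially"
      proof eventually_elim
        case (elim j)
        have "norm (h j / of_real (L j - r) ^ k) \<le> norm (h j)"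
          unfolding norm_divide norm_power norm_of_real
          using elim r divide_left_mono[of 1 "\<bar>L j - r\<bar> ^ k" "norm (h j)"] by (simp add: one_le_power)
        then show ?case unfolding norm_mult by (simp add: mult_right_mono)
      qed
    qed
    ultimately show ?thesis
      using mom[of k] unfolding resolvent_trace_def by (simp only: suminf_mult mult_zero_right)
  qed
  have "(\<lambda>k. \<Sum>j. a j k) \<longlonglongrightarrow> (\<Sum>j. if j = m then h m * of_real (b m) / of_real (p m) else 0)"
  proof (rule conjunct2[OF conjunct2[OF tannerys_theorem[where M = "\<lambda>j. norm (h j * (of_real (b j) / of_real (L j - r)))"]]])
    fix j
    consider "j < m" | "j = m" | "j > m" by linarith
    then show "(\<lambda>k. a j k) \<longlonglongrightarrow> (if j = m then h m * of_real (b m) / of_real (p m) else 0)"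
    proof cases
      case 3
      have "q j < 1" using p strict_mono_less[OF L_mono, of m j] 3 by (simp add: q_def p_def)
      then have "(\<lambda>k. q j ^ k) \<longlonglongrightarrow> 0" using q1[of j] 3 by (intro LIMSEQ_power_zero) auto
      then have "(\<lambda>k. of_real (q j ^ k) :: complex) \<longlonglongrightarrow> of_real 0" by (rule tendsto_of_real)
      from tendsto_mult[OF tendsto_const[of "h j * of_real (b j) / of_real (p j)"] this]
      show ?thesis using 3 by (simp add: a_def)
    qed (use p[of m] in \<open>auto simp: a_def q_def\<close>)
  next
    have "norm (a j k) \<le> norm (h j * (of_real (b j) / of_real (L j - r)))" for j k
    proof (cases "j < m")
      case False
      then have "q j ^ k \<le> 1" "0 \<le> q j ^ k" using q1[of j] by (auto simp: power_le_one)
      then have "norm (of_real (q j ^ k) :: complex) \<le> 1" by (simp only: norm_of_real abs_of_nonneg)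
      then have "norm (h j * of_real (b j) / of_real (p j) * of_real (q j ^ k))
          \<le> norm (h j * of_real (b j) / of_real (p j)) * 1"
        unfolding norm_mult[of _ "of_real (q j ^ k)"] by (rule mult_left_mono) simp
      then show ?thesis using False by (simp add: a_def p_def)
    qed (simp add: a_def)
    then show "\<forall>\<^sub>F (j, k) in sequentially \<times>\<^sub>F sequentially. norm (a j k) \<le> norm (h j * (of_real (b j) / of_real (L j - r)))"
      by (intro always_eventually) auto
  qed (use summable_resolvent_trace[OF r h] in auto)
  then have "h m * of_real (b m) / of_real (p m) = 0"
    using sums_unique[OF sums_single[of m "\<lambda>_. h m * of_real (b m) / of_real (p m)"]]
    by (simp add: sum0 LIMSEQ_const_iff)
  then show ?case using b_nz[of m] p[of m] by simp
qed

theorem orthogonal_to_range_imp_zero: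
  fixes h :: "nat \<Rightarrow> complex"
  assumes D: "\<And>n. norm (of_real (b n) * d n) \<le> D"
    and res_sum: "\<And>N. summable (\<lambda>m. (norm (\<Sum>n<N. of_real (b n) * ((if n = m then 1 else 0) - entry m n)))\<^sup>2 / L m)"
    and res_lim: "(\<lambda>N. \<Sum>m. (norm (\<Sum>n<N. of_real (b n) * ((if n = m then 1 else 0) - entry m n)))\<^sup>2 / L m) \<longlonglongrightarrow> 0"
    and h: "summable (\<lambda>m. (norm (h m))\<^sup>2)" and h0: "\<And>n. (\<Sum>m. h m * entry m n) = 0"
  shows "h m = 0"
proof -
  obtain r where r: "r \<le> - 1" "r \<le> - lam"
    and sm: "summable (\<lambda>n. of_real (b n) * d n / of_real (L n - lam - r))"
    and lt: "norm (\<Sum>n. of_real (b n) * d n / of_real (L n - lam - r)) < 1"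
    by (rule small_response_exists[OF D])
  have ne: "(\<Sum>n. of_real (b n) * d n / of_real (L n - lam - r)) \<noteq> 1"
    using lt by auto
  note step = resolvent_step[OF r summable_sums[OF sm] ne res_sum res_lim]
  have all: "summable (\<lambda>m. (norm (h m / of_real (L m - r) ^ k))\<^sup>2)
      \<and> (\<forall>n. (\<Sum>m. h m / of_real (L m - r) ^ k * entry m n) = 0)" for k
  proof (induction k)
    case (Suc k)
    have eq: "h m / of_real (L m - r) ^ Suc k = h m / of_real (L m - r) ^ k / of_real (L m - r)" for m
      by (simp add: mult.commute)
    show ?case unfolding eq
      using sq_summable_resolved(1)[OF r(1), of "\<lambda>m. h m / of_real (L m - r) ^ k"]
        step(2)[of "\<lambda>m. h m / of_real (L m - r) ^ k"] Suc.IH by simp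
  qed (use h h0 in auto)
  have mom: "resolvent_trace r (\<lambda>m. h m / of_real (L m - r) ^ k) = 0" for k
    using all[of k] by (intro step(1)) auto
  show ?thesis using vanishing_of_moments[OF _ h mom] r(1) by simp
qed

end

section \<open>Square-integrable functions\<close>

text \<open>
  The square of the norm; working with it avoids square roots in the estimates below.
\<close>

definition L2_sq :: "'a measure \<Rightarrow> ('a \<Rightarrow> complex) \<Rightarrow> real" where
  "L2_sq M f = (LINT x|M. (norm (f x))\<^sup>2)"

lemma L2_sq_nonneg: "0 \<le> L2_sq M f"
  unfolding L2_sq_def by (rule integral_nonneg_AE) simp

lemma L2_norm_eq: "L2_norm M f = sqrt (L2_sq M f)"
  by (simp add: L2_norm_def L2_sq_def)

lemma L2D: "f \<in> L2 M \<Longrightarrow> f \<in> borel_measurable M" "f \<in> L2 M \<Longrightarrow> integrable M (\<lambda>x. (norm (f x))\<^sup>2)"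
  by (auto simp: L2_def)

lemma L2_add:
  assumes "f \<in> L2 M" "g \<in> L2 M"
  shows "(\<lambda>x. f x + g x) \<in> L2 M"
proof -
  note [measurable] = L2D(1)[OF assms(1)] L2D(1)[OF assms(2)]
  have "integrable M (\<lambda>x. (norm (f x + g x))\<^sup>2)"
    by (rule Bochner_Integration.integrable_bound[where f = "\<lambda>x. 2 * (norm (f x))\<^sup>2 + 2 * (norm (g x))\<^sup>2"])
       (use L2D(2)[OF assms(1)] L2D(2)[OF assms(2)] norm_add_sq_le in auto)
  then show ?thesis by (simp add: L2_def)
qed

lemma L2_sq_add_le:
  assumes "f \<in> L2 M" "g \<in> L2 M"
  shows "L2_sq M (\<lambda>x. f x + g x) \<le> 2 * L2_sq M f + 2 * L2_sq M g"
proof -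
  have "L2_sq M (\<lambda>x. f x + g x) \<le> (LINT x|M. 2 * (norm (f x))\<^sup>2 + 2 * (norm (g x))\<^sup>2)"
    unfolding L2_sq_def
    by (rule integral_mono) (use L2D(2)[OF L2_add[OF assms]] L2D(2)[OF assms(1)] L2D(2)[OF assms(2)] norm_add_sq_le in auto)
  then show ?thesis using L2D(2)[OF assms(1)] L2D(2)[OF assms(2)] by (simp add: L2_sq_def)
qed

lemma L2_cmult: "f \<in> L2 M \<Longrightarrow> (\<lambda>x. a * f x) \<in> L2 M"
  by (auto simp: L2_def norm_mult power_mult_distrib)

lemma L2_diff: "f \<in> L2 M \<Longrightarrow> g \<in> L2 M \<Longrightarrow> (\<lambda>x. f x - g x) \<in> L2 M"
  using L2_add[of f M "\<lambda>x. (- 1) * g x"] L2_cmult[of g M "- 1"] by simp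

lemma L2_sq_uminus: "L2_sq M (\<lambda>x. - f x) = L2_sq M f"
  by (simp add: L2_sq_def)

lemma L2_sq_diff_le:
  assumes "f \<in> L2 M" "g \<in> L2 M"
  shows "L2_sq M (\<lambda>x. f x - g x) \<le> 2 * L2_sq M f + 2 * L2_sq M g"
  using L2_sq_add_le[OF assms(1) L2_cmult[OF assms(2), of "- 1"]] by (simp add: L2_sq_uminus)

lemma L2_zero: "(\<lambda>x. 0) \<in> L2 M"
  by (simp add: L2_def)

lemma L2_sum: "(\<And>i. i \<in> I \<Longrightarrow> f i \<in> L2 M) \<Longrightarrow> (\<lambda>x. \<Sum>i\<in>I. f i x) \<in> L2 M"
  by (induction I rule: infinite_finite_induct) (auto intro: L2_add L2_zero)

lemma L2_sq_cong_AE: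
  assumes "f \<in> borel_measurable M" "g \<in> borel_measurable M" "AE x in M. f x = g x"
  shows "L2_sq M f = L2_sq M g"
  unfolding L2_sq_def using assms by (intro integral_cong_AE) auto

lemma L2_of_AE_bound:
  assumes [measurable]: "f \<in> borel_measurable M" and "integrable M g" and "AE x in M. (norm (f x))\<^sup>2 \<le> g x"
  shows "f \<in> L2 M" and "L2_sq M f \<le> integral\<^sup>L M g"
proof -
  have *: "integrable M (\<lambda>x. (norm (f x))\<^sup>2)"
    by (rule Bochner_Integration.integrable_bound[OF assms(2)]) (use assms(3) in auto)
  then show "f \<in> L2 M" by (simp add: L2_def)
  show "L2_sq M f \<le> integral\<^sup>L M g"
    unfolding L2_sq_def by (rule integral_mono_AE[OF * assms(2,3)])
qed

lemma L2_mult_integrable: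
  assumes "f \<in> L2 M" "g \<in> L2 M"
  shows "integrable M (\<lambda>x. f x * g x)"
proof (rule Bochner_Integration.integrable_bound)
  note [measurable] = L2D(1)[OF assms(1)] L2D(1)[OF assms(2)]
  show "integrable M (\<lambda>x. (norm (f x))\<^sup>2 + (norm (g x))\<^sup>2)"
    using L2D(2)[OF assms(1)] L2D(2)[OF assms(2)] by simp
  show "(\<lambda>x. f x * g x) \<in> borel_measurable M" by simp
  have "norm (a * b) \<le> (norm a)\<^sup>2 + (norm b)\<^sup>2" for a b :: complex
    using sum_squares_bound[of "norm a" "norm b"] mult_nonneg_nonneg[OF norm_ge_zero[of a] norm_ge_zero[of b]]
    unfolding norm_mult by linarith
  then show "AE x in M. norm (f x * g x) \<le> norm ((norm (f x))\<^sup>2 + (norm (g x))\<^sup>2)"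
    by (intro always_eventually allI) (simp add: abs_of_nonneg)
qed

lemma measurable_cnj:
  fixes f :: "'a \<Rightarrow> complex"
  shows "f \<in> borel_measurable M \<Longrightarrow> (\<lambda>x. cnj (f x)) \<in> borel_measurable M"
  by (rule borel_measurable_continuous_on[OF continuous_on_cnj[OF continuous_on_id]])

lemma L2_cnj: "f \<in> L2 M \<Longrightarrow> (\<lambda>x. cnj (f x)) \<in> L2 M"
  by (auto simp: L2_def intro: measurable_cnj)

text \<open>
  The pointwise inequality \<open>2 s t |f g| \<le> s\<^sup>2 |f|\<^sup>2 + t\<^sup>2 |g|\<^sup>2\<close> is integrated; suitable \<open>s\<close> and \<open>t\<close> then
  give the claim.
\<close>

lemma L2_Cauchy_Schwarz:
  assumes f: "f \<in> L2 M" and g: "g \<in> L2 M"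
  shows "(norm (LINT x|M. f x * g x))\<^sup>2 \<le> L2_sq M f * L2_sq M g"
proof -
  define c where "c = (LINT x|M. f x * g x)"
  define A where "A = L2_sq M f"
  define B where "B = L2_sq M g"
  have AB: "A \<ge> 0" "B \<ge> 0" by (simp_all add: A_def B_def L2_sq_nonneg)
  have quad: "2 * s * t * norm c \<le> s\<^sup>2 * A + t\<^sup>2 * B" if "s \<ge> 0" "t \<ge> 0" for s t
  proof -
    have i: "integrable M (\<lambda>x. norm (f x * g x))"
      using L2_mult_integrable[OF f g] by (rule integrable_norm)
    have "2 * s * t * norm c \<le> 2 * s * t * (LINT x|M. norm (f x * g x))"
      unfolding c_def using that by (intro mult_left_mono integral_norm_bound) auto
    also have "\<dots> = (LINT x|M. 2 * s * t * norm (f x * g x))" by simp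
    also have "\<dots> \<le> (LINT x|M. s\<^sup>2 * (norm (f x))\<^sup>2 + t\<^sup>2 * (norm (g x))\<^sup>2)"
    proof (rule integral_mono)
      show "2 * s * t * norm (f x * g x) \<le> s\<^sup>2 * (norm (f x))\<^sup>2 + t\<^sup>2 * (norm (g x))\<^sup>2" for x
        using sum_squares_bound[of "s * norm (f x)" "t * norm (g x)"]
        by (simp add: norm_mult power_mult_distrib mult_ac)
    qed (use i L2D(2)[OF f] L2D(2)[OF g] in auto)
    also have "\<dots> = s\<^sup>2 * A + t\<^sup>2 * B"
      using L2D(2)[OF f] L2D(2)[OF g] by (simp add: A_def B_def L2_sq_def)
    finally show ?thesis .
  qed
  have "(norm c)\<^sup>2 \<le> A * B"
  proof (cases "B = 0")
    case True
    have "norm c = 0"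
    proof (rule ccontr)
      assume "norm c \<noteq> 0"
      then have "norm c > 0" by simp
      \<comment> \<open>a large t contradicts the bound, whose right-hand side does not grow with t\<close>
      from quad[of 1 "(A + 1) / norm c"] AB this True show False by simp
    qed
    then show ?thesis using AB by simp
  next
    case False
    then have "B > 0" using AB by simp
    \<comment> \<open>the choice of s and t that makes the quadratic inequality sharp\<close>
    from quad[of B "norm c"] AB have "2 * B * norm c * norm c \<le> B\<^sup>2 * A + (norm c)\<^sup>2 * B" by simp
    then have "B * (norm c)\<^sup>2 \<le> B * (A * B)" by (simp add: power2_eq_square algebra_simps)
    then show ?thesis using \<open>B > 0\<close> by simp
  qed
  then show ?thesis by (simp add: c_def A_def B_def)
qed

lemma L2_inner_bound:
  assumes "f \<in> L2 M" "g \<in> L2 M"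
  shows "(norm (L2_inner M f g))\<^sup>2 \<le> L2_sq M f * L2_sq M g"
  using L2_Cauchy_Schwarz[OF assms(1) L2_cnj[OF assms(2)]] by (simp add: L2_inner_def L2_sq_def)

lemma L2_inner_add:
  assumes "f \<in> L2 M" "g \<in> L2 M" "h \<in> L2 M"
  shows "L2_inner M (\<lambda>x. f x + g x) h = L2_inner M f h + L2_inner M g h"
  using L2_mult_integrable[OF assms(1) L2_cnj[OF assms(3)]] L2_mult_integrable[OF assms(2) L2_cnj[OF assms(3)]]
  by (simp add: L2_inner_def distrib_right)

lemma L2_inner_cmult: "L2_inner M (\<lambda>x. a * f x) h = a * L2_inner M f h"
  by (simp add: L2_inner_def mult.assoc)

lemma L2_inner_diff:
  assumes "f \<in> L2 M" "g \<in> L2 M" "h \<in> L2 M"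
  shows "L2_inner M (\<lambda>x. f x - g x) h = L2_inner M f h - L2_inner M g h"
  using L2_mult_integrable[OF assms(1) L2_cnj[OF assms(3)]] L2_mult_integrable[OF assms(2) L2_cnj[OF assms(3)]]
  by (simp add: L2_inner_def left_diff_distrib)

lemma L2_inner_sum:
  assumes "\<And>i. i \<in> I \<Longrightarrow> f i \<in> L2 M" "h \<in> L2 M"
  shows "L2_inner M (\<lambda>x. \<Sum>i\<in>I. a i * f i x) h = (\<Sum>i\<in>I. a i * L2_inner M (f i) h)"
  using assms
proof (induction I rule: infinite_finite_induct)
  case (insert i I)
  have s: "(\<lambda>x. \<Sum>i\<in>I. a i * f i x) \<in> L2 M" using insert by (intro L2_sum L2_cmult) auto
  have "L2_inner M (\<lambda>x. a i * f i x + (\<Sum>i\<in>I. a i * f i x)) h = a i * L2_inner M (f i) h + (\<Sum>i\<in>I. a i * L2_inner M (f i) h)"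
    using insert by (subst L2_inner_add[OF L2_cmult s]) (auto simp: L2_inner_cmult)
  then show ?case using insert by simp
qed (auto simp: L2_inner_def)

lemma L2_inner_commute: "L2_inner M g f = cnj (L2_inner M f g)"
  using Bochner_Integration.integral_cnj[of M "\<lambda>x. f x * cnj (g x)"] by (simp add: L2_inner_def mult.commute)

lemma L2_inner_self: "L2_inner M f f = of_real (L2_sq M f)"
proof -
  have "f x * cnj (f x) = of_real ((norm (f x))\<^sup>2)" for x
    by (rule complex_norm_square[symmetric])
  then show ?thesis by (simp only: L2_inner_def L2_sq_def integral_complex_of_real)
qed

lemma L2_inner_cong_AE:
  assumes "f \<in> borel_measurable M" "g \<in> borel_measurable M" "h \<in> borel_measurable M" "AE x in M. f x = g x"
  shows "L2_inner M f h = L2_inner M g h"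
proof -
  note [measurable] = assms(1,2) measurable_cnj[OF assms(3)]
  show ?thesis unfolding L2_inner_def using assms(4) by (intro integral_cong_AE) auto
qed

lemma L2_sq_orthonormal_sum:
  fixes e :: "nat \<Rightarrow> 'a \<Rightarrow> complex"
  assumes e: "\<And>n. e n \<in> L2 M" and on: "\<And>n m. L2_inner M (e n) (e m) = (if n = m then 1 else 0)"
  shows "L2_sq M (\<lambda>x. \<Sum>n<N. a n * e n x) = (\<Sum>n<N. (norm (a n))\<^sup>2)"
proof -
  define s where "s = (\<lambda>x. \<Sum>n<N. a n * e n x)"
  have s: "s \<in> L2 M" unfolding s_def by (intro L2_sum L2_cmult e)
  have es: "L2_inner M (e n) s = cnj (a n)" if "n < N" for n
  proof -
    have "L2_inner M s (e n) = (\<Sum>i<N. a i * L2_inner M (e i) (e n))"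
      unfolding s_def by (rule L2_inner_sum[OF e e])
    also have "\<dots> = a n" using that by (simp add: on if_distrib sum.delta cong: if_cong)
    finally show ?thesis by (subst L2_inner_commute) simp
  qed
  have "of_real (L2_sq M s) = L2_inner M s s" by (simp add: L2_inner_self)
  also have "\<dots> = (\<Sum>n<N. a n * L2_inner M (e n) s)"
    by (subst (1) s_def, rule L2_inner_sum[OF e s])
  also have "\<dots> = of_real (\<Sum>n<N. (norm (a n))\<^sup>2)"
    unfolding of_real_sum by (intro sum.cong refl) (simp only: lessThan_iff es complex_norm_square)
  finally show ?thesis by (simp only: of_real_eq_iff s_def)
qed

text \<open>
  Cauchy--Schwarz for \<open>f\<close> and its projection \<open>s\<close>, because the inner product of the two and the squared
  norm of \<open>s\<close> both equal the sum of squares on the left.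
\<close>

lemma Bessel_inequality:
  fixes e :: "nat \<Rightarrow> 'a \<Rightarrow> complex"
  assumes e: "\<And>n. e n \<in> L2 M" and on: "\<And>n m. L2_inner M (e n) (e m) = (if n = m then 1 else 0)"
    and f: "f \<in> L2 M"
  shows "(\<Sum>n<N. (norm (L2_inner M f (e n)))\<^sup>2) \<le> L2_sq M f"
proof -
  define s where "s = (\<lambda>x. \<Sum>n<N. L2_inner M f (e n) * e n x)"
  define A where "A = (\<Sum>n<N. (norm (L2_inner M f (e n)))\<^sup>2)"
  have s: "s \<in> L2 M" unfolding s_def by (intro L2_sum L2_cmult e)
  have ss: "L2_sq M s = A" unfolding s_def A_def by (rule L2_sq_orthonormal_sum[OF e on])
  have "L2_inner M s f = (\<Sum>n<N. L2_inner M f (e n) * L2_inner M (e n) f)"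
    unfolding s_def by (rule L2_inner_sum[OF e f])
  also have "\<dots> = (\<Sum>n<N. of_real ((norm (L2_inner M f (e n)))\<^sup>2))"
    by (intro sum.cong refl) (simp only: L2_inner_commute[of M "e _" f] complex_norm_square)
  finally have sf: "L2_inner M s f = of_real A" by (simp add: A_def)
  have "A\<^sup>2 \<le> A * L2_sq M f"
    using L2_inner_bound[OF s f] by (simp add: sf ss)
  moreover have "A \<ge> 0" by (simp add: A_def sum_nonneg)
  ultimately have "A \<le> L2_sq M f"
    using L2_sq_nonneg[of M f] by (cases "A = 0") (auto simp: power2_eq_square)
  then show ?thesis by (simp add: A_def)
qed

text \<open>
  Monotone convergence: the sum of the squares is integrable, hence finite almost everywhere.
\<close>

lemma L2_square_sum_AE_summable:
  fixes p :: "nat \<Rightarrow> 'a \<Rightarrow> complex"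
  assumes p: "\<And>n. p n \<in> L2 M" and sum: "summable (\<lambda>n. L2_sq M (p n))"
  shows "AE x in M. summable (\<lambda>n. (norm (p n x))\<^sup>2)"
    and "integrable M (\<lambda>x. \<Sum>n. (norm (p n x))\<^sup>2)"
    and "(LINT x|M. (\<Sum>n. (norm (p n x))\<^sup>2)) = (\<Sum>n. L2_sq M (p n))"
proof -
  note [measurable] = L2D(1)[OF p]
  have "(\<integral>\<^sup>+ x. (\<Sum>n. ennreal ((norm (p n x))\<^sup>2)) \<partial>M) = (\<Sum>n. \<integral>\<^sup>+ x. ennreal ((norm (p n x))\<^sup>2) \<partial>M)"
    by (rule nn_integral_suminf) simp
  also have "\<dots> = (\<Sum>n. ennreal (L2_sq M (p n)))"
    unfolding L2_sq_def by (subst nn_integral_eq_integral[OF L2D(2)[OF p]]) auto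
  also have "\<dots> \<noteq> \<infinity>"
    using suminf_ennreal2[OF L2_sq_nonneg sum] by simp
  finally have "AE x in M. (\<Sum>n. ennreal ((norm (p n x))\<^sup>2)) \<noteq> \<infinity>"
    by (intro nn_integral_noteq_infinite) auto
  then show AE: "AE x in M. summable (\<lambda>n. (norm (p n x))\<^sup>2)"
    by eventually_elim (rule summable_suminf_not_top, auto)
  have AE': "AE x in M. summable (\<lambda>n. norm ((norm (p n x))\<^sup>2))" using AE by simp
  have sum': "summable (\<lambda>n. LINT x|M. norm ((norm (p n x))\<^sup>2))" using sum by (simp add: L2_sq_def)
  show "integrable M (\<lambda>x. \<Sum>n. (norm (p n x))\<^sup>2)"
    by (rule integrable_suminf[OF L2D(2)[OF p] AE' sum'])
  show "(LINT x|M. (\<Sum>n. (norm (p n x))\<^sup>2)) = (\<Sum>n. L2_sq M (p n))"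
    unfolding L2_sq_def by (rule integral_suminf[OF L2D(2)[OF p] AE' sum'])
qed

text \<open>
  The series is taken pointwise. If both the coefficients and the norms of the functions are
  square-summable, it converges absolutely almost everywhere, which yields measurability directly.
\<close>

definition superpose :: "(nat \<Rightarrow> 'a \<Rightarrow> complex) \<Rightarrow> (nat \<Rightarrow> complex) \<Rightarrow> 'a \<Rightarrow> complex" where
  "superpose p a x = (\<Sum>n. a n * p n x)"

lemma superpose_L2:
  fixes p :: "nat \<Rightarrow> 'a \<Rightarrow> complex"
  assumes p: "\<And>n. p n \<in> L2 M" and sum: "summable (\<lambda>n. L2_sq M (p n))"
    and a: "summable (\<lambda>n. (norm (a n))\<^sup>2)"
  shows "AE x in M. summable (\<lambda>n. a n * p n x)"
    and "superpose p a \<in> L2 M"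
    and "L2_sq M (superpose p a) \<le> (\<Sum>n. (norm (a n))\<^sup>2) * (\<Sum>n. L2_sq M (p n))"
proof -
  note [measurable] = L2D(1)[OF p]
  note AE = L2_square_sum_AE_summable[OF p sum]
  show "AE x in M. summable (\<lambda>n. a n * p n x)"
    using AE(1) by eventually_elim (rule summable_norm_cancel, rule sq_summable_mult(1)[OF a])
  have m: "superpose p a \<in> borel_measurable M" unfolding superpose_def[abs_def] by simp
  have bound: "AE x in M. (norm (superpose p a x))\<^sup>2 \<le> (\<Sum>n. (norm (a n))\<^sup>2) * (\<Sum>n. (norm (p n x))\<^sup>2)"
    using AE(1)
  proof eventually_elim
    case (elim x)
    have "(norm (superpose p a x))\<^sup>2 \<le> (sqrt (\<Sum>n. (norm (a n))\<^sup>2) * sqrt (\<Sum>n. (norm (p n x))\<^sup>2))\<^sup>2"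
      unfolding superpose_def by (intro power_mono sq_summable_mult(3)[OF a elim]) simp
    then show ?case by (simp add: power_mult_distrib suminf_nonneg a elim)
  qed
  have i: "integrable M (\<lambda>x. (\<Sum>n. (norm (a n))\<^sup>2) * (\<Sum>n. (norm (p n x))\<^sup>2))"
    by (rule integrable_mult_right) (rule AE(2))
  show "superpose p a \<in> L2 M" by (rule L2_of_AE_bound(1)[OF m i bound])
  show "L2_sq M (superpose p a) \<le> (\<Sum>n. (norm (a n))\<^sup>2) * (\<Sum>n. L2_sq M (p n))"
    using L2_of_AE_bound(2)[OF m i bound] by (simp add: AE(3))
qed

text \<open>
  The remainder of the series is almost everywhere the superposition of the shifted families, so the
  bound in \<open>superpose_L2\<close> applies to it.
\<close>

lemma superpose_tail:
  fixes p :: "nat \<Rightarrow> 'a \<Rightarrow> complex"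
  assumes p: "\<And>n. p n \<in> L2 M" and sum: "summable (\<lambda>n. L2_sq M (p n))"
    and a: "summable (\<lambda>n. (norm (a n))\<^sup>2)"
  shows "(\<lambda>N. L2_sq M (\<lambda>x. superpose p a x - (\<Sum>n<N. a n * p n x))) \<longlonglongrightarrow> 0"
proof (rule Lim_null_comparison)
  define A where "A = (\<Sum>n. (norm (a n))\<^sup>2)"
  have "norm (L2_sq M (\<lambda>x. superpose p a x - (\<Sum>n<N. a n * p n x))) \<le> A * (\<Sum>n. L2_sq M (p (n + N)))" for N
  proof -
    have sumN: "summable (\<lambda>n. L2_sq M (p (n + N)))" using sum by (subst summable_iff_shift)
    have aN: "summable (\<lambda>n. (norm (a (n + N)))\<^sup>2)" using a by (subst summable_iff_shift)
    note t = superpose_L2[of "\<lambda>n. p (n + N)", OF p sumN aN]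
    have m: "(\<lambda>x. superpose p a x - (\<Sum>n<N. a n * p n x)) \<in> borel_measurable M"
      by (rule L2D(1), intro L2_diff superpose_L2(2)[OF p sum a] L2_sum L2_cmult p)
    have "AE x in M. superpose p a x - (\<Sum>n<N. a n * p n x) = superpose (\<lambda>n. p (n + N)) (\<lambda>n. a (n + N)) x"
      using superpose_L2(1)[OF p sum a]
    proof eventually_elim
      case (elim x)
      show ?case unfolding superpose_def using suminf_split_initial_segment[OF elim, of N] by simp
    qed
    from L2_sq_cong_AE[OF m L2D(1)[OF t(2)] this]
    have "L2_sq M (\<lambda>x. superpose p a x - (\<Sum>n<N. a n * p n x)) \<le> (\<Sum>n. (norm (a (n + N)))\<^sup>2) * (\<Sum>n. L2_sq M (p (n + N)))"
      using t(3) by simp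
    also have "\<dots> \<le> A * (\<Sum>n. L2_sq M (p (n + N)))"
    proof (rule mult_right_mono)
      show "(\<Sum>n. (norm (a (n + N)))\<^sup>2) \<le> A"
        unfolding A_def using suminf_split_initial_segment[OF a, of N] sum_nonneg[of "{..<N}" "\<lambda>n. (norm (a n))\<^sup>2"] by simp
      show "0 \<le> (\<Sum>n. L2_sq M (p (n + N)))" by (rule suminf_nonneg[OF sumN L2_sq_nonneg])
    qed
    finally show ?thesis by (simp add: L2_sq_nonneg)
  qed
  then show "eventually (\<lambda>N. norm (L2_sq M (\<lambda>x. superpose p a x - (\<Sum>n<N. a n * p n x))) \<le> A * (\<Sum>n. L2_sq M (p (n + N)))) sequentially"
    by simp
  have "(\<lambda>N. A * (\<Sum>n. L2_sq M (p (n + N)))) \<longlonglongrightarrow> A * 0"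
    by (intro tendsto_mult tendsto_const suminf_exist_split2 sum)
  then show "(\<lambda>N. A * (\<Sum>n. L2_sq M (p (n + N)))) \<longlonglongrightarrow> 0" by simp
qed

lemma superpose_inner:
  fixes p :: "nat \<Rightarrow> 'a \<Rightarrow> complex"
  assumes p: "\<And>n. p n \<in> L2 M" and sum: "summable (\<lambda>n. L2_sq M (p n))"
    and a: "summable (\<lambda>n. (norm (a n))\<^sup>2)" and g: "g \<in> L2 M"
  shows "(\<lambda>n. a n * L2_inner M (p n) g) sums L2_inner M (superpose p a) g"
proof -
  note W = superpose_L2(2)[OF p sum a]
  have "(\<lambda>N. (\<Sum>n<N. a n * L2_inner M (p n) g) - L2_inner M (superpose p a) g) \<longlonglongrightarrow> 0"
  proof (rule Lim_null_comparison)
    have "norm ((\<Sum>n<N. a n * L2_inner M (p n) g) - L2_inner M (superpose p a) g)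
        \<le> sqrt (L2_sq M (\<lambda>x. superpose p a x - (\<Sum>n<N. a n * p n x)) * L2_sq M g)" for N
    proof -
      have s: "(\<lambda>x. \<Sum>n<N. a n * p n x) \<in> L2 M" by (intro L2_sum L2_cmult p)
      have "L2_inner M (\<lambda>x. superpose p a x - (\<Sum>n<N. a n * p n x)) g
          = L2_inner M (superpose p a) g - (\<Sum>n<N. a n * L2_inner M (p n) g)"
        using L2_inner_diff[OF W s g] L2_inner_sum[OF p g, where I = "{..<N}" and a = a] by simp
      then show ?thesis
        using L2_inner_bound[OF L2_diff[OF W s] g] by (simp add: norm_minus_commute real_le_rsqrt)
    qed
    then show "eventually (\<lambda>N. norm ((\<Sum>n<N. a n * L2_inner M (p n) g) - L2_inner M (superpose p a) g)
        \<le> sqrt (L2_sq M (\<lambda>x. superpose p a x - (\<Sum>n<N. a n * p n x)) * L2_sq M g)) sequentially" by simp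
    have "(\<lambda>N. sqrt (L2_sq M (\<lambda>x. superpose p a x - (\<Sum>n<N. a n * p n x)) * L2_sq M g)) \<longlonglongrightarrow> sqrt (0 * L2_sq M g)"
      by (intro tendsto_intros superpose_tail[OF p sum a])
    then show "(\<lambda>N. sqrt (L2_sq M (\<lambda>x. superpose p a x - (\<Sum>n<N. a n * p n x)) * L2_sq M g)) \<longlonglongrightarrow> 0" by simp
  qed
  then show ?thesis unfolding sums_def by (simp add: LIM_zero_iff)
qed

lemma L2_linear_operatorD:
  assumes "L2_linear_operator M T"
  shows "f \<in> L2 M \<Longrightarrow> T f \<in> L2 M"
    and "f \<in> L2 M \<Longrightarrow> g \<in> L2 M \<Longrightarrow> AE x in M. T (\<lambda>t. f t + g t) x = T f x + T g x"
    and "f \<in> L2 M \<Longrightarrow> AE x in M. T (\<lambda>t. a * f t) x = a * T f x"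
  using assms unfolding L2_linear_operator_def by simp_all

lemma L2_continuous_of_bounded:
  assumes T: "L2_linear_operator M T" and C: "C \<ge> 0" "\<And>f. f \<in> L2 M \<Longrightarrow> L2_sq M (T f) \<le> C * L2_sq M f"
  shows "L2_continuous M T"
  unfolding L2_continuous_def
proof (intro ballI allI impI)
  fix f and \<epsilon> :: real assume f: "f \<in> L2 M" and \<epsilon>: "\<epsilon> > 0"
  define \<delta> where "\<delta> = \<epsilon> / sqrt (C + 1)"
  have \<delta>: "\<delta> > 0" using \<epsilon> C by (simp add: \<delta>_def)
  have "L2_norm M (\<lambda>x. T g x - T f x) < \<epsilon>" if g: "g \<in> L2 M" and lt: "L2_norm M (\<lambda>x. g x - f x) < \<delta>" for g
  proof -
    define h where "h = (\<lambda>x. g x + (- 1) * f x)"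
    have h: "h \<in> L2 M" unfolding h_def by (intro L2_add L2_cmult f g)
    have "AE x in M. T h x = T g x + T (\<lambda>x. (- 1) * f x) x"
      unfolding h_def by (rule L2_linear_operatorD(2)[OF T g L2_cmult[OF f]])
    moreover have "AE x in M. T (\<lambda>x. (- 1) * f x) x = (- 1) * T f x"
      by (rule L2_linear_operatorD(3)[OF T f])
    ultimately have "AE x in M. T g x - T f x = T h x" by eventually_elim simp
    moreover have "T g \<in> L2 M" "T f \<in> L2 M" "T h \<in> L2 M"
      by (intro L2_linear_operatorD(1)[OF T] f g h)+
    ultimately have "L2_sq M (\<lambda>x. T g x - T f x) = L2_sq M (T h)"
      by (intro L2_sq_cong_AE) (auto intro: L2D(1) L2_diff)
    also have "\<dots> \<le> C * L2_sq M h" by (rule C(2)[OF h])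
    finally have "L2_norm M (\<lambda>x. T g x - T f x) \<le> sqrt (C * L2_sq M h)"
      by (simp add: L2_norm_eq)
    also have "\<dots> \<le> sqrt ((C + 1) * L2_sq M h)"
      using L2_sq_nonneg[of M h] by (intro real_sqrt_le_mono mult_right_mono) auto
    also have "\<dots> = sqrt (C + 1) * L2_norm M (\<lambda>x. g x - f x)"
      by (simp add: real_sqrt_mult L2_norm_eq h_def)
    also have "\<dots> < sqrt (C + 1) * \<delta>" using lt C by simp
    finally show ?thesis using C by (simp add: \<delta>_def)
  qed
  then show "\<exists>\<delta>>0. \<forall>g\<in>L2 M. L2_norm M (\<lambda>x. g x - f x) < \<delta> \<longrightarrow> L2_norm M (\<lambda>x. T g x - T f x) < \<epsilon>"
    using \<delta> by blast
qed

section \<open>Integral operators given by an expansion\<close>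

context sigma_finite_measure
begin

lemma L2_sections:
  assumes \<kappa>: "\<kappa> \<in> L2 (M \<Otimes>\<^sub>M M)"
  shows "AE x in M. (\<lambda>y. \<kappa> (x, y)) \<in> L2 M"
    and "integrable M (\<lambda>x. L2_sq M (\<lambda>y. \<kappa> (x, y)))"
    and "(LINT x|M. L2_sq M (\<lambda>y. \<kappa> (x, y))) = L2_sq (M \<Otimes>\<^sub>M M) \<kappa>"
proof -
  interpret P: pair_sigma_finite M M ..
  note [measurable] = L2D(1)[OF \<kappa>]
  note i = L2D(2)[OF \<kappa>]
  show "AE x in M. (\<lambda>y. \<kappa> (x, y)) \<in> L2 M"
    using P.AE_integrable_fst'[OF i] AE_space by eventually_elim (simp add: L2_def)
  show "integrable M (\<lambda>x. L2_sq M (\<lambda>y. \<kappa> (x, y)))"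
    unfolding L2_sq_def by (rule P.integrable_fst'[OF i])
  show "(LINT x|M. L2_sq M (\<lambda>y. \<kappa> (x, y))) = L2_sq (M \<Otimes>\<^sub>M M) \<kappa>"
    unfolding L2_sq_def by (rule P.integral_fst'[OF i])
qed

text \<open>
  Cauchy--Schwarz on almost every section of the kernel, followed by Fubini's theorem.
\<close>

lemma kernel_integral_L2:
  assumes \<kappa>: "\<kappa> \<in> L2 (M \<Otimes>\<^sub>M M)" and f: "f \<in> L2 M"
  shows "(\<lambda>x. LINT y|M. \<kappa> (x, y) * f y) \<in> L2 M"
    and "L2_sq M (\<lambda>x. LINT y|M. \<kappa> (x, y) * f y) \<le> L2_sq (M \<Otimes>\<^sub>M M) \<kappa> * L2_sq M f"
proof -
  note [measurable] = L2D(1)[OF \<kappa>] L2D(1)[OF f]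
  have m: "(\<lambda>x. LINT y|M. \<kappa> (x, y) * f y) \<in> borel_measurable M" by measurable
  have i: "integrable M (\<lambda>x. L2_sq M (\<lambda>y. \<kappa> (x, y)) * L2_sq M f)"
    by (intro integrable_mult_left L2_sections(2)[OF \<kappa>])
  have b: "AE x in M. (norm (LINT y|M. \<kappa> (x, y) * f y))\<^sup>2 \<le> L2_sq M (\<lambda>y. \<kappa> (x, y)) * L2_sq M f"
    using L2_sections(1)[OF \<kappa>] by eventually_elim (rule L2_Cauchy_Schwarz[OF _ f])
  show "(\<lambda>x. LINT y|M. \<kappa> (x, y) * f y) \<in> L2 M" by (rule L2_of_AE_bound(1)[OF m i b])
  show "L2_sq M (\<lambda>x. LINT y|M. \<kappa> (x, y) * f y) \<le> L2_sq (M \<Otimes>\<^sub>M M) \<kappa> * L2_sq M f"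
    using L2_of_AE_bound(2)[OF m i b] by (simp add: L2_sections(3)[OF \<kappa>])
qed

end

text \<open>
  The system \<open>e\<close> is real-valued on the underlying space, so that integrating \<open>f\<close> against the kernel
  term \<open>p n x * e n y\<close> produces the coefficient of \<open>f\<close> without a conjugation.
\<close>

locale kernel_expansion = sigma_finite_measure M for M :: "'a measure" +
  fixes e p :: "nat \<Rightarrow> 'a \<Rightarrow> complex" and k :: "'a \<Rightarrow> 'a \<Rightarrow> complex"
  assumes e: "\<And>n. e n \<in> L2 M"
    and orthonormal: "\<And>n m. L2_inner M (e n) (e m) = (if n = m then 1 else 0)"
    and e_real: "\<And>n x. x \<in> space M \<Longrightarrow> cnj (e n x) = e n x"
    and p: "\<And>n. p n \<in> L2 M"
    and tensor: "\<And>n. (\<lambda>(x, y). p n x * e n y) \<in> L2 (M \<Otimes>\<^sub>M M)"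
    and k: "(\<lambda>(x, y). k x y) \<in> L2 (M \<Otimes>\<^sub>M M)"
    and lim: "(\<lambda>N. L2_sq (M \<Otimes>\<^sub>M M) (\<lambda>(x, y). k x y - (\<Sum>n<N. p n x * e n y))) \<longlonglongrightarrow> 0"
begin

lemma e_integral: "(LINT y|M. e n y * f y) = L2_inner M f (e n)"
  unfolding L2_inner_def by (rule Bochner_Integration.integral_cong) (auto simp: e_real mult.commute)

lemma partial_kernel: "(\<lambda>(x, y). \<Sum>n<N. p n x * e n y) \<in> L2 (M \<Otimes>\<^sub>M M)"
  using L2_sum[of "{..<N}" "\<lambda>n (x, y). p n x * e n y" "M \<Otimes>\<^sub>M M"] tensor by (simp add: case_prod_unfold)

lemma partial_kernel_norm: "L2_sq (M \<Otimes>\<^sub>M M) (\<lambda>(x, y). \<Sum>n<N. p n x * e n y) = (\<Sum>n<N. L2_sq M (p n))"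
proof -
  have "L2_sq (M \<Otimes>\<^sub>M M) (\<lambda>(x, y). \<Sum>n<N. p n x * e n y) = (LINT x|M. L2_sq M (\<lambda>y. \<Sum>n<N. p n x * e n y))"
    using L2_sections(3)[OF partial_kernel[of N]] by simp
  also have "\<dots> = (LINT x|M. (\<Sum>n<N. (norm (p n x))\<^sup>2))"
    by (simp only: L2_sq_orthonormal_sum[OF e orthonormal])
  also have "\<dots> = (\<Sum>n<N. L2_sq M (p n))"
    unfolding L2_sq_def by (rule Bochner_Integration.integral_sum) (rule L2D(2)[OF p])
  finally show ?thesis .
qed

lemma kernel_diff: "(\<lambda>(x, y). k x y - (\<Sum>n<N. p n x * e n y)) \<in> L2 (M \<Otimes>\<^sub>M M)"
  using L2_diff[OF k partial_kernel[of N]] by (simp add: case_prod_unfold)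

text \<open>
  By orthonormality in the second variable the squared norm of a partial sum of the kernel is the sum
  of the \<open>L2_sq M (p n)\<close>; it stays bounded as the partial sums converge.
\<close>

lemma summable_p: "summable (\<lambda>n. L2_sq M (p n))"
proof -
  have "Bseq (\<lambda>N. L2_sq (M \<Otimes>\<^sub>M M) (\<lambda>(x, y). k x y - (\<Sum>n<N. p n x * e n y)))"
    by (rule convergent_imp_Bseq) (use lim in \<open>auto simp: convergent_def\<close>)
  then obtain B where B: "\<And>N. L2_sq (M \<Otimes>\<^sub>M M) (\<lambda>(x, y). k x y - (\<Sum>n<N. p n x * e n y)) \<le> B"
    by (auto simp: Bseq_def abs_le_iff)
  show ?thesis
  proof (rule summableI_nonneg_bounded)
    show "0 \<le> L2_sq M (p n)" for n by (rule L2_sq_nonneg)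
    fix N
    have "(\<Sum>n<N. L2_sq M (p n)) = L2_sq (M \<Otimes>\<^sub>M M) (\<lambda>z. (\<lambda>(x, y). k x y) z - (\<lambda>(x, y). k x y - (\<Sum>n<N. p n x * e n y)) z)"
      unfolding partial_kernel_norm[symmetric] by (simp add: case_prod_unfold)
    also have "\<dots> \<le> 2 * L2_sq (M \<Otimes>\<^sub>M M) (\<lambda>(x, y). k x y) + 2 * L2_sq (M \<Otimes>\<^sub>M M) (\<lambda>(x, y). k x y - (\<Sum>n<N. p n x * e n y))"
      by (rule L2_sq_diff_le[OF k kernel_diff])
    also have "\<dots> \<le> 2 * L2_sq (M \<Otimes>\<^sub>M M) (\<lambda>(x, y). k x y) + 2 * B" using B[of N] by simp
    finally show "(\<Sum>n<N. L2_sq M (p n)) \<le> 2 * L2_sq (M \<Otimes>\<^sub>M M) (\<lambda>(x, y). k x y) + 2 * B" .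
  qed
qed

definition coeffs :: "('a \<Rightarrow> complex) \<Rightarrow> ell2" where
  "coeffs f = Abs_ell2 (\<lambda>n. L2_inner M f (e n))"

lemma coeffs:
  assumes f: "f \<in> L2 M"
  shows coord_coeffs: "coord (coeffs f) n = L2_inner M f (e n)"
    and norm_coeffs: "(norm (coeffs f))\<^sup>2 \<le> L2_sq M f"
proof -
  have *: "(\<Sum>n<N. (norm (L2_inner M f (e n)))\<^sup>2) \<le> (sqrt (L2_sq M f))\<^sup>2" for N
    using Bessel_inequality[OF e orthonormal f] by (simp add: L2_sq_nonneg)
  note ** = ell2_of_bounded_sums[OF * real_sqrt_ge_zero[OF L2_sq_nonneg]]
  show "coord (coeffs f) n = L2_inner M f (e n)" by (simp add: coeffs_def Abs_ell2_coord[OF **(1)])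
  have "(norm (coeffs f))\<^sup>2 \<le> (sqrt (L2_sq M f))\<^sup>2"
    unfolding coeffs_def by (rule power_mono[OF **(2)]) simp
  then show "(norm (coeffs f))\<^sup>2 \<le> L2_sq M f" by (simp add: L2_sq_nonneg)
qed

definition synthesis :: "ell2 \<Rightarrow> 'a \<Rightarrow> complex" where "synthesis a = superpose p (coord a)"

lemma synthesis_L2: "synthesis a \<in> L2 M"
  unfolding synthesis_def by (rule superpose_L2(2)[OF p summable_p coord_summable])

lemma synthesis_bound: "L2_sq M (synthesis a) \<le> (norm a)\<^sup>2 * (\<Sum>n. L2_sq M (p n))"
  unfolding synthesis_def norm_ell2_sq by (rule superpose_L2(3)[OF p summable_p coord_summable])

definition K :: "('a \<Rightarrow> complex) \<Rightarrow> 'a \<Rightarrow> complex" where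
  "K f x = (LINT y|M. k x y * f y)"

lemma K_L2: "f \<in> L2 M \<Longrightarrow> K f \<in> L2 M"
  using kernel_integral_L2(1)[OF k] by (simp add: K_def[abs_def])

text \<open>
  Both sides are limits in the mean of the partial sums \<open>\<Sum> \<langle>f, e n\<rangle> p n\<close>.
\<close>

lemma K_eq_synthesis:
  assumes f: "f \<in> L2 M"
  shows "AE x in M. K f x = synthesis (coeffs f) x"
proof -
  define s where "s N = (\<lambda>x. \<Sum>n<N. L2_inner M f (e n) * p n x)" for N
  have s: "s N \<in> L2 M" for N unfolding s_def by (intro L2_sum L2_cmult p)
  have Kf: "K f \<in> L2 M" by (rule K_L2[OF f])
  have Ks: "L2_sq M (\<lambda>x. K f x - s N x) \<le> L2_sq (M \<Otimes>\<^sub>M M) (\<lambda>(x, y). k x y - (\<Sum>n<N. p n x * e n y)) * L2_sq M f" for N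
  proof -
    note d = kernel_integral_L2[OF kernel_diff[of N] f]
    have "AE x in M. K f x - s N x = (LINT y|M. (case (x, y) of (x, y) \<Rightarrow> k x y - (\<Sum>n<N. p n x * e n y)) * f y)"
      using L2_sections(1)[OF k]
    proof eventually_elim
      case (elim x)
      have i1: "integrable M (\<lambda>y. k x y * f y)"
        using L2_mult_integrable[OF elim f] by simp
      have i2: "integrable M (\<lambda>y. \<Sum>n<N. p n x * (e n y * f y))"
        by (intro Bochner_Integration.integrable_sum integrable_mult_right L2_mult_integrable e f)
      have "(LINT y|M. (\<Sum>n<N. p n x * (e n y * f y))) = s N x"
      proof (subst Bochner_Integration.integral_sum)
        show "integrable M (\<lambda>y. p n x * (e n y * f y))" for n
          by (intro integrable_mult_right L2_mult_integrable e f)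
        show "(\<Sum>n<N. LINT y|M. p n x * (e n y * f y)) = s N x"
          unfolding s_def integral_mult_right_zero e_integral by (simp only: mult.commute)
      qed
      moreover have "(LINT y|M. (case (x, y) of (x, y) \<Rightarrow> k x y - (\<Sum>n<N. p n x * e n y)) * f y)
          = (LINT y|M. k x y * f y) - (LINT y|M. (\<Sum>n<N. p n x * (e n y * f y)))"
        by (subst Bochner_Integration.integral_diff[OF i1 i2, symmetric])
           (simp add: left_diff_distrib sum_distrib_right mult.assoc)
      ultimately show ?case by (simp add: K_def)
    qed
    from L2_sq_cong_AE[OF L2D(1)[OF L2_diff[OF Kf s]] L2D(1)[OF d(1)] this] d(2)
    show ?thesis by simp
  qed
  have Ws: "(\<lambda>N. L2_sq M (\<lambda>x. synthesis (coeffs f) x - s N x)) \<longlonglongrightarrow> 0"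
    unfolding synthesis_def s_def coord_coeffs[OF f, symmetric] by (rule superpose_tail[OF p summable_p coord_summable])
  have KW: "(\<lambda>x. K f x - synthesis (coeffs f) x) \<in> L2 M" by (rule L2_diff[OF Kf synthesis_L2])
  have "L2_sq M (\<lambda>x. K f x - synthesis (coeffs f) x) \<le> 0"
  proof (rule LIMSEQ_le_const)
    show "(\<lambda>N. 2 * (L2_sq (M \<Otimes>\<^sub>M M) (\<lambda>(x, y). k x y - (\<Sum>n<N. p n x * e n y)) * L2_sq M f)
        + 2 * L2_sq M (\<lambda>x. synthesis (coeffs f) x - s N x)) \<longlonglongrightarrow> 0"
      using tendsto_add[OF tendsto_mult[OF tendsto_const tendsto_mult[OF lim tendsto_const]] tendsto_mult[OF tendsto_const Ws], of 2 "L2_sq M f" 2]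
      by simp
    have "L2_sq M (\<lambda>x. K f x - synthesis (coeffs f) x)
        \<le> 2 * (L2_sq (M \<Otimes>\<^sub>M M) (\<lambda>(x, y). k x y - (\<Sum>n<N. p n x * e n y)) * L2_sq M f)
        + 2 * L2_sq M (\<lambda>x. synthesis (coeffs f) x - s N x)" for N
      using L2_sq_diff_le[OF L2_diff[OF Kf s[of N]] L2_diff[OF synthesis_L2[of "coeffs f"] s[of N]]] Ks[of N] by simp
    then show "\<exists>N. \<forall>n\<ge>N. L2_sq M (\<lambda>x. K f x - synthesis (coeffs f) x)
        \<le> 2 * (L2_sq (M \<Otimes>\<^sub>M M) (\<lambda>(x, y). k x y - (\<Sum>i<n. p i x * e i y)) * L2_sq M f)
        + 2 * L2_sq M (\<lambda>x. synthesis (coeffs f) x - s n x)" by blast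
  qed
  then have "L2_sq M (\<lambda>x. K f x - synthesis (coeffs f) x) = 0" using L2_sq_nonneg by (rule antisym)
  then have "AE x in M. (norm (K f x - synthesis (coeffs f) x))\<^sup>2 = 0"
    unfolding L2_sq_def by (subst (asm) integral_nonneg_eq_0_iff_AE[OF L2D(2)[OF KW]]) auto
  then show ?thesis by eventually_elim simp
qed

text \<open>
  The matrix of \<open>K\<close> with respect to the system \<open>e\<close>.
\<close>

definition coeff_matrix :: "nat \<Rightarrow> nat \<Rightarrow> complex" where "coeff_matrix m n = L2_inner M (p n) (e m)"

lemma coeff_matrix_transpose_hilbert_schmidt: "hilbert_schmidt (\<lambda>n m. coeff_matrix m n)"
proof -
  have col: "summable (\<lambda>m. (norm (coeff_matrix m n))\<^sup>2)" "(\<Sum>m. (norm (coeff_matrix m n))\<^sup>2) \<le> L2_sq M (p n)" for n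
  proof -
    show S: "summable (\<lambda>m. (norm (coeff_matrix m n))\<^sup>2)"
      by (rule summableI_nonneg_bounded[OF _ Bessel_inequality[OF e orthonormal p[of n], folded coeff_matrix_def]]) simp
    show "(\<Sum>m. (norm (coeff_matrix m n))\<^sup>2) \<le> L2_sq M (p n)"
      by (rule suminf_le_const[OF S Bessel_inequality[OF e orthonormal p[of n], folded coeff_matrix_def]])
  qed
  have "summable (\<lambda>n. \<Sum>m. (norm (coeff_matrix m n))\<^sup>2)"
    by (rule summable_comparison_test'[OF summable_p]) (use col in \<open>simp add: suminf_nonneg\<close>)
  then show ?thesis using col(1) by (simp add: hilbert_schmidt_def)
qed

lemma coeff_matrix_hilbert_schmidt: "hilbert_schmidt coeff_matrix"
  using hilbert_schmidt_transpose[OF coeff_matrix_transpose_hilbert_schmidt] by simp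

lemma coeffs_synthesis: "coeffs (synthesis a) = matrix_op coeff_matrix a"
proof (rule ell2_eqI)
  fix m
  have "(\<lambda>n. coord a n * L2_inner M (p n) (e m)) sums L2_inner M (synthesis a) (e m)"
    unfolding synthesis_def by (rule superpose_inner[OF p summable_p coord_summable e])
  then show "coord (coeffs (synthesis a)) m = coord (matrix_op coeff_matrix a) m"
    by (simp add: coord_coeffs[OF synthesis_L2] coord_matrix_op[OF coeff_matrix_hilbert_schmidt] coeff_matrix_def mult.commute sums_iff)
qed

lemma coeffs_add: "f \<in> L2 M \<Longrightarrow> g \<in> L2 M \<Longrightarrow> coeffs (\<lambda>x. f x + g x) = coeffs f + coeffs g"
  by (rule ell2_eqI) (simp add: coord_coeffs L2_add plus_ell2.rep_eq L2_inner_add e)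

lemma coeffs_diff: "f \<in> L2 M \<Longrightarrow> g \<in> L2 M \<Longrightarrow> coeffs (\<lambda>x. f x - g x) = coeffs f - coeffs g"
  by (rule ell2_eqI) (simp add: coord_coeffs L2_diff minus_ell2.rep_eq L2_inner_diff e)

lemma coeffs_cong_AE:
  assumes "f \<in> L2 M" "g \<in> L2 M" "AE x in M. f x = g x"
  shows "coeffs f = coeffs g"
  unfolding coeffs_def using L2_inner_cong_AE[OF L2D(1)[OF assms(1)] L2D(1)[OF assms(2)] L2D(1)[OF e] assms(3)] by simp

lemma coeffs_cmult: "f \<in> L2 M \<Longrightarrow> coord (coeffs (\<lambda>x. a * f x)) n = a * coord (coeffs f) n"
  by (simp add: coord_coeffs L2_cmult L2_inner_cmult)

lemma synthesis_add: "AE x in M. synthesis (a + b) x = synthesis a x + synthesis b x"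
  using superpose_L2(1)[OF p summable_p coord_summable[of a]] superpose_L2(1)[OF p summable_p coord_summable[of b]]
proof eventually_elim
  case (elim x)
  show ?case unfolding synthesis_def superpose_def suminf_add[OF elim]
    by (simp add: plus_ell2.rep_eq distrib_right)
qed

lemma synthesis_cmult:
  assumes "\<And>n. coord b n = a * coord c n"
  shows "AE x in M. synthesis b x = a * synthesis c x"
  using superpose_L2(1)[OF p summable_p coord_summable[of c]]
proof eventually_elim
  case (elim x)
  show ?case unfolding synthesis_def superpose_def using suminf_mult[OF elim, of a]
    by (simp add: assms mult.assoc)
qed

definition T :: "('a \<Rightarrow> complex) \<Rightarrow> 'a \<Rightarrow> complex" where "T f x = f x - K f x"

lemma T_eq_synthesis: "f \<in> L2 M \<Longrightarrow> AE x in M. T f x = f x - synthesis (coeffs f) x"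
  using K_eq_synthesis[of f] by (auto simp: T_def)

lemma T_linear: "L2_linear_operator M T"
  unfolding L2_linear_operator_def
proof (intro conjI ballI allI impI)
  fix f assume f: "f \<in> L2 M"
  show "T f \<in> L2 M" unfolding T_def[abs_def] by (rule L2_diff[OF f K_L2[OF f]])
  show "AE x in M. T (\<lambda>t. a * f t) x = a * T f x" for a
    using T_eq_synthesis[OF f] T_eq_synthesis[OF L2_cmult[OF f, of a]] synthesis_cmult[OF coeffs_cmult[OF f], of a]
    by eventually_elim (simp add: right_diff_distrib)
  fix g assume g: "g \<in> L2 M"
  show "AE x in M. T (\<lambda>t. f t + g t) x = T f x + T g x"
    using T_eq_synthesis[OF f] T_eq_synthesis[OF g] T_eq_synthesis[OF L2_add[OF f g]] synthesis_add[of "coeffs f" "coeffs g"]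
    by eventually_elim (simp add: coeffs_add[OF f g])
  assume "AE x in M. f x = g x"
  from this T_eq_synthesis[OF f] T_eq_synthesis[OF g] show "AE x in M. T f x = T g x"
    by eventually_elim (simp add: coeffs_cong_AE[OF f g \<open>AE x in M. f x = g x\<close>])
qed

lemma T_continuous: "L2_continuous M T"
proof (rule L2_continuous_of_bounded[OF T_linear])
  define C where "C = L2_sq (M \<Otimes>\<^sub>M M) (\<lambda>(x, y). k x y)"
  show "2 + 2 * C \<ge> 0" by (simp add: C_def L2_sq_nonneg)
  fix f assume f: "f \<in> L2 M"
  have "L2_sq M (K f) \<le> C * L2_sq M f"
    using kernel_integral_L2(2)[OF k f] by (simp add: K_def[abs_def] C_def)
  then show "L2_sq M (T f) \<le> (2 + 2 * C) * L2_sq M f"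
    unfolding T_def[abs_def] using L2_sq_diff_le[OF f K_L2[OF f]] by (simp add: distrib_right)
qed

text \<open>
  The equation \<open>f - K f = g\<close> is solved by \<open>f = g + \<Sum> a n p n\<close>, where \<open>a\<close> is the coefficient sequence of the
  unknown \<open>f\<close>. Taking coefficients, \<open>a\<close> must solve \<open>a - coeff_matrix a = coeffs g\<close>, and the Fredholm
  alternative provides a bounded solution operator \<open>R\<close> for this equation in \<^typ>\<open>ell2\<close>. The hypothesis
  concerns the transposed matrix: it says that no nonzero combination of the \<open>e n\<close> annihilates the
  range of \<open>T\<close>.
\<close>

theorem T_invertible:
  assumes inj: "\<And>x. matrix_op (\<lambda>n m. coeff_matrix m n) x = x \<Longrightarrow> x = 0"
  shows "L2_invertible M T"
proof -
  note hs = coeff_matrix_hilbert_schmidt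
  have inj': "x = 0" if "matrix_op coeff_matrix x = x" for x
    by (rule injective_of_transpose[OF hs inj that])
  obtain C where C: "C \<ge> 0" "\<And>y. \<exists>x. x - matrix_op coeff_matrix x = y \<and> norm x \<le> C * norm y"
    using fredholm_hilbert_schmidt[OF hs inj'] by blast
  define R where "R y = (SOME x. x - matrix_op coeff_matrix x = y \<and> norm x \<le> C * norm y)" for y
  have R: "R y - matrix_op coeff_matrix (R y) = y" "norm (R y) \<le> C * norm y" for y
    using someI_ex[OF C(2)[of y]] by (auto simp: R_def)
  note lin = linear_matrix_op[OF hs]
  have uniq: "R y = x" if "x - matrix_op coeff_matrix x = y" for x y
  proof -
    have "matrix_op coeff_matrix (R y - x) = R y - x"
    proof -
      have "matrix_op coeff_matrix (R y - x) = (R y - (R y - matrix_op coeff_matrix (R y))) - (x - (x - matrix_op coeff_matrix x))"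
        by (simp add: linear_diff[OF lin])
      also have "\<dots> = R y - x" unfolding R(1) that by simp
      finally show ?thesis .
    qed
    then show ?thesis using inj'[of "R y - x"] by simp
  qed
  have R_add: "R (y + z) = R y + R z" for y z
  proof (rule uniq)
    have "R y + R z - matrix_op coeff_matrix (R y + R z) = (R y - matrix_op coeff_matrix (R y)) + (R z - matrix_op coeff_matrix (R z))"
      by (simp add: linear_add[OF lin])
    then show "R y + R z - matrix_op coeff_matrix (R y + R z) = y + z" by (simp only: R(1))
  qed
  have R_cmult: "coord (R z) n = a * coord (R y) n" if z: "\<And>n. coord z n = a * coord y n" for a y z n
  proof -
    define b where "b = Abs_ell2 (\<lambda>n. a * coord (R y) n)"
    have b: "coord b n = a * coord (R y) n" for n
      unfolding b_def by (simp add: Abs_ell2_coord[OF sq_summable_cmult[OF coord_summable]])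
    have "R z = b"
    proof (rule uniq, rule ell2_eqI)
      fix m
      have "(\<Sum>n. coeff_matrix m n * coord b n) = a * (\<Sum>n. coeff_matrix m n * coord (R y) n)"
        by (subst suminf_mult[OF matrix_op_summable[OF hs], symmetric]) (simp add: b mult_ac)
      moreover have "coord y m = coord (R y) m - (\<Sum>n. coeff_matrix m n * coord (R y) n)"
        using arg_cong[OF R(1)[of y], of "\<lambda>v. coord v m"] by (simp add: minus_ell2.rep_eq coord_matrix_op[OF hs])
      ultimately show "coord (b - matrix_op coeff_matrix b) m = coord z m"
        by (simp add: minus_ell2.rep_eq coord_matrix_op[OF hs] b z right_diff_distrib)
    qed
    then show ?thesis by (simp add: b)
  qed
  define S where "S g x = g x + synthesis (R (coeffs g)) x" for g x
  have SL2: "S g \<in> L2 M" if "g \<in> L2 M" for g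
    unfolding S_def[abs_def] by (rule L2_add[OF that synthesis_L2])
  have S_linear: "L2_linear_operator M S"
    unfolding L2_linear_operator_def
  proof (intro conjI ballI allI impI)
    fix f assume f: "f \<in> L2 M"
    show "S f \<in> L2 M" by (rule SL2[OF f])
    show "AE x in M. S (\<lambda>t. a * f t) x = a * S f x" for a
      using synthesis_cmult[OF R_cmult[OF coeffs_cmult[OF f]], of a]
      by eventually_elim (simp add: S_def distrib_left)
    fix g assume g: "g \<in> L2 M"
    show "AE x in M. S (\<lambda>t. f t + g t) x = S f x + S g x"
      using synthesis_add[of "R (coeffs f)" "R (coeffs g)"]
      by eventually_elim (simp add: S_def coeffs_add[OF f g] R_add)
    assume fg: "AE x in M. f x = g x"
    then show "AE x in M. S f x = S g x"
      by eventually_elim (simp add: S_def coeffs_cong_AE[OF f g fg])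
  qed
  have S_cont: "L2_continuous M S"
  proof (rule L2_continuous_of_bounded[OF S_linear])
    define D where "D = (\<Sum>n. L2_sq M (p n))"
    have D: "D \<ge> 0" unfolding D_def by (rule suminf_nonneg[OF summable_p L2_sq_nonneg])
    then show "2 + 2 * (C\<^sup>2 * D) \<ge> 0" by simp
    fix g assume g: "g \<in> L2 M"
    have "(norm (R (coeffs g)))\<^sup>2 \<le> (C * norm (coeffs g))\<^sup>2" by (rule power_mono[OF R(2)]) simp
    also have "\<dots> \<le> C\<^sup>2 * L2_sq M g"
      unfolding power_mult_distrib by (rule mult_left_mono[OF norm_coeffs[OF g]]) simp
    finally have "L2_sq M (synthesis (R (coeffs g))) \<le> C\<^sup>2 * L2_sq M g * D"
      by (rule order_trans[OF synthesis_bound[of "R (coeffs g)", folded D_def] mult_right_mono[OF _ D]])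
    then show "L2_sq M (S g) \<le> (2 + 2 * (C\<^sup>2 * D)) * L2_sq M g"
      unfolding S_def[abs_def] using L2_sq_add_le[OF g synthesis_L2, of "R (coeffs g)"] by (simp add: algebra_simps)
  qed
  have ST: "AE x in M. S (T f) x = f x" if f: "f \<in> L2 M" for f
  proof -
    have Tf: "T f \<in> L2 M" by (rule L2_linear_operatorD(1)[OF T_linear f])
    have "coeffs (T f) = coeffs (\<lambda>x. f x - synthesis (coeffs f) x)"
      by (rule coeffs_cong_AE[OF Tf L2_diff[OF f synthesis_L2] T_eq_synthesis[OF f]])
    also have "\<dots> = coeffs f - matrix_op coeff_matrix (coeffs f)"
      by (simp add: coeffs_diff[OF f synthesis_L2] coeffs_synthesis)
    finally have "R (coeffs (T f)) = coeffs f" by (intro uniq) simp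
    then show ?thesis using T_eq_synthesis[OF f] by (auto simp: S_def)
  qed
  have TS: "AE x in M. T (S f) x = f x" if f: "f \<in> L2 M" for f
  proof -
    have "coeffs (S f) = coeffs f + matrix_op coeff_matrix (R (coeffs f))"
      unfolding S_def[abs_def] by (simp add: coeffs_add[OF f synthesis_L2] coeffs_synthesis)
    also have "\<dots> = R (coeffs f)" using R(1)[of "coeffs f"] by (simp add: algebra_simps)
    finally show ?thesis using T_eq_synthesis[OF SL2[OF f]] by (auto simp: S_def)
  qed
  show ?thesis
    unfolding L2_invertible_def using S_linear S_cont ST TS by blast
qed

end

section \<open>The entire part of the Bessel functions and the degenerate equation\<close>

definition bessel_coeff :: "real \<Rightarrow> nat \<Rightarrow> real" where
  "bessel_coeff \<mu> m = (- 1 / 4) ^ m / (fact m * Gamma (\<mu> + real m + 1))"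

text \<open>
  The entire function \<open>E\<^sub>\<mu>\<close> with \<open>J\<^sub>\<mu>(z) = (z/2)\<^sup>\<mu> E\<^sub>\<mu>(z\<^sup>2)\<close>. It is defined over the real and the complex
  numbers at once: the differential equation is treated over the reals, the given functions are complex.
\<close>

definition bessel_entire :: "real \<Rightarrow> 'a \<Rightarrow> 'a::{real_normed_field, banach}" where
  "bessel_entire \<mu> z = (\<Sum>m. of_real (bessel_coeff \<mu> m) * z ^ m)"

lemma bessel_coeff_Suc:
  assumes "\<mu> > - 1"
  shows "bessel_coeff \<mu> (Suc m) = - bessel_coeff \<mu> m / (4 * (real m + 1) * (\<mu> + real m + 1))"
proof -
  have "\<mu> + real m + 1 > 0" using assms by simp
  then have "Gamma (\<mu> + real m + 1 + 1) = (\<mu> + real m + 1) * Gamma (\<mu> + real m + 1)"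
    by (intro Gamma_plus1) (auto elim!: nonpos_Ints_cases)
  then show ?thesis by (simp add: bessel_coeff_def add_ac mult_ac)
qed

lemma summable_bessel:
  fixes z :: "'a::{real_normed_field, banach}"
  assumes "\<mu> > - 1"
  shows "summable (\<lambda>m. of_real (bessel_coeff \<mu> m) * z ^ m)"
proof (rule summable_ratio_test)
  show "(1 / 2 :: real) < 1" by simp
  fix m assume m: "m \<ge> Suc (nat \<lceil>norm z\<rceil>)"
  then have "norm z \<le> real m" "real m \<ge> 1" by linarith+
  have ge: "\<mu> + real m + 1 \<ge> 1" using assms \<open>real m \<ge> 1\<close> by simp
  have "norm z / (4 * (real m + 1) * (\<mu> + real m + 1)) \<le> 1 / 2"
  proof -
    have "norm z \<le> 1 / 2 * (4 * (real m + 1) * 1)" using \<open>norm z \<le> real m\<close> by simp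
    also have "\<dots> \<le> 1 / 2 * (4 * (real m + 1) * (\<mu> + real m + 1))"
      using ge by (intro mult_left_mono) auto
    finally show ?thesis using ge by (simp only: pos_divide_le_eq[of "4 * (real m + 1) * (\<mu> + real m + 1)"] mult_pos_pos)
  qed
  then have "norm z / (4 * (real m + 1) * (\<mu> + real m + 1)) * (\<bar>bessel_coeff \<mu> m\<bar> * norm z ^ m)
      \<le> 1 / 2 * (\<bar>bessel_coeff \<mu> m\<bar> * norm z ^ m)"
    by (intro mult_right_mono) auto
  then show "norm (of_real (bessel_coeff \<mu> (Suc m)) * z ^ Suc m)
      \<le> 1 / 2 * norm (of_real (bessel_coeff \<mu> m) * z ^ m)"
    unfolding norm_mult norm_power norm_of_real bessel_coeff_Suc[OF assms] abs_divide abs_minus_cancel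
    using ge by (simp add: abs_mult mult_ac)
qed

lemma bessel_coeff_shift: "real (Suc m) * bessel_coeff \<mu> (Suc m) = - (bessel_coeff (\<mu> + 1) m / 4)"
proof -
  have "\<mu> + real (Suc m) + 1 = \<mu> + 1 + real m + 1" by simp
  then have "Gamma (\<mu> + real (Suc m) + 1) = Gamma (\<mu> + 1 + real m + 1)" by (rule arg_cong)
  then show ?thesis unfolding bessel_coeff_def fact_Suc
    by (simp only: power_Suc of_nat_mult) (simp del: of_nat_Suc)
qed

lemma bessel_entire_deriv:
  fixes z :: "'a::{real_normed_field, banach}"
  assumes "\<mu> > - 1"
  shows "(bessel_entire \<mu> has_field_derivative - bessel_entire (\<mu> + 1) z / 4) (at z)"
proof -
  have "diffs (\<lambda>m. of_real (bessel_coeff \<mu> m)) = (\<lambda>m. - (of_real (bessel_coeff (\<mu> + 1) m) / 4) :: 'a)"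
  proof
    fix m
    have "real (Suc m) * bessel_coeff \<mu> (Suc m) = - (bessel_coeff (\<mu> + 1) m / 4)"
      by (rule bessel_coeff_shift)
    then have "of_real (real (Suc m) * bessel_coeff \<mu> (Suc m)) = (of_real (- (bessel_coeff (\<mu> + 1) m / 4)) :: 'a)"
      by (rule arg_cong)
    then show "diffs (\<lambda>m. of_real (bessel_coeff \<mu> m)) m = (- (of_real (bessel_coeff (\<mu> + 1) m) / 4) :: 'a)"
      unfolding diffs_def of_real_mult of_real_of_nat_eq by simp
  qed
  moreover have "(\<Sum>m. - (of_real (bessel_coeff (\<mu> + 1) m) / 4) * z ^ m) = - bessel_entire (\<mu> + 1) z / 4"
    using sums_mult[OF summable_sums[OF summable_bessel[of "\<mu> + 1" z]], of "- 1 / 4"] assms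
    by (simp add: bessel_entire_def sums_iff)
  ultimately show ?thesis
    using termdiffs_strong_converges_everywhere[OF summable_bessel[OF assms], of z]
    by (simp add: bessel_entire_def[abs_def])
qed

text \<open>
  By \<open>bessel_entire_deriv\<close> the left-hand side is \<open>\<mu> E\<^sub>\<mu> + z E\<^sub>\<mu>'\<close>; termwise this multiplies the \<open>m\<close>-th
  coefficient by \<open>\<mu> + m\<close>, which lowers the argument of the Gamma function by one.
\<close>

lemma bessel_entire_recurrence:
  fixes z :: "'a::{real_normed_field, banach}"
  assumes "\<mu> > 0"
  shows "of_real \<mu> * bessel_entire \<mu> z - z * bessel_entire (\<mu> + 1) z / 4 = bessel_entire (\<mu> - 1) z"
proof -
  define e where "e m = (of_real (bessel_coeff \<mu> m) :: 'a)" for m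
  have c: "(\<mu> + real m) * bessel_coeff \<mu> m = bessel_coeff (\<mu> - 1) m" for m
  proof -
    have "Gamma (\<mu> + real m + 1) = (\<mu> + real m) * Gamma (\<mu> + real m)"
      using assms by (intro Gamma_plus1) (auto elim!: nonpos_Ints_cases)
    then show ?thesis using assms by (simp add: bessel_coeff_def)
  qed
  have "(\<lambda>m. of_real (bessel_coeff (\<mu> + 1) m) * z ^ m) sums bessel_entire (\<mu> + 1) z"
    unfolding bessel_entire_def using assms by (intro summable_sums summable_bessel) auto
  then have "(\<lambda>m. (- z / 4) * (of_real (bessel_coeff (\<mu> + 1) m) * z ^ m)) sums ((- z / 4) * bessel_entire (\<mu> + 1) z)"
    by (rule sums_mult)
  moreover have "(- z / 4) * (of_real (bessel_coeff (\<mu> + 1) m) * z ^ m) = of_nat (Suc m) * e (Suc m) * z ^ Suc m" for m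
  proof -
    have "real (Suc m) * bessel_coeff \<mu> (Suc m) = - (bessel_coeff (\<mu> + 1) m / 4)"
      by (rule bessel_coeff_shift)
    then have "of_real (real (Suc m) * bessel_coeff \<mu> (Suc m)) = (of_real (- (bessel_coeff (\<mu> + 1) m / 4)) :: 'a)"
      by (rule arg_cong)
    then have "of_nat (Suc m) * e (Suc m) = - (of_real (bessel_coeff (\<mu> + 1) m) / 4)"
      unfolding of_real_mult of_real_of_nat_eq e_def by simp
    then show ?thesis by simp
  qed
  ultimately have "(\<lambda>m. of_nat (Suc m) * e (Suc m) * z ^ Suc m) sums ((- z / 4) * bessel_entire (\<mu> + 1) z)"
    by simp
  then have 1: "(\<lambda>m. of_nat m * e m * z ^ m) sums ((- z / 4) * bessel_entire (\<mu> + 1) z)"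
    by (subst (asm) sums_Suc_iff) simp
  have "(\<lambda>m. e m * z ^ m) sums bessel_entire \<mu> z"
    unfolding bessel_entire_def e_def using assms by (intro summable_sums summable_bessel) auto
  then have "(\<lambda>m. of_real \<mu> * (e m * z ^ m)) sums (of_real \<mu> * bessel_entire \<mu> z)"
    by (rule sums_mult)
  from sums_add[OF this 1]
  have "(\<lambda>m. of_real ((\<mu> + real m) * bessel_coeff \<mu> m) * z ^ m)
      sums (of_real \<mu> * bessel_entire \<mu> z + (- z / 4) * bessel_entire (\<mu> + 1) z)"
    by (simp add: e_def algebra_simps)
  then have "bessel_entire (\<mu> - 1) z = of_real \<mu> * bessel_entire \<mu> z + (- z / 4) * bessel_entire (\<mu> + 1) z"
    unfolding c by (simp add: bessel_entire_def sums_iff)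
  then show ?thesis by simp
qed

lemma bessel_entire_of_real:
  assumes "\<mu> > - 1"
  shows "bessel_entire \<mu> (of_real x :: complex) = of_real (bessel_entire \<mu> x)"
  using sums_of_real[OF summable_sums[OF summable_bessel[OF assms, of x]], where 'a = complex]
  by (simp add: bessel_entire_def sums_iff)

lemma bessel_entire_0: "\<mu> > - 1 \<Longrightarrow> bessel_entire \<mu> (0::real) > 0"
  unfolding bessel_entire_def by (subst powser_zero) (simp add: bessel_coeff_def Gamma_real_pos)

lemma bessel_J_eq: "bessel_J \<mu> z = (z / 2) powr of_real \<mu> * bessel_entire \<mu> (z\<^sup>2)"
proof -
  have "(- 1) ^ m / (fact m * of_real (Gamma (\<mu> + real m + 1))) * (z / 2) ^ (2 * m)
      = of_real (bessel_coeff \<mu> m) * (z\<^sup>2) ^ m" for m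
  proof -
    have "(z / 2) ^ (2 * m) = (z\<^sup>2) ^ m / 4 ^ m"
      by (simp add: power_mult power_divide)
    moreover have "(of_real (bessel_coeff \<mu> m) :: complex) = (- 1) ^ m / 4 ^ m / (fact m * of_real (Gamma (\<mu> + real m + 1)))"
      unfolding bessel_coeff_def power_divide of_real_divide of_real_mult of_real_power by simp
    ultimately show ?thesis by simp
  qed
  then show ?thesis unfolding bessel_J_def bessel_entire_def by presburger
qed

locale degenerate_operator =
  fixes \<alpha> :: real
  assumes alpha: "0 < \<alpha>" "\<alpha> < 1"
begin

abbreviation "\<nu> \<equiv> nu \<alpha>"
abbreviation "\<kappa> \<equiv> kappa \<alpha>"

lemma nu_pos: "\<nu> > 0" and nu_eq: "(2 - \<alpha>) * \<nu> = 1 - \<alpha>"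
  using alpha by (simp_all add: nu_def)

lemma kappa_pos: "\<kappa> > 0" and kappa_eq: "2 * \<kappa> = 2 - \<alpha>"
  using alpha by (simp_all add: kappa_def)

text \<open>
  \<open>sol q\<close> solves \<open>(x\<^sup>\<alpha> u')' = - q \<kappa>\<^sup>2 u\<close> and vanishes at 0; it depends analytically on \<open>q\<close>, whatever the sign
  of \<open>q\<close>. \<open>flux q\<close> is \<open>x\<^sup>\<alpha> u'\<close>, which extends continuously to 0 although \<open>u'\<close> does not.
\<close>

definition sol :: "real \<Rightarrow> real \<Rightarrow> real" where
  "sol q x = x powr (1 - \<alpha>) * bessel_entire \<nu> (q * x powr (2 - \<alpha>))"

definition flux :: "real \<Rightarrow> real \<Rightarrow> real" where
  "flux q x = (2 - \<alpha>) * bessel_entire (\<nu> - 1) (q * x powr (2 - \<alpha>))"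

lemma sol_0: "sol q 0 = 0" using alpha by (simp add: sol_def)

lemma sol_1: "sol q 1 = bessel_entire \<nu> q" by (simp add: sol_def)

lemma DERIV_sol:
  assumes x: "x > 0"
  shows "(sol q has_real_derivative x powr (- \<alpha>) * flux q x) (at x)"
proof -
  define y where "y = q * x powr (2 - \<alpha>)"
  have inner: "((\<lambda>x. q * x powr (2 - \<alpha>)) has_real_derivative q * ((2 - \<alpha>) * x powr (1 - \<alpha>))) (at x)"
    using has_real_derivative_powr[OF x, of "2 - \<alpha>"] by (intro DERIV_cmult) simp
  have pw: "((\<lambda>x. x powr (1 - \<alpha>)) has_real_derivative (1 - \<alpha>) * x powr (- \<alpha>)) (at x)"
    using has_real_derivative_powr[OF x, of "1 - \<alpha>"] by simp
  have "\<nu> > - 1" using nu_pos by simp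
  note DERIV_chain2[OF bessel_entire_deriv[OF this] inner]
  from DERIV_mult'[OF pw this]
  have "(sol q has_real_derivative x powr (1 - \<alpha>) * (- bessel_entire (\<nu> + 1) y / 4 * (q * ((2 - \<alpha>) * x powr (1 - \<alpha>))))
      + (1 - \<alpha>) * x powr (- \<alpha>) * bessel_entire \<nu> y) (at x)"
    by (simp add: sol_def[abs_def] y_def)
  moreover have "x powr (1 - \<alpha>) * (- bessel_entire (\<nu> + 1) y / 4 * (q * ((2 - \<alpha>) * x powr (1 - \<alpha>))))
      + (1 - \<alpha>) * x powr (- \<alpha>) * bessel_entire \<nu> y = x powr (- \<alpha>) * flux q x"
  proof -
    have pp: "x powr (1 - \<alpha>) * x powr (1 - \<alpha>) = x powr (- \<alpha>) * x powr (2 - \<alpha>)"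
      by (simp add: powr_add[symmetric])
    have "x powr (1 - \<alpha>) * (- bessel_entire (\<nu> + 1) y / 4 * (q * ((2 - \<alpha>) * x powr (1 - \<alpha>))))
        = (2 - \<alpha>) * (- bessel_entire (\<nu> + 1) y / 4) * q * (x powr (1 - \<alpha>) * x powr (1 - \<alpha>))"
      by (simp add: mult_ac)
    also have "\<dots> = x powr (- \<alpha>) * ((2 - \<alpha>) * (- (y * bessel_entire (\<nu> + 1) y / 4)))"
      unfolding pp by (simp add: y_def mult_ac)
    finally have "x powr (1 - \<alpha>) * (- bessel_entire (\<nu> + 1) y / 4 * (q * ((2 - \<alpha>) * x powr (1 - \<alpha>))))
      + (1 - \<alpha>) * x powr (- \<alpha>) * bessel_entire \<nu> y
      = x powr (- \<alpha>) * ((2 - \<alpha>) * (of_real \<nu> * bessel_entire \<nu> y - y * bessel_entire (\<nu> + 1) y / 4))"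
      using nu_eq by (simp add: algebra_simps flip: nu_eq)
    then show ?thesis
      unfolding bessel_entire_recurrence[OF nu_pos] flux_def y_def .
  qed
  ultimately show ?thesis by simp
qed

lemma DERIV_flux:
  assumes x: "x > 0"
  shows "(flux q has_real_derivative - (q * \<kappa>\<^sup>2 * sol q x)) (at x)"
proof -
  have inner: "((\<lambda>x. q * x powr (2 - \<alpha>)) has_real_derivative q * ((2 - \<alpha>) * x powr (1 - \<alpha>))) (at x)"
    using has_real_derivative_powr[OF x, of "2 - \<alpha>"] by (intro DERIV_cmult) simp
  have "\<nu> - 1 > - 1" using nu_pos by simp
  from DERIV_cmult[OF DERIV_chain2[OF bessel_entire_deriv[OF this] inner], of "2 - \<alpha>"]
  have "(flux q has_real_derivative (2 - \<alpha>) * (- bessel_entire \<nu> (q * x powr (2 - \<alpha>)) / 4 * (q * ((2 - \<alpha>) * x powr (1 - \<alpha>))))) (at x)"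
    by (simp add: flux_def[abs_def])
  moreover have "(2 - \<alpha>) * (- bessel_entire \<nu> (q * x powr (2 - \<alpha>)) / 4 * (q * ((2 - \<alpha>) * x powr (1 - \<alpha>)))) = - (q * \<kappa>\<^sup>2 * sol q x)"
    by (simp add: sol_def kappa_eq[symmetric] power2_eq_square)
  ultimately show ?thesis by (simp only:)
qed

lemma continuous_on_bessel_entire: "\<mu> > - 1 \<Longrightarrow> continuous_on S (bessel_entire \<mu> :: real \<Rightarrow> real)"
  using DERIV_isCont[OF bessel_entire_deriv] by (intro continuous_at_imp_continuous_on) blast

lemma continuous_on_sol: "continuous_on {0..} (sol q)"
  unfolding sol_def[abs_def] using alpha nu_pos
  by (intro continuous_intros continuous_on_powr' continuous_on_compose2[OF continuous_on_bessel_entire[of _ UNIV]]) auto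

lemma continuous_on_flux: "continuous_on {0..} (flux q)"
  unfolding flux_def[abs_def] using alpha nu_pos
  by (intro continuous_intros continuous_on_powr' continuous_on_compose2[OF continuous_on_bessel_entire[of _ UNIV]]) auto

text \<open>
  Green's formula. The boundary term at 0 drops out because the solutions vanish there while their
  fluxes stay bounded.
\<close>

lemma lagrange_identity:
  "((\<lambda>x. (r - q) * \<kappa>\<^sup>2 * (sol q x * sol r x)) has_integral flux q 1 * sol r 1 - flux r 1 * sol q 1) {0..1}"
proof -
  define f where "f x = flux q x * sol r x - flux r x * sol q x" for x
  have "((\<lambda>x. (r - q) * \<kappa>\<^sup>2 * (sol q x * sol r x)) has_integral f 1 - f 0) {0..1}"
  proof (rule fundamental_theorem_of_calculus_interior)
    show "continuous_on {0..1} f"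
      unfolding f_def[abs_def]
      by (intro continuous_intros continuous_on_subset[OF continuous_on_sol] continuous_on_subset[OF continuous_on_flux]) auto
    fix x :: real assume "x \<in> {0<..<1}"
    then have x: "x > 0" by simp
    note dU = DERIV_sol[OF x] and dP = DERIV_flux[OF x]
    have "(f has_real_derivative (r - q) * \<kappa>\<^sup>2 * (sol q x * sol r x)) (at x)"
      unfolding f_def[abs_def]
      by (rule DERIV_cong[OF DERIV_diff[OF DERIV_mult[OF dP dU] DERIV_mult[OF dP dU]]]) (simp add: algebra_simps)
    then show "(f has_vector_derivative (r - q) * \<kappa>\<^sup>2 * (sol q x * sol r x)) (at x)"
      by (simp add: has_real_derivative_iff_has_vector_derivative)
  qed simp
  then show ?thesis by (simp add: f_def sol_0)
qed

text \<open>
  The limiting case of equal parameters in Green's formula, obtained from an explicit antiderivative: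
  multiplying the equation by \<open>x u'\<close> gives a formula of Pohozaev type.
\<close>

lemma norm_identity:
  assumes "sol q 1 = 0"
  shows "((\<lambda>x. (2 - \<alpha>) * (q * \<kappa>\<^sup>2) * (sol q x)\<^sup>2) has_integral (flux q 1)\<^sup>2) {0..1}"
proof -
  define s where "s = q * \<kappa>\<^sup>2"
  define f where "f x = x powr (1 - \<alpha>) * (flux q x * flux q x) - (1 - \<alpha>) * (flux q x * sol q x) + s * (x * (sol q x * sol q x))" for x
  have "((\<lambda>x. (2 - \<alpha>) * s * (sol q x)\<^sup>2) has_integral f 1 - f 0) {0..1}"
  proof (rule fundamental_theorem_of_calculus_interior)
    show "continuous_on {0..1} f"
      unfolding f_def[abs_def] using alpha
      by (intro continuous_intros continuous_on_powr' continuous_on_subset[OF continuous_on_sol] continuous_on_subset[OF continuous_on_flux]) auto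
    fix x :: real assume "x \<in> {0<..<1}"
    then have x: "x > 0" by simp
    note dU = DERIV_sol[OF x, of q] and dP = DERIV_flux[OF x, of q, folded s_def]
    have dp: "((\<lambda>x. x powr (1 - \<alpha>)) has_real_derivative (1 - \<alpha>) * x powr (- \<alpha>)) (at x)"
      using has_real_derivative_powr[OF x, of "1 - \<alpha>"] by simp
    have px: "x powr (1 - \<alpha>) = x * x powr (- \<alpha>)"
      using x by (simp add: powr_mult_base)
    have "(f has_real_derivative (2 - \<alpha>) * s * (sol q x)\<^sup>2) (at x)"
      unfolding f_def[abs_def]
      by (rule DERIV_cong[OF DERIV_add[OF DERIV_diff[OF DERIV_mult[OF dp DERIV_mult[OF dP dP]]
              DERIV_cmult[OF DERIV_mult[OF dP dU]]] DERIV_cmult[OF DERIV_mult[OF DERIV_ident DERIV_mult[OF dU dU]]]]])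
         (simp add: px algebra_simps power2_eq_square)
    then show "(f has_vector_derivative (2 - \<alpha>) * s * (sol q x)\<^sup>2) (at x)"
      by (simp add: has_real_derivative_iff_has_vector_derivative)
  qed simp
  then show ?thesis using assms alpha by (simp add: f_def sol_0 s_def power2_eq_square)
qed

text \<open>
  The zeros are simple: otherwise \<open>norm_identity\<close> would force \<open>sol q\<close> to vanish identically on the unit
  interval, against \<open>E\<^sub>\<nu>(0) > 0\<close>.
\<close>

lemma flux_nonzero:
  assumes q: "q > 0" and z: "bessel_entire \<nu> q = 0"
  shows "flux q 1 \<noteq> 0"
proof
  assume 0: "flux q 1 = 0"
  have "sol q 1 = 0" using z by (simp add: sol_1)
  from norm_identity[OF this] have I: "((\<lambda>x. (2 - \<alpha>) * (q * \<kappa>\<^sup>2) * (sol q x)\<^sup>2) has_integral 0) (cbox 0 1)"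
    by (simp add: 0)
  have U0: "sol q x = 0" if "x \<in> {0..1}" for x
  proof -
    have "(2 - \<alpha>) * (q * \<kappa>\<^sup>2) * (sol q x)\<^sup>2 = 0"
    proof (rule has_integral_0_cbox_imp_0[OF _ _ I])
      show "continuous_on (cbox 0 1) (\<lambda>x. (2 - \<alpha>) * (q * \<kappa>\<^sup>2) * (sol q x)\<^sup>2)"
        by (intro continuous_intros continuous_on_subset[OF continuous_on_sol]) auto
    qed (use q alpha that in auto)
    then show ?thesis using q alpha kappa_pos by simp
  qed
  have "((\<lambda>x. bessel_entire \<nu> (q * x powr (2 - \<alpha>))) \<longlongrightarrow> bessel_entire \<nu> (q * 0 powr (2 - \<alpha>))) (at 0 within {0..1})"
  proof -
    have "continuous_on {0..1} (\<lambda>x. bessel_entire \<nu> (q * x powr (2 - \<alpha>)))"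
      using alpha nu_pos
      by (intro continuous_intros continuous_on_powr' continuous_on_compose2[OF continuous_on_bessel_entire[of _ UNIV]]) auto
    then show ?thesis unfolding continuous_on_def by (rule bspec) simp
  qed
  moreover have "eventually (\<lambda>x. bessel_entire \<nu> (q * x powr (2 - \<alpha>)) = 0) (at 0 within {0..1})"
    unfolding eventually_at
  proof (intro exI[of _ 1] conjI ballI impI)
    fix x :: real assume "x \<in> {0..1}" "x \<noteq> 0 \<and> dist x 0 < 1"
    then show "bessel_entire \<nu> (q * x powr (2 - \<alpha>)) = 0" using U0[of x] by (simp add: sol_def)
  qed simp
  ultimately have "((\<lambda>x. 0) \<longlongrightarrow> bessel_entire \<nu> (q * 0 powr (2 - \<alpha>))) (at 0 within {0..1::real})"
    by (rule Lim_transform_eventually)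
  moreover have "at 0 within {0..1::real} \<noteq> bot"
    by (simp add: at_within_Icc_at_right)
  ultimately have "bessel_entire \<nu> (0::real) = 0" by (simp add: tendsto_const_iff)
  then show False using bessel_entire_0[of \<nu>] nu_pos by simp
qed

text \<open>
  Nonoscillation is impossible. If the solution kept its sign \<open>\<sigma>\<close>, its flux would decrease. The flux
  cannot become negative, since \<open>x powr (- \<alpha>)\<close> has infinite integral at infinity and the solution
  would be driven through zero. Hence the solution increases, and then the flux decreases at least
  linearly, so it becomes negative after all.
\<close>

lemma no_eventual_sign:
  assumes \<sigma>: "\<sigma> = 1 \<or> \<sigma> = - 1" and X: "X \<ge> 0" and pos: "\<And>x. x > X \<Longrightarrow> \<sigma> * sol 1 x > 0"
  shows False
proof -
  have dU: "((\<lambda>x. \<sigma> * sol 1 x) has_real_derivative x powr (- \<alpha>) * (\<sigma> * flux 1 x)) (at x)" if "x > X" for x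
    using DERIV_cmult[OF DERIV_sol[of x 1], of \<sigma>] that X by (simp add: mult_ac)
  have dP: "((\<lambda>x. \<sigma> * flux 1 x) has_real_derivative - (\<kappa>\<^sup>2 * (\<sigma> * sol 1 x))) (at x)" if "x > X" for x
    using DERIV_cmult[OF DERIV_flux[of x 1], of \<sigma>] that X by (simp add: mult_ac)
  have Pdec: "\<sigma> * flux 1 y \<le> \<sigma> * flux 1 x" if "X < x" "x \<le> y" for x y
  proof (rule DERIV_nonpos_imp_nonincreasing[OF that(2)])
    fix z assume "x \<le> z" "z \<le> y"
    then have "z > X" using that by simp
    then show "\<exists>D. ((\<lambda>x. \<sigma> * flux 1 x) has_real_derivative D) (at z) \<and> D \<le> 0"
      using dP[of z] pos[of z] by (intro exI[of _ "- (\<kappa>\<^sup>2 * (\<sigma> * sol 1 z))"]) simp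
  qed
  have Ppos: "\<sigma> * flux 1 x0 \<ge> 0" if x0: "x0 > X" for x0
  proof (rule ccontr)
    assume "\<not> ?thesis"
    then have neg: "\<sigma> * flux 1 x0 < 0" by simp
    define e where "e = - (\<sigma> * flux 1 x0)"
    have e: "e > 0" using neg by (simp add: e_def)
    \<comment> \<open>the correction term is e times an antiderivative of \<open>x powr (- \<alpha>)\<close>, so g is nonincreasing\<close>
    define g where "g x = \<sigma> * sol 1 x + e / (1 - \<alpha>) * x powr (1 - \<alpha>)" for x
    have dg: "(g has_real_derivative x powr (- \<alpha>) * (\<sigma> * flux 1 x) + e * x powr (- \<alpha>)) (at x)" if "x > X" for x
    proof -
      have "((\<lambda>x. e / (1 - \<alpha>) * x powr (1 - \<alpha>)) has_real_derivative e / (1 - \<alpha>) * ((1 - \<alpha>) * x powr (- \<alpha>))) (at x)"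
        using has_real_derivative_powr[of x "1 - \<alpha>"] that X by (intro DERIV_cmult) simp
      from DERIV_add[OF dU[OF that] this] show ?thesis using alpha by (simp add: g_def[abs_def])
    qed
    have gdec: "g y \<le> g x0" if "x0 \<le> y" for y
    proof (rule DERIV_nonpos_imp_nonincreasing[OF that])
      fix x assume x: "x0 \<le> x" "x \<le> y"
      have "\<sigma> * flux 1 x + e \<le> 0" using Pdec[OF x0 x(1)] by (simp add: e_def)
      then have "x powr (- \<alpha>) * (\<sigma> * flux 1 x + e) \<le> 0" by (intro mult_nonneg_nonpos) auto
      then show "\<exists>D. (g has_real_derivative D) (at x) \<and> D \<le> 0"
        using dg[of x] x x0 by (intro exI[of _ "x powr (- \<alpha>) * (\<sigma> * flux 1 x) + e * x powr (- \<alpha>)"]) (simp add: algebra_simps)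
    qed
    define c where "c = (1 - \<alpha>) * \<bar>g x0\<bar> / e"
    define y where "y = max x0 (c powr (1 / (1 - \<alpha>)))"
    have "c = (c powr (1 / (1 - \<alpha>))) powr (1 - \<alpha>)"
      using e alpha by (simp add: powr_powr c_def)
    also have "\<dots> \<le> y powr (1 - \<alpha>)"
      using alpha by (intro powr_mono2) (auto simp: y_def)
    finally have y: "y powr (1 - \<alpha>) \<ge> (1 - \<alpha>) * \<bar>g x0\<bar> / e" "y \<ge> x0"
      by (simp_all add: c_def y_def)
    have "e / (1 - \<alpha>) * y powr (1 - \<alpha>) \<ge> \<bar>g x0\<bar>" using y(1) e alpha by (simp add: field_simps)
    moreover have "g y \<le> \<bar>g x0\<bar>" using gdec[OF y(2)] by simp
    moreover have "\<sigma> * sol 1 y > 0" using pos[of y] y x0 by simp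
    ultimately show False by (simp add: g_def)
  qed
  define x1 where "x1 = X + 1"
  have x1: "x1 > X" by (simp add: x1_def)
  have Uinc: "\<sigma> * sol 1 x1 \<le> \<sigma> * sol 1 y" if "x1 \<le> y" for y
  proof (rule DERIV_nonneg_imp_nondecreasing[OF that])
    fix z assume "x1 \<le> z" "z \<le> y"
    then have "z > X" using x1 by simp
    then show "\<exists>D. ((\<lambda>x. \<sigma> * sol 1 x) has_real_derivative D) (at z) \<and> 0 \<le> D"
      using dU[of z] Ppos[of z] by (intro exI[of _ "z powr (- \<alpha>) * (\<sigma> * flux 1 z)"]) simp
  qed
  define v where "v = \<kappa>\<^sup>2 * (\<sigma> * sol 1 x1)"
  have v: "v > 0" using pos[OF x1] kappa_pos by (simp add: v_def)
  \<comment> \<open>at this point the linear bound makes the flux at most -1\<close>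
  define y where "y = x1 + (\<bar>\<sigma> * flux 1 x1\<bar> + 1) / v"
  have y: "y \<ge> x1" using v by (simp add: y_def)
  have "\<sigma> * flux 1 y + v * y \<le> \<sigma> * flux 1 x1 + v * x1"
  proof (rule DERIV_nonpos_imp_nonincreasing[OF y])
    fix x assume x: "x1 \<le> x" "x \<le> y"
    have "v \<le> \<kappa>\<^sup>2 * (\<sigma> * sol 1 x)" unfolding v_def by (intro mult_left_mono Uinc x) simp
    moreover have "((\<lambda>x. \<sigma> * flux 1 x + v * x) has_real_derivative - (\<kappa>\<^sup>2 * (\<sigma> * sol 1 x)) + v * 1) (at x)"
      using x x1 by (intro DERIV_add dP DERIV_cmult DERIV_ident) auto
    ultimately show "\<exists>D. ((\<lambda>x. \<sigma> * flux 1 x + v * x) has_real_derivative D) (at x) \<and> D \<le> 0" by force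
  qed
  moreover have "v * y = v * x1 + \<bar>\<sigma> * flux 1 x1\<bar> + 1" using v by (simp add: y_def field_simps)
  moreover have "\<sigma> * flux 1 y \<ge> 0" using Ppos[of y] y x1 by simp
  ultimately show False by linarith
qed

lemma bessel_entire_zeros_unbounded:
  assumes "Y \<ge> 0"
  shows "\<exists>y>Y. bessel_entire \<nu> (y::real) = 0"
proof (rule ccontr)
  assume no: "\<not> ?thesis"
  define X where "X = Y powr (1 / (2 - \<alpha>))"
  have X: "X \<ge> 0" by (simp add: X_def)
  have nz: "sol 1 x \<noteq> 0" if "x > X" for x
  proof -
    have "X powr (2 - \<alpha>) = Y" using assms alpha by (simp add: X_def powr_powr)
    moreover have "X powr (2 - \<alpha>) < x powr (2 - \<alpha>)" using that X alpha by (intro powr_less_mono2) auto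
    ultimately show ?thesis using no that X by (auto simp: sol_def)
  qed
  define \<sigma> where "\<sigma> = sgn (sol 1 (X + 1))"
  have \<sigma>: "\<sigma> = 1 \<or> \<sigma> = - 1" using nz[of "X + 1"] by (auto simp: \<sigma>_def sgn_if)
  show False
  proof (rule no_eventual_sign[OF \<sigma> X], rule ccontr)
    fix x assume x: "x > X" and "\<not> \<sigma> * sol 1 x > 0"
    then have le: "\<sigma> * sol 1 x \<le> 0" by simp
    have ge: "\<sigma> * sol 1 (X + 1) > 0" using nz[of "X + 1"] by (simp add: \<sigma>_def sgn_if)
    have "connected ((\<lambda>x. \<sigma> * sol 1 x) ` {X<..})"
      using X by (intro connected_continuous_image continuous_intros continuous_on_subset[OF continuous_on_sol]) auto
    then have "0 \<in> (\<lambda>x. \<sigma> * sol 1 x) ` {X<..}"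
      by (rule connectedD_interval[OF _ _ _ le less_imp_le[OF ge]]) (use x in auto)
    then show False using nz \<sigma> by auto
  qed
qed

text \<open>
  At an accumulation point of zeros both the function and its derivative would vanish. This is excluded
  at 0 by \<open>E\<^sub>\<nu>(0) > 0\<close> and elsewhere by the simplicity of the zeros.
\<close>

lemma finite_bessel_entire_zeros: "finite {y::real. 0 < y \<and> y \<le> Y \<and> bessel_entire \<nu> y = 0}"
proof (rule ccontr)
  define Z where "Z = {y::real. 0 < y \<and> y \<le> Y \<and> bessel_entire \<nu> y = 0}"
  assume "infinite {y::real. 0 < y \<and> y \<le> Y \<and> bessel_entire \<nu> y = 0}"
  then have "infinite Z" "bounded Z"
    by (auto simp: Z_def intro: bounded_subset[OF bounded_cbox[of 0 Y]])
  then obtain z where z: "z islimpt Z" using bounded_infinite_imp_islimpt by blast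
  then obtain y where y: "\<And>n. y n \<in> Z - {z}" "y \<longlonglongrightarrow> z"
    unfolding islimpt_sequential by blast
  have nu1: "\<nu> > - 1" using nu_pos by simp
  have "(\<lambda>n. bessel_entire \<nu> (y n)) \<longlonglongrightarrow> bessel_entire \<nu> z"
    by (rule isCont_tendsto_compose[OF DERIV_isCont[OF bessel_entire_deriv[OF nu1]] y(2)])
  then have Ez: "bessel_entire \<nu> z = 0" using y(1) by (simp add: Z_def LIMSEQ_const_iff)
  have "z \<ge> 0" by (rule LIMSEQ_le_const[OF y(2)]) (use y(1) in \<open>auto simp: Z_def intro!: exI[of _ 0] less_imp_le\<close>)
  then have z0: "z > 0" using Ez bessel_entire_0[OF nu1] by (cases "z = 0") auto
  have "((\<lambda>x. (bessel_entire \<nu> x - bessel_entire \<nu> z) / (x - z)) \<longlongrightarrow> - bessel_entire (\<nu> + 1) z / 4) (at z)"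
    using bessel_entire_deriv[OF nu1, of z] by (simp add: has_field_derivative_iff)
  moreover have "filterlim y (at z) sequentially"
    using y by (auto simp: filterlim_at)
  ultimately have "(\<lambda>n. (bessel_entire \<nu> (y n) - bessel_entire \<nu> z) / (y n - z)) \<longlonglongrightarrow> - bessel_entire (\<nu> + 1) z / 4"
    by (rule filterlim_compose)
  then have "bessel_entire (\<nu> + 1) z = 0" using y(1) by (simp add: Z_def Ez LIMSEQ_const_iff)
  then have "flux z 1 = 0" using bessel_entire_recurrence[OF nu_pos, of z] Ez by (simp add: flux_def)
  then show False using flux_nonzero[OF z0 Ez] by simp
qed

end

section \<open>Zeros, eigenfunctions and their inner products\<close>

text \<open>
  Local finiteness makes the element that follows \<open>x\<close> a minimum of a finite set, and passing to it raises
  the count by one. This is what the description of \<open>bessel_zero\<close> by counting relies on.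
\<close>

lemma nth_element_ex1:
  fixes S :: "real set"
  assumes fin: "\<And>x. finite {t \<in> S. t \<le> x}" and unb: "\<And>x. \<exists>s\<in>S. s > x"
  shows "\<exists>!x. x \<in> S \<and> card {t \<in> S. t \<le> x} = Suc n"
proof (rule ex_ex1I)
  show "\<exists>x. x \<in> S \<and> card {t \<in> S. t \<le> x} = Suc n"
  proof (induction n)
    case 0
    obtain s where s: "s \<in> S" using unb by blast
    define x where "x = Min {t \<in> S. t \<le> s}"
    have x: "x \<in> {t \<in> S. t \<le> s}" unfolding x_def by (rule Min_in[OF fin]) (use s in auto)
    have "x \<le> t" if "t \<in> S" "t \<le> s" for t unfolding x_def by (rule Min_le[OF fin]) (use that in auto)
    with x have "{t \<in> S. t \<le> x} = {x}" by force
    then show ?case using x by auto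
  next
    case (Suc n)
    then obtain x where x: "x \<in> S" "card {t \<in> S. t \<le> x} = Suc n" by blast
    obtain s where s: "s \<in> S" "s > x" using unb by blast
    define T where "T = {t \<in> S. t \<le> s \<and> x < t}"
    have T: "finite T" unfolding T_def by (rule finite_subset[OF _ fin[of s]]) auto
    define y where "y = Min T"
    have y: "y \<in> T" unfolding y_def by (rule Min_in[OF T]) (use s in \<open>auto simp: T_def\<close>)
    have le: "y \<le> t" if "t \<in> T" for t unfolding y_def by (rule Min_le[OF T that])
    have "{t \<in> S. t \<le> y} = insert y {t \<in> S. t \<le> x}"
    proof (intro equalityI subsetI)
      fix t assume t: "t \<in> {t \<in> S. t \<le> y}"
      show "t \<in> insert y {t \<in> S. t \<le> x}"
      proof (cases "t \<le> x")
        case False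
        then have "t \<in> T" using t y by (auto simp: T_def)
        then show ?thesis using le[of t] t by auto
      qed (use t in auto)
    qed (use y x in \<open>auto simp: T_def\<close>)
    moreover have "y \<notin> {t \<in> S. t \<le> x}" using y by (auto simp: T_def)
    ultimately have "card {t \<in> S. t \<le> y} = Suc (Suc n)" using fin x by simp
    then show ?case using y by (auto simp: T_def)
  qed
  fix x y assume x: "x \<in> S \<and> card {t \<in> S. t \<le> x} = Suc n" and y: "y \<in> S \<and> card {t \<in> S. t \<le> y} = Suc n"
  have less: "card {t \<in> S. t \<le> u} < card {t \<in> S. t \<le> v}" if "u < v" "v \<in> S" for u v
    by (rule psubset_card_mono[OF fin]) (use that in force)
  show "x = y"
    using less[of x y] less[of y x] x y by (cases x y rule: linorder_cases) auto
qed

lemma complex_powr_mult_of_real: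
  assumes "t > 0"
  shows "(w * of_real t :: complex) powr of_real \<mu> = w powr of_real \<mu> * of_real (t powr \<mu>)"
proof (cases "w = 0")
  case False
  have "Ln (w * of_real t) = of_real (ln t) + Ln w"
    using Ln_times_of_real[OF assms False] Ln_of_real[OF assms] by (simp add: mult.commute)
  then show ?thesis
    using assms False by (simp add: powr_def exp_add distrib_left exp_of_real[symmetric] flip: of_real_mult)
qed simp

lemma unit_interval_integral:
  fixes f :: "real \<Rightarrow> real"
  assumes f: "continuous_on {0..1} f"
  shows "integrable unit_interval f" and "(f has_integral I) {0..1} \<Longrightarrow> (LINT x|unit_interval. f x) = I"
proof -
  have "set_integrable lborel {0..1} f"
    by (rule borel_integrable_atLeastAtMost'[OF f])
  then have S: "set_integrable lborel {0<..<1} f"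
    by (rule set_integrable_subset) auto
  then show "integrable unit_interval f"
    by (simp add: integrable_restrict_space set_integrable_def)
  assume I: "(f has_integral I) {0..1}"
  have "(LINT x|unit_interval. f x) = (LINT x:{0<..<1}|lborel. f x)"
    by (simp add: integral_restrict_space set_lebesgue_integral_def)
  also have "\<dots> = integral {0<..<1} f" by (rule set_borel_integral_eq_integral(2)[OF S])
  also have "\<dots> = I" using I has_integral_open_interval[of f I 0 1] by (intro integral_unique) simp
  finally show "(LINT x|unit_interval. f x) = I" .
qed

context degenerate_operator
begin

lemma continuous_on_sol_mult: "continuous_on {0..1} (\<lambda>x. sol q x * sol r x)"
  by (intro continuous_intros continuous_on_subset[OF continuous_on_sol]) auto

lemma integral_sol_mult:
  assumes "q \<noteq> r"
  shows "(LINT x|unit_interval. sol q x * sol r x) = (flux q 1 * sol r 1 - flux r 1 * sol q 1) / ((r - q) * \<kappa>\<^sup>2)"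
proof (rule unit_interval_integral(2)[OF continuous_on_sol_mult])
  have "(r - q) * \<kappa>\<^sup>2 \<noteq> 0" using assms kappa_pos by simp
  with has_integral_divide[OF lagrange_identity[of r q], of "(r - q) * \<kappa>\<^sup>2"]
  show "((\<lambda>x. sol q x * sol r x) has_integral (flux q 1 * sol r 1 - flux r 1 * sol q 1) / ((r - q) * \<kappa>\<^sup>2)) {0..1}"
    by simp
qed

lemma integral_sol_sq:
  assumes "q > 0" "sol q 1 = 0"
  shows "(LINT x|unit_interval. sol q x * sol q x) = (flux q 1)\<^sup>2 / ((2 - \<alpha>) * (q * \<kappa>\<^sup>2))"
proof (rule unit_interval_integral(2)[OF continuous_on_sol_mult])
  have "(2 - \<alpha>) * (q * \<kappa>\<^sup>2) \<noteq> 0" using assms alpha kappa_pos by simp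
  with has_integral_divide[OF norm_identity[OF assms(2)], of "(2 - \<alpha>) * (q * \<kappa>\<^sup>2)"]
  show "((\<lambda>x. sol q x * sol q x) has_integral (flux q 1)\<^sup>2 / ((2 - \<alpha>) * (q * \<kappa>\<^sup>2))) {0..1}"
    by (simp add: power2_eq_square)
qed

lemma bessel_J_of_real:
  assumes "t \<ge> 0"
  shows "bessel_J \<nu> (of_real t) = of_real ((t / 2) powr \<nu> * bessel_entire \<nu> (t\<^sup>2))"
proof -
  have "(of_real t / 2) powr of_real \<nu> = (of_real ((t / 2) powr \<nu>) :: complex)"
    using powr_of_real[of "t / 2" \<nu>] assms by simp
  moreover have "bessel_entire \<nu> ((of_real t)\<^sup>2 :: complex) = of_real (bessel_entire \<nu> (t\<^sup>2))"
    using bessel_entire_of_real[of \<nu> "t\<^sup>2"] nu_pos by simp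
  ultimately show ?thesis by (simp add: bessel_J_eq)
qed

lemma bessel_J_zero_iff: "t > 0 \<Longrightarrow> bessel_J \<nu> (of_real t) = 0 \<longleftrightarrow> bessel_entire \<nu> (t\<^sup>2) = 0"
  by (simp add: bessel_J_of_real)

definition positive_zeros :: "real set" where "positive_zeros = {t. 0 < t \<and> bessel_J \<nu> (of_real t) = 0}"

lemma finite_positive_zeros: "finite {t \<in> positive_zeros. t \<le> x}"
proof (rule finite_imageD)
  show "finite ((\<lambda>t. t\<^sup>2) ` {t \<in> positive_zeros. t \<le> x})"
  proof (rule finite_subset[OF _ finite_bessel_entire_zeros[of "x\<^sup>2"]])
    show "(\<lambda>t. t\<^sup>2) ` {t \<in> positive_zeros. t \<le> x} \<subseteq> {y. 0 < y \<and> y \<le> x\<^sup>2 \<and> bessel_entire \<nu> y = 0}"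
      by (auto simp: positive_zeros_def bessel_J_zero_iff power_mono)
  qed
  show "inj_on (\<lambda>t. t\<^sup>2) {t \<in> positive_zeros. t \<le> x}"
    by (auto simp: inj_on_def positive_zeros_def)
qed

lemma unbounded_positive_zeros: "\<exists>s\<in>positive_zeros. s > x"
proof -
  obtain y where y: "y > x\<^sup>2" "bessel_entire \<nu> y = 0"
    using bessel_entire_zeros_unbounded[of "x\<^sup>2"] by auto
  have y0: "y > 0" using y(1) zero_le_power2[of x] by linarith
  have "sqrt y > x" using y(1) by (simp add: real_less_rsqrt)
  moreover have "sqrt y \<in> positive_zeros" using y0 y(2) by (simp add: positive_zeros_def bessel_J_zero_iff)
  ultimately show ?thesis by blast
qed

lemma bessel_zero_spec:
  assumes "n \<ge> 1"
  shows "bessel_zero \<nu> n \<in> positive_zeros" and "card {t \<in> positive_zeros. t \<le> bessel_zero \<nu> n} = n"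
proof -
  obtain m where m: "n = Suc m" using assms by (cases n) auto
  have eq: "(0 < x \<and> bessel_J \<nu> (of_real x) = 0 \<and> card {t. 0 < t \<and> t \<le> x \<and> bessel_J \<nu> (of_real t) = 0} = n)
      \<longleftrightarrow> (x \<in> positive_zeros \<and> card {t \<in> positive_zeros. t \<le> x} = Suc m)" for x
  proof -
    have "{t. 0 < t \<and> t \<le> x \<and> bessel_J \<nu> (of_real t) = 0} = {t \<in> positive_zeros. t \<le> x}" by (auto simp: positive_zeros_def)
    then show ?thesis by (auto simp: positive_zeros_def m)
  qed
  have "bessel_zero \<nu> n \<in> positive_zeros \<and> card {t \<in> positive_zeros. t \<le> bessel_zero \<nu> n} = Suc m"
    unfolding bessel_zero_def eq by (rule theI'[OF nth_element_ex1[OF finite_positive_zeros unbounded_positive_zeros]])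
  then show "bessel_zero \<nu> n \<in> positive_zeros" and "card {t \<in> positive_zeros. t \<le> bessel_zero \<nu> n} = n" by (auto simp: m)
qed

lemma bessel_zero_less:
  assumes "1 \<le> m" "m < n"
  shows "bessel_zero \<nu> m < bessel_zero \<nu> n"
proof (rule ccontr)
  assume "\<not> ?thesis"
  then have "card {t \<in> positive_zeros. t \<le> bessel_zero \<nu> n} \<le> card {t \<in> positive_zeros. t \<le> bessel_zero \<nu> m}"
    by (intro card_mono finite_positive_zeros) auto
  then show False using assms bessel_zero_spec(2)[of m] bessel_zero_spec(2)[of n] by simp
qed

definition zero_sq :: "nat \<Rightarrow> real" where "zero_sq n = (bessel_zero \<nu> n)\<^sup>2"

definition boundary_deriv :: "nat \<Rightarrow> real" where "boundary_deriv n = sqrt (2 * \<kappa>) * \<kappa> * bessel_zero \<nu> n"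

lemma bessel_zero_facts:
  assumes "n \<ge> 1"
  shows "bessel_zero \<nu> n > 0" "zero_sq n > 0" "bessel_entire \<nu> (zero_sq n) = 0" "sol (zero_sq n) 1 = 0" "flux (zero_sq n) 1 \<noteq> 0"
    "eigval \<alpha> n = zero_sq n * \<kappa>\<^sup>2" "eigval \<alpha> n > 0" "(boundary_deriv n)\<^sup>2 = (2 - \<alpha>) * eigval \<alpha> n" "boundary_deriv n > 0"
proof -
  show j: "bessel_zero \<nu> n > 0" using bessel_zero_spec(1)[OF assms] by (simp add: positive_zeros_def)
  then show qp: "zero_sq n > 0" by (simp add: zero_sq_def)
  show E: "bessel_entire \<nu> (zero_sq n) = 0"
    using bessel_zero_spec(1)[OF assms] j by (simp add: positive_zeros_def zero_sq_def bessel_J_zero_iff)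
  then show "sol (zero_sq n) 1 = 0" by (simp add: sol_1)
  show "flux (zero_sq n) 1 \<noteq> 0" by (rule flux_nonzero[OF qp E])
  show e: "eigval \<alpha> n = zero_sq n * \<kappa>\<^sup>2" by (simp add: eigval_def zero_sq_def power_mult_distrib)
  then show "eigval \<alpha> n > 0" using qp kappa_pos by simp
  show "(boundary_deriv n)\<^sup>2 = (2 - \<alpha>) * eigval \<alpha> n"
    unfolding e boundary_deriv_def zero_sq_def kappa_eq[symmetric] using kappa_pos by (simp add: power_mult_distrib)
  show "boundary_deriv n > 0" using j kappa_pos by (simp add: boundary_deriv_def)
qed

definition mode :: "nat \<Rightarrow> real \<Rightarrow> real" where "mode n x = boundary_deriv n / flux (zero_sq n) 1 * sol (zero_sq n) x"

text \<open>
  At a zero the derivative of the factor \<open>(z/2)\<^sup>\<nu>\<close> does not contribute, and the recurrence identifies the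
  remaining derivative with the flux at 1. This makes the normalisation of \<open>phi\<close> equivalent to
  prescribing its derivative at 1, see \<open>mode\<close>.
\<close>

lemma deriv_bessel_J_zero:
  assumes n: "n \<ge> 1"
  shows "deriv (bessel_J \<nu>) (of_real (bessel_zero \<nu> n))
    = of_real ((bessel_zero \<nu> n / 2) powr \<nu> * flux (zero_sq n) 1 / (\<kappa> * bessel_zero \<nu> n))"
proof -
  define j where "j = bessel_zero \<nu> n"
  have j: "j > 0" using bessel_zero_facts[OF n] by (simp add: j_def)
  have nu1: "\<nu> > - 1" using nu_pos by simp
  have E0: "bessel_entire \<nu> ((of_real j)\<^sup>2 :: complex) = 0"
    using bessel_zero_facts(3)[OF n] bessel_entire_of_real[OF nu1, of "j\<^sup>2"] by (simp add: zero_sq_def j_def)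
  have E1: "bessel_entire (\<nu> + 1) ((of_real j)\<^sup>2 :: complex) = of_real (bessel_entire (\<nu> + 1) (zero_sq n))"
    using bessel_entire_of_real[of "\<nu> + 1" "j\<^sup>2"] nu_pos by (simp add: zero_sq_def j_def)
  have "(of_real j / 2 :: complex) = of_real (j / 2)" by simp
  then have "(of_real j / 2 :: complex) \<notin> \<real>\<^sub>\<le>\<^sub>0"
    using j by (simp only: complex_nonpos_Reals_iff Re_complex_of_real Im_complex_of_real) simp
  note dpowr = has_field_derivative_powr[OF this, of "of_real \<nu>"]
  have half: "((\<lambda>z::complex. z / 2) has_field_derivative 1 / 2) (at (of_real j))"
    by (auto intro!: derivative_eq_intros)
  note D = DERIV_chain2[OF dpowr half]
  have sq: "((\<lambda>z::complex. z\<^sup>2) has_field_derivative 2 * of_real j) (at (of_real j))"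
    by (auto intro!: derivative_eq_intros)
  have "(bessel_J \<nu> has_field_derivative
      (of_real j / 2) powr of_real \<nu> * (- bessel_entire (\<nu> + 1) ((of_real j)\<^sup>2) / 4 * (2 * of_real j)) 
      + of_real \<nu> * (of_real j / 2) powr (of_real \<nu> - 1) * (1 / 2) * bessel_entire \<nu> ((of_real j)\<^sup>2))
      (at (of_real j))"
    unfolding bessel_J_eq[abs_def]
    by (rule DERIV_mult'[OF D DERIV_chain2[OF bessel_entire_deriv[OF nu1] sq]])
  then have "deriv (bessel_J \<nu>) (of_real j) = (of_real j / 2) powr of_real \<nu> * (- bessel_entire (\<nu> + 1) ((of_real j)\<^sup>2) / 4 * (2 * of_real j))"
    unfolding E0 by (simp add: DERIV_imp_deriv)
  also have "(of_real j / 2 :: complex) powr of_real \<nu> = of_real ((j / 2) powr \<nu>)"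
    using powr_of_real[of "j / 2" \<nu>] j by simp
  finally have *: "deriv (bessel_J \<nu>) (of_real j) = of_real ((j / 2) powr \<nu> * (- bessel_entire (\<nu> + 1) (zero_sq n) / 4 * (2 * j)))"
    unfolding E1 by simp
  have "flux (zero_sq n) 1 = 2 * \<kappa> * (- j\<^sup>2 * bessel_entire (\<nu> + 1) (zero_sq n) / 4)"
    using bessel_entire_recurrence[OF nu_pos, of "zero_sq n"] bessel_zero_facts(3)[OF n]
    by (simp add: flux_def kappa_eq zero_sq_def j_def)
  then have "- bessel_entire (\<nu> + 1) (zero_sq n) / 4 * (2 * j) = flux (zero_sq n) 1 / (\<kappa> * j)"
    using j kappa_pos by (simp add: field_simps power2_eq_square)
  from *[unfolded this] show ?thesis by (simp add: j_def)
qed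

lemma phi_eq:
  assumes n: "n \<ge> 1" and x: "x > 0"
  shows "phi \<alpha> n x = of_real (mode n x)"
proof -
  define j where "j = bessel_zero \<nu> n"
  have j: "j > 0" using bessel_zero_facts[OF n] by (simp add: j_def)
  have "(j * x powr \<kappa> / 2) powr \<nu> = (j / 2) powr \<nu> * x powr (\<kappa> * \<nu>)"
    using j x powr_mult[of "j / 2" "x powr \<kappa>" \<nu>] by (simp add: powr_powr)
  moreover have "\<kappa> * \<nu> = (1 - \<alpha>) / 2" using nu_eq kappa_eq by (metis (no_types) mult.assoc nonzero_mult_div_cancel_left zero_neq_numeral times_divide_eq_right)
  moreover have "x powr ((1 - \<alpha>) / 2) * x powr ((1 - \<alpha>) / 2) = x powr (1 - \<alpha>)"
    by (simp add: powr_add[symmetric])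
  moreover have "(j * x powr \<kappa>)\<^sup>2 = zero_sq n * x powr (2 - \<alpha>)"
    by (simp add: power_mult_distrib zero_sq_def j_def power2_eq_square powr_add[symmetric] flip: kappa_eq mult_2)
  ultimately have J: "of_real (x powr ((1 - \<alpha>) / 2)) * bessel_J \<nu> (of_real (j * x powr \<kappa>)) = of_real ((j / 2) powr \<nu> * sol (zero_sq n) x)"
    using j by (subst bessel_J_of_real) (auto simp: sol_def mult_ac simp flip: of_real_mult)
  have "phi \<alpha> n x = of_real (sqrt (2 * \<kappa>)) / of_real ((j / 2) powr \<nu> * flux (zero_sq n) 1 / (\<kappa> * j))
      * (of_real (x powr ((1 - \<alpha>) / 2)) * bessel_J \<nu> (of_real (j * x powr \<kappa>)))"
    unfolding phi_def deriv_bessel_J_zero[OF n] by (simp add: j_def)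
  also have "\<dots> = of_real (sqrt (2 * \<kappa>) / ((j / 2) powr \<nu> * flux (zero_sq n) 1 / (\<kappa> * j)) * ((j / 2) powr \<nu> * sol (zero_sq n) x))"
    unfolding J by simp
  also have "sqrt (2 * \<kappa>) / ((j / 2) powr \<nu> * flux (zero_sq n) 1 / (\<kappa> * j)) * ((j / 2) powr \<nu> * sol (zero_sq n) x) = mode n x"
    using j by (simp add: mode_def boundary_deriv_def j_def)
  finally show ?thesis .
qed

text \<open>
  The constant \<open>C\<close> absorbs the complex power of the square root. It stays anonymous because the inner
  products in \<open>xi_phi_inner\<close> are expressed through the boundary value of \<open>xi\<close>.
\<close>

lemma xi_eq:
  obtains C where "\<And>x. x > 0 \<Longrightarrow> xi \<alpha> lam n x = C * of_real (sol ((eigval \<alpha> n - lam) / \<kappa>\<^sup>2) x)"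
proof -
  define w where "w = csqrt (of_real (eigval \<alpha> n - lam)) / of_real \<kappa>"
  have w2: "w\<^sup>2 = of_real ((eigval \<alpha> n - lam) / \<kappa>\<^sup>2)"
    by (simp add: w_def power_divide)
  define C where "C = of_real (sqrt (2 * \<kappa>)) / deriv (bessel_J \<nu>) (of_real (bessel_zero \<nu> n)) * (w / 2) powr of_real \<nu>"
  have "xi \<alpha> lam n x = C * of_real (sol ((eigval \<alpha> n - lam) / \<kappa>\<^sup>2) x)" if x: "x > 0" for x
  proof -
    have "(w * of_real (x powr \<kappa>) / 2) powr of_real \<nu> = (w / 2) powr of_real \<nu> * of_real ((x powr \<kappa>) powr \<nu>)"
      using complex_powr_mult_of_real[of "x powr \<kappa>" "w / 2" \<nu>] x by simp
    moreover have "\<kappa> * \<nu> = (1 - \<alpha>) / 2" using nu_eq kappa_eq by (metis (no_types) mult.assoc nonzero_mult_div_cancel_left zero_neq_numeral times_divide_eq_right)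
    ultimately have 1: "(w * of_real (x powr \<kappa>) / 2) powr of_real \<nu> = (w / 2) powr of_real \<nu> * of_real (x powr ((1 - \<alpha>) / 2))"
      by (simp add: powr_powr)
    have "(x powr \<kappa>)\<^sup>2 = x powr (2 - \<alpha>)"
      by (simp add: power2_eq_square powr_add[symmetric] flip: kappa_eq mult_2)
    then have "(w * of_real (x powr \<kappa>))\<^sup>2 = of_real ((eigval \<alpha> n - lam) / \<kappa>\<^sup>2 * x powr (2 - \<alpha>))"
      unfolding power_mult_distrib w2 by (simp only: of_real_mult of_real_power[symmetric])
    then have 2: "bessel_entire \<nu> ((w * of_real (x powr \<kappa>))\<^sup>2) = of_real (bessel_entire \<nu> ((eigval \<alpha> n - lam) / \<kappa>\<^sup>2 * x powr (2 - \<alpha>)))"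
      using bessel_entire_of_real[of \<nu>] nu_pos by (simp only:)
    have 3: "(of_real (x powr ((1 - \<alpha>) / 2)) * of_real (x powr ((1 - \<alpha>) / 2)) :: complex) = of_real (x powr (1 - \<alpha>))"
      unfolding of_real_mult[symmetric] by (simp add: powr_add[symmetric])
    show ?thesis
      unfolding xi_def w_def[symmetric] bessel_J_eq 1 2 C_def sol_def of_real_mult 3[symmetric] by (simp only: mult_ac)
  qed
  then show thesis by (rule that)
qed

lemma vector_derivative_phi:
  assumes n: "n \<ge> 1"
  shows "vector_derivative (phi \<alpha> n) (at 1) = of_real (boundary_deriv n)"
proof -
  have "(mode n has_real_derivative boundary_deriv n) (at 1)"
    using DERIV_cmult[OF DERIV_sol[of 1 "zero_sq n"], of "boundary_deriv n / flux (zero_sq n) 1"] bessel_zero_facts(5)[OF n]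
    by (simp add: mode_def[abs_def])
  from has_vector_derivative_of_real[OF this]
  have "((\<lambda>x. of_real (mode n x) :: complex) has_vector_derivative of_real (boundary_deriv n)) (at 1)" .
  then have "(phi \<alpha> n has_vector_derivative of_real (boundary_deriv n)) (at 1)"
    by (rule has_vector_derivative_transform_within_open[where S = "{0<..}"]) (auto simp: phi_eq[OF n])
  then show ?thesis by (rule vector_derivative_at)
qed

lemma integral_of_real_unit:
  assumes "\<And>x. 0 < x \<Longrightarrow> x < 1 \<Longrightarrow> f x = of_real (g x)"
  shows "(LINT x|unit_interval. f x) = (of_real (LINT x|unit_interval. g x) :: complex)"
proof -
  have "(LINT x|unit_interval. f x) = (LINT x|unit_interval. of_real (g x))"
    by (rule Bochner_Integration.integral_cong) (use assms in \<open>auto simp: space_restrict_space\<close>)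
  then show ?thesis by simp
qed

lemma integral_sol_mode:
  assumes n: "n \<ge> 1" and r: "r \<noteq> zero_sq n"
  shows "(LINT x|unit_interval. sol r x * mode n x) = sol r 1 * boundary_deriv n / (r * \<kappa>\<^sup>2 - eigval \<alpha> n)"
proof -
  have "(LINT x|unit_interval. sol r x * mode n x) = (LINT x|unit_interval. sol r x * sol (zero_sq n) x) * (boundary_deriv n / flux (zero_sq n) 1)"
    by (simp add: mode_def mult_ac)
  also have "\<dots> = - (flux (zero_sq n) 1 * sol r 1) / ((zero_sq n - r) * \<kappa>\<^sup>2) * (boundary_deriv n / flux (zero_sq n) 1)"
    using bessel_zero_facts(4)[OF n] by (simp add: integral_sol_mult[OF r])
  also have "\<dots> = - sol r 1 * boundary_deriv n / ((zero_sq n - r) * \<kappa>\<^sup>2)"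
    using bessel_zero_facts(5)[OF n] by simp
  also have "\<dots> = sol r 1 * boundary_deriv n / (r * \<kappa>\<^sup>2 - eigval \<alpha> n)"
    unfolding bessel_zero_facts(6)[OF n] by (simp add: left_diff_distrib flip: minus_divide_right) (metis minus_diff_eq minus_divide_right)
  finally show ?thesis .
qed

lemma phi_orthonormal:
  assumes n: "n \<ge> 1" and m: "m \<ge> 1"
  shows "L2_inner unit_interval (phi \<alpha> n) (phi \<alpha> m) = (if n = m then 1 else 0)"
proof -
  have "L2_inner unit_interval (phi \<alpha> n) (phi \<alpha> m) = of_real (LINT x|unit_interval. mode n x * mode m x)"
    unfolding L2_inner_def by (rule integral_of_real_unit) (simp add: phi_eq[OF n] phi_eq[OF m])
  also have "(LINT x|unit_interval. mode n x * mode m x) = (if n = m then 1 else 0)"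
  proof (cases "n = m")
    case True
    have "(LINT x|unit_interval. mode n x * mode n x) = (boundary_deriv n / flux (zero_sq n) 1)\<^sup>2 * (LINT x|unit_interval. sol (zero_sq n) x * sol (zero_sq n) x)"
      unfolding mode_def power2_eq_square by (subst integral_mult_right_zero[symmetric]) (simp only: mult_ac)
    also have "\<dots> = (boundary_deriv n)\<^sup>2 / ((2 - \<alpha>) * (zero_sq n * \<kappa>\<^sup>2))"
      using bessel_zero_facts(2,4,5)[OF n] by (simp add: integral_sol_sq power_divide)
    also have "\<dots> = 1"
      unfolding bessel_zero_facts(8)[OF n] bessel_zero_facts(6)[OF n, symmetric] using bessel_zero_facts(7)[OF n] alpha by simp
    finally show ?thesis using True by simp
  next
    case False
    have "bessel_zero \<nu> n \<noteq> bessel_zero \<nu> m"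
      using False bessel_zero_less[of n m] bessel_zero_less[of m n] n m by (cases n m rule: linorder_cases) auto
    then have "zero_sq n \<noteq> zero_sq m"
      using bessel_zero_facts(1)[OF n] bessel_zero_facts(1)[OF m] by (simp add: zero_sq_def)
    then have "(LINT x|unit_interval. sol (zero_sq n) x * mode m x) = 0"
      using integral_sol_mode[OF m, of "zero_sq n"] bessel_zero_facts(4)[OF n] by simp
    then have "(LINT x|unit_interval. boundary_deriv n / flux (zero_sq n) 1 * (sol (zero_sq n) x * mode m x)) = 0" by simp
    then show ?thesis using False by (simp add: mode_def[of n] mult.assoc)
  qed
  finally show ?thesis by simp
qed

text \<open>
  The matrix of the transformation: \<open>xi\<close> solves the equation with eigenvalue parameter shifted by \<open>lam\<close>, and
  Green's formula leaves only the boundary term at 1, where \<open>phi\<close> vanishes but \<open>xi\<close> need not.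
\<close>

lemma xi_phi_inner:
  assumes m: "m \<ge> 1" and nr: "eigval \<alpha> n - lam \<noteq> eigval \<alpha> m"
  shows "L2_inner unit_interval (xi \<alpha> lam n) (phi \<alpha> m)
    = xi \<alpha> lam n 1 * (of_real (boundary_deriv m) / of_real (eigval \<alpha> n - lam - eigval \<alpha> m))"
proof -
  obtain C where C: "\<And>x. x > 0 \<Longrightarrow> xi \<alpha> lam n x = C * of_real (sol ((eigval \<alpha> n - lam) / \<kappa>\<^sup>2) x)"
    using xi_eq by blast
  define r where "r = (eigval \<alpha> n - lam) / \<kappa>\<^sup>2"
  have r: "r * \<kappa>\<^sup>2 = eigval \<alpha> n - lam" using kappa_pos by (simp add: r_def)
  then have ne: "r \<noteq> zero_sq m" using nr bessel_zero_facts(6)[OF m] by auto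
  have "L2_inner unit_interval (xi \<alpha> lam n) (phi \<alpha> m) = (LINT x|unit_interval. C * of_real (sol r x * mode m x))"
    unfolding L2_inner_def
    by (rule Bochner_Integration.integral_cong) (auto simp: space_restrict_space C r_def phi_eq[OF m])
  also have "\<dots> = C * of_real (LINT x|unit_interval. sol r x * mode m x)"
    by (simp only: integral_mult_right_zero integral_complex_of_real)
  also have "\<dots> = C * of_real (sol r 1) * (of_real (boundary_deriv m) / of_real (eigval \<alpha> n - lam - eigval \<alpha> m))"
    unfolding integral_sol_mode[OF m ne] r by simp
  finally show ?thesis using C[of 1] by (simp add: r_def)
qed

lemma sol_in_L2: "(\<lambda>x. of_real (sol r x)) \<in> L2 unit_interval"
proof -
  have "continuous_on {0..1} (sol r)" by (rule continuous_on_subset[OF continuous_on_sol]) auto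
  from unit_interval_integral(1)[OF this] have "sol r \<in> borel_measurable unit_interval" by auto
  moreover have "integrable unit_interval (\<lambda>x. sol r x * sol r x)"
    by (rule unit_interval_integral(1)[OF continuous_on_sol_mult])
  ultimately show ?thesis by (simp add: L2_def power2_eq_square)
qed

lemma L2_cong:
  assumes "f \<in> L2 unit_interval" and "\<And>x. 0 < x \<Longrightarrow> x < 1 \<Longrightarrow> f x = g x"
  shows "g \<in> L2 unit_interval"
proof -
  have "g \<in> borel_measurable unit_interval \<longleftrightarrow> f \<in> borel_measurable unit_interval"
    by (rule measurable_cong) (use assms(2) in \<open>auto simp: space_restrict_space\<close>)
  moreover have "integrable unit_interval (\<lambda>x. (norm (g x))\<^sup>2) \<longleftrightarrow> integrable unit_interval (\<lambda>x. (norm (f x))\<^sup>2)"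
    by (rule Bochner_Integration.integrable_cong) (use assms(2) in \<open>auto simp: space_restrict_space\<close>)
  ultimately show ?thesis using assms(1) by (simp add: L2_def)
qed

lemma phi_in_L2: "n \<ge> 1 \<Longrightarrow> phi \<alpha> n \<in> L2 unit_interval"
  by (rule L2_cong[OF L2_cmult[OF sol_in_L2, of "of_real (boundary_deriv n / flux (zero_sq n) 1)" "zero_sq n"]]) (simp add: phi_eq mode_def)

lemma xi_in_L2: "xi \<alpha> lam n \<in> L2 unit_interval"
proof -
  obtain C where C: "\<And>x. x > 0 \<Longrightarrow> xi \<alpha> lam n x = C * of_real (sol ((eigval \<alpha> n - lam) / \<kappa>\<^sup>2) x)"
    using xi_eq by blast
  show ?thesis by (rule L2_cong[OF L2_cmult[OF sol_in_L2]]) (simp add: C)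
qed

text \<open>
  For \<open>q = 0\<close> the solution is a multiple of \<open>x powr (1 - \<alpha>)\<close>. Its coefficients are proportional to the
  inverse square roots of the eigenvalues, so Bessel's inequality makes the reciprocals of the
  eigenvalues summable.
\<close>

lemma sol_0_phi_inner:
  assumes m: "m \<ge> 1"
  shows "L2_inner unit_interval (\<lambda>x. of_real (sol 0 x)) (phi \<alpha> m) = of_real (- sol 0 1 * boundary_deriv m / eigval \<alpha> m)"
    and "sol 0 1 \<noteq> 0"
proof -
  have "L2_inner unit_interval (\<lambda>x. of_real (sol 0 x)) (phi \<alpha> m) = of_real (LINT x|unit_interval. sol 0 x * mode m x)"
    unfolding L2_inner_def by (rule integral_of_real_unit) (simp add: phi_eq[OF m])
  also have "(LINT x|unit_interval. sol 0 x * mode m x) = - sol 0 1 * boundary_deriv m / eigval \<alpha> m"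
    using integral_sol_mode[OF m, of 0] bessel_zero_facts(2)[OF m] by simp
  finally show "L2_inner unit_interval (\<lambda>x. of_real (sol 0 x)) (phi \<alpha> m) = of_real (- sol 0 1 * boundary_deriv m / eigval \<alpha> m)" .
  show "sol 0 1 \<noteq> 0" using bessel_entire_0[of \<nu>] nu_pos by (simp add: sol_1)
qed

end

section \<open>Invertibility of the transformation\<close>

lemma sigma_finite_unit_interval: "sigma_finite_measure unit_interval"
  by (rule sigma_finite_measure_restrict_space) (auto simp: lborel.sigma_finite_measure_axioms)

lemma atLeast_1_eq_range_Suc: "{1..} = range Suc"
  by (auto simp: image_iff Suc_le_eq gr0_conv_Suc)

lemma summable_from_1_iff:
  fixes g :: "nat \<Rightarrow> real"
  assumes "\<And>m. g m \<ge> 0"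
  shows "g summable_on {1..} \<longleftrightarrow> summable (\<lambda>m. g (Suc m))"
proof -
  have "g summable_on {1..} \<longleftrightarrow> (g \<circ> Suc) summable_on UNIV"
    unfolding atLeast_1_eq_range_Suc by (rule summable_on_reindex) simp
  also have "\<dots> \<longleftrightarrow> summable (g \<circ> Suc)"
    by (rule summable_on_UNIV_nonneg_real_iff) (simp add: assms)
  finally show ?thesis by (simp add: o_def)
qed

lemma infsum_from_1:
  fixes g :: "nat \<Rightarrow> real"
  assumes "\<And>m. g m \<ge> 0" and "summable (\<lambda>m. g (Suc m))"
  shows "infsum g {1..} = (\<Sum>m. g (Suc m))"
proof -
  have "summable (g \<circ> Suc)" using assms(2) by (simp add: o_def)
  then have "(g \<circ> Suc) summable_on UNIV"
    by (subst summable_on_UNIV_nonneg_real_iff) (simp_all add: assms(1))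
  from has_sum_imp_sums[OF has_sum_infsum[OF this]]
  have "infsum (g \<circ> Suc) UNIV = (\<Sum>m. g (Suc m))" by (simp add: sums_iff o_def)
  moreover have "infsum g {1..} = infsum (g \<circ> Suc) UNIV"
    unfolding atLeast_1_eq_range_Suc by (rule infsum_reindex) simp
  ultimately show ?thesis by simp
qed

theorem theorem2:
  fixes \<alpha> lam :: real
    and c :: "nat \<Rightarrow> complex"
    and k :: "real \<Rightarrow> real \<Rightarrow> complex"
  assumes "0 < \<alpha>" and "\<alpha> < 1"
    and "0 < lam"
    and "\<And>n. n \<ge> 1 \<Longrightarrow> lam \<noteq> eigval \<alpha> n"
    and "\<And>n m. n \<ge> 1 \<Longrightarrow> m \<ge> 1 \<Longrightarrow> eigval \<alpha> n - lam \<noteq> eigval \<alpha> m"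
    and "admissible_coeffs \<alpha> lam c"
    and "is_kernel \<alpha> lam c k"
  shows "L2_linear_operator unit_interval (kernel_transform k) \<and>
         L2_continuous unit_interval (kernel_transform k) \<and>
         L2_invertible unit_interval (kernel_transform k)"
proof -
  interpret degenerate_operator \<alpha> by unfold_locales fact+
  define e where "e n = phi \<alpha> (Suc n)" for n
  define p where "p n = psi \<alpha> lam c (Suc n)" for n
  have e: "e n \<in> L2 unit_interval" for n unfolding e_def by (rule phi_in_L2) simp
  have xi: "xi \<alpha> lam n \<in> L2 unit_interval" for n by (rule xi_in_L2)
  have p: "p n \<in> L2 unit_interval" for n
    unfolding p_def psi_def[abs_def] by (intro L2_diff L2_cmult phi_in_L2 xi) simp
  have on: "L2_inner unit_interval (e n) (e m) = (if n = m then 1 else 0)" for n m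
    unfolding e_def by (subst phi_orthonormal) auto
  have kernel: "\<And>n. n \<ge> 1 \<Longrightarrow> (\<lambda>(x, y). psi \<alpha> lam c n x * phi \<alpha> n y) \<in> L2 (unit_interval \<Otimes>\<^sub>M unit_interval)"
    "(\<lambda>(x, y). k x y) \<in> L2 (unit_interval \<Otimes>\<^sub>M unit_interval)"
    "(\<lambda>N. L2_norm (unit_interval \<Otimes>\<^sub>M unit_interval)
        (\<lambda>z. (\<Sum>n=1..N. (\<lambda>(x, y). psi \<alpha> lam c n x * phi \<alpha> n y) z) - (\<lambda>(x, y). k x y) z)) \<longlonglongrightarrow> 0"
    using \<open>is_kernel \<alpha> lam c k\<close> unfolding is_kernel_def L2_sums_def by blast+
  interpret sf: sigma_finite_measure unit_interval by (rule sigma_finite_unit_interval)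
  interpret KE: kernel_expansion unit_interval e p k
  proof
    show "cnj (e n x) = e n x" if "x \<in> space unit_interval" for n x
      using that by (simp add: e_def phi_eq space_restrict_space)
    show "(\<lambda>(x, y). p n x * e n y) \<in> L2 (unit_interval \<Otimes>\<^sub>M unit_interval)" for n
      unfolding p_def e_def by (rule kernel(1)) simp
    have "L2_sq (unit_interval \<Otimes>\<^sub>M unit_interval) (\<lambda>(x, y). k x y - (\<Sum>n<N. p n x * e n y))
        = (L2_norm (unit_interval \<Otimes>\<^sub>M unit_interval)
        (\<lambda>z. (\<Sum>n=1..N. (\<lambda>(x, y). psi \<alpha> lam c n x * phi \<alpha> n y) z) - (\<lambda>(x, y). k x y) z))\<^sup>2" for N
      unfolding L2_norm_eq real_sqrt_pow2[OF L2_sq_nonneg]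
      by (subst L2_sq_uminus[symmetric]) (simp add: case_prod_unfold p_def e_def sum.atLeast1_atMost_eq)
    then show "(\<lambda>N. L2_sq (unit_interval \<Otimes>\<^sub>M unit_interval) (\<lambda>(x, y). k x y - (\<Sum>n<N. p n x * e n y))) \<longlonglongrightarrow> 0"
      using tendsto_power[OF kernel(3), of 2] by simp
  qed (fact e on p kernel(2))+
  have T: "KE.T = kernel_transform k"
    by (intro ext) (simp add: KE.T_def KE.K_def kernel_transform_def)

  define L where "L n = eigval \<alpha> (Suc n)" for n
  define b where "b n = boundary_deriv (Suc n)" for n
  define d where "d n = c (Suc n) * xi \<alpha> lam (Suc n) 1" for n
  have L_pos: "L n > 0" for n unfolding L_def by (rule bessel_zero_facts) simp
  have b_sq: "(b n)\<^sup>2 = (2 - \<alpha>) * L n" for n unfolding b_def L_def by (rule bessel_zero_facts) simp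
  have L_sum: "summable (\<lambda>n. 1 / L n)"
  proof -
    have "(norm (L2_inner unit_interval (\<lambda>x. of_real (sol 0 x)) (e n)))\<^sup>2 = (sol 0 1)\<^sup>2 * (2 - \<alpha>) * (1 / L n)" for n
    proof -
      have "L2_inner unit_interval (\<lambda>x. of_real (sol 0 x)) (e n) = of_real (- sol 0 1 * b n / L n)"
        unfolding e_def b_def L_def by (rule sol_0_phi_inner(1)) simp
      then have "(norm (L2_inner unit_interval (\<lambda>x. of_real (sol 0 x)) (e n)))\<^sup>2 = (- sol 0 1 * b n / L n)\<^sup>2"
        by (simp only: norm_of_real power2_abs)
      also have "\<dots> = (sol 0 1)\<^sup>2 * (2 - \<alpha>) * (1 / L n)"
        using L_pos[of n] by (simp add: power_divide power_mult_distrib b_sq) (simp add: power2_eq_square)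
      finally show ?thesis .
    qed
    moreover have "summable (\<lambda>n. (norm (L2_inner unit_interval (\<lambda>x. of_real (sol 0 x)) (e n)))\<^sup>2)"
      by (rule summableI_nonneg_bounded[OF _ Bessel_inequality[OF e on sol_in_L2]]) simp
    ultimately have "summable (\<lambda>n. (sol 0 1)\<^sup>2 * (2 - \<alpha>) * (1 / L n))" by simp
    then show ?thesis using sol_0_phi_inner(2)[of 1] alpha by (subst (asm) summable_cmult_iff) auto
  qed
  interpret BS: boundary_system L b d lam "2 - \<alpha>"
  proof
    show "strict_mono L"
    proof (rule strict_monoI)
      fix m n :: nat assume "m < n"
      then have "bessel_zero \<nu> (Suc m) < bessel_zero \<nu> (Suc n)" by (intro bessel_zero_less) auto
      then show "L m < L n"
        unfolding L_def eigval_def using bessel_zero_facts(1)[of "Suc m"] kappa_pos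
        by (intro power_strict_mono) auto
    qed
    show "L n - lam \<noteq> L m" for n m unfolding L_def by (rule assms(5)) auto
  qed (use assms L_pos b_sq L_sum in auto)

  have mat: "KE.coeff_matrix m n = (if n = m then 1 else 0) - BS.entry m n" for m n
  proof -
    have "KE.coeff_matrix m n = L2_inner unit_interval (e n) (e m) - c (Suc n) * L2_inner unit_interval (xi \<alpha> lam (Suc n)) (e m)"
      unfolding KE.coeff_matrix_def p_def psi_def[abs_def] e_def[of n, symmetric]
      by (subst L2_inner_diff) (auto intro: e L2_cmult xi simp: L2_inner_cmult)
    also have "L2_inner unit_interval (xi \<alpha> lam (Suc n)) (e m) = xi \<alpha> lam (Suc n) 1 * (of_real (b m) / of_real (L n - lam - L m))"
      unfolding e_def b_def L_def by (rule xi_phi_inner) (use assms(5) in auto)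
    finally show ?thesis by (simp add: on BS.entry_def d_def mult.assoc)
  qed
  \<comment> \<open>the n-th diagonal entry of the matrix of K is 1 + b n d n / lam\<close>
  have D: "norm (of_real (b n) * d n) \<le> lam * (1 + sqrt (\<Sum>n. L2_sq unit_interval (p n)))" for n
  proof -
    have "(norm (KE.coeff_matrix n n))\<^sup>2 \<le> L2_sq unit_interval (p n) * L2_sq unit_interval (e n)"
      unfolding KE.coeff_matrix_def by (rule L2_inner_bound[OF p e])
    also have "L2_sq unit_interval (e n) = 1"
      using L2_inner_self[of unit_interval "e n"] on[of n n] by (metis of_real_eq_1_iff)
    also have "L2_sq unit_interval (p n) * 1 \<le> (\<Sum>n. L2_sq unit_interval (p n))"
      using sum_le_suminf[OF KE.summable_p, of "{n}"] by (simp add: L2_sq_nonneg)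
    finally have "norm (KE.coeff_matrix n n) \<le> sqrt (\<Sum>n. L2_sq unit_interval (p n))" by (rule real_le_rsqrt)
    moreover have "of_real (b n) * d n = of_real lam * (KE.coeff_matrix n n - 1)"
      using \<open>0 < lam\<close> by (simp add: mat BS.entry_def mult.commute)
    then have "norm (of_real (b n) * d n) = lam * norm (KE.coeff_matrix n n - 1)"
      using \<open>0 < lam\<close> by (simp only: norm_mult norm_of_real abs_of_pos)
    moreover have "norm (KE.coeff_matrix n n - 1) \<le> norm (KE.coeff_matrix n n) + 1"
      using norm_triangle_ineq4[of "KE.coeff_matrix n n" 1] by simp
    ultimately show ?thesis using \<open>0 < lam\<close> by simp
  qed

  define a where "a n m = of_real (b n) * ((if n = m then 1 else 0) - BS.entry m n)" for n m
  have emb: "dual_embed \<alpha> (\<lambda>x. vector_derivative (phi \<alpha> (Suc n)) (at 1) * psi \<alpha> lam c (Suc n) x) (Suc m) = a n m" for n m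
  proof -
    have "vector_derivative (phi \<alpha> (Suc n)) (at 1) = of_real (b n)"
      unfolding b_def by (rule vector_derivative_phi) simp
    then have "dual_embed \<alpha> (\<lambda>x. vector_derivative (phi \<alpha> (Suc n)) (at 1) * psi \<alpha> lam c (Suc n) x) (Suc m) = of_real (b n) * KE.coeff_matrix m n"
      by (simp add: dual_embed_def L2_inner_cmult KE.coeff_matrix_def p_def e_def)
    then show ?thesis by (simp add: a_def mat)
  qed
  have dual: "\<And>n. n \<ge> 1 \<Longrightarrow> dual_embed \<alpha> (\<lambda>x. vector_derivative (phi \<alpha> n) (at 1) * psi \<alpha> lam c n x) \<in> dual_space \<alpha>"
    "(\<lambda>N. dual_norm \<alpha> (\<lambda>m. (\<Sum>n=1..N. dual_embed \<alpha> (\<lambda>x. vector_derivative (phi \<alpha> n) (at 1) * psi \<alpha> lam c n x) m) - 0)) \<longlonglongrightarrow> 0"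
    using \<open>admissible_coeffs \<alpha> lam c\<close> unfolding admissible_coeffs_def dual_sums_def by blast+
  have eig_nn: "(norm (v m :: complex))\<^sup>2 / eigval \<alpha> m \<ge> 0" for v m by (simp add: eigval_def)
  have sq_div: "(norm (v / of_real (sqrt (L m)) :: complex))\<^sup>2 = (norm v)\<^sup>2 / L m" for v m
    using L_pos[of m] by (simp add: norm_divide power_divide)
  have a_sum: "summable (\<lambda>m. (norm (a n m / of_real (sqrt (L m))))\<^sup>2)" for n
  proof -
    have "(\<lambda>m. (norm (dual_embed \<alpha> (\<lambda>x. vector_derivative (phi \<alpha> (Suc n)) (at 1) * psi \<alpha> lam c (Suc n) x) m))\<^sup>2 / eigval \<alpha> m) summable_on {1..}"
      using dual(1)[of "Suc n"] by (simp add: dual_space_def)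
    then have "summable (\<lambda>m. (norm (dual_embed \<alpha> (\<lambda>x. vector_derivative (phi \<alpha> (Suc n)) (at 1) * psi \<alpha> lam c (Suc n) x) (Suc m)))\<^sup>2 / eigval \<alpha> (Suc m))"
      by (rule iffD1[OF summable_from_1_iff, rotated]) (rule eig_nn)
    then show ?thesis unfolding emb L_def[symmetric] sq_div .
  qed
  have res_sum: "summable (\<lambda>m. (norm (\<Sum>n<N. a n m))\<^sup>2 / L m)" for N
  proof -
    have "summable (\<lambda>m. (norm (\<Sum>n<N. a n m / of_real (sqrt (L m))))\<^sup>2)"
    proof (induction N)
      case (Suc N)
      then show ?case using sq_summable_add[OF Suc.IH a_sum[of N]] by simp
    qed simp
    then show ?thesis unfolding sum_divide_distrib[symmetric] sq_div .
  qed
  have "dual_norm \<alpha> (\<lambda>m. (\<Sum>n=1..N. dual_embed \<alpha> (\<lambda>x. vector_derivative (phi \<alpha> n) (at 1) * psi \<alpha> lam c n x) m) - 0)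
      = sqrt (\<Sum>m. (norm (\<Sum>n<N. a n m))\<^sup>2 / L m)" for N
  proof -
    define g where "g m = (norm ((\<Sum>n=1..N. dual_embed \<alpha> (\<lambda>x. vector_derivative (phi \<alpha> n) (at 1) * psi \<alpha> lam c n x) m) - 0))\<^sup>2 / eigval \<alpha> m" for m
    have g: "g (Suc m) = (norm (\<Sum>n<N. a n m))\<^sup>2 / L m" for m
      by (simp add: g_def sum.atLeast1_atMost_eq emb L_def)
    have nn: "g m \<ge> 0" for m unfolding g_def by (rule eig_nn)
    from infsum_from_1[of g, OF nn, unfolded g, OF res_sum] show ?thesis
      unfolding dual_norm_def g_def[symmetric] g by simp
  qed
  then have "(\<lambda>N. (sqrt (\<Sum>m. (norm (\<Sum>n<N. a n m))\<^sup>2 / L m))\<^sup>2) \<longlonglongrightarrow> 0\<^sup>2"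
    using dual(2) by (intro tendsto_power) simp
  moreover have "(sqrt (\<Sum>m. (norm (\<Sum>n<N. a n m))\<^sup>2 / L m))\<^sup>2 = (\<Sum>m. (norm (\<Sum>n<N. a n m))\<^sup>2 / L m)" for N
    by (rule real_sqrt_pow2, rule suminf_nonneg[OF res_sum]) (use L_pos in \<open>simp add: less_imp_le\<close>)
  ultimately have res_lim: "(\<lambda>N. \<Sum>m. (norm (\<Sum>n<N. a n m))\<^sup>2 / L m) \<longlonglongrightarrow> 0" by simp

  have "x = 0" if x: "matrix_op (\<lambda>n m. KE.coeff_matrix m n) x = x" for x
  proof (rule ell2_eqI)
    fix m
    have "coord x m = 0"
    proof (rule BS.orthogonal_to_range_imp_zero[OF D res_sum[unfolded a_def] res_lim[unfolded a_def] coord_summable])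
      fix n
      have se: "summable (\<lambda>m. coord x m * BS.entry m n)" by (rule BS.summable_entry[OF coord_summable])
      have "(\<lambda>m. if m = n then coord x m else 0) sums coord x n" by (rule sums_single)
      from sums_diff[OF this summable_sums[OF se]]
      have "(\<lambda>m. KE.coeff_matrix m n * coord x m) sums (coord x n - (\<Sum>m. coord x m * BS.entry m n))"
        by (rule back_subst[where P = "\<lambda>f. f sums _"]) (auto simp: mat algebra_simps)
      moreover have "(\<Sum>m. KE.coeff_matrix m n * coord x m) = coord x n"
        using coord_matrix_op[OF KE.coeff_matrix_transpose_hilbert_schmidt, of x n] x by simp
      ultimately show "(\<Sum>m. coord x m * BS.entry m n) = 0" by (simp add: sums_iff)
    qed
    then show "coord x m = coord 0 m" by (simp add: zero_ell2.rep_eq)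
  qed
  then have "L2_invertible unit_interval KE.T" by (rule KE.T_invertible)
  with KE.T_linear KE.T_continuous show ?thesis by (simp add: T)
qed

end
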